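(* Let $N\ge1$ be an odd integer, $n\ge2$ an integer, $\lambda=\pm1$, and let $\boldsymbol{k}$ be a field whose characteristic does not divide $2nN$ and which contains a primitive $4nN$-th root of unity. Suppose that $\lambda=-1$, or that $\lambda=1$ and $n$ is odd. Then the Hopf algebra $A_{Nn}^{+\lambda}$ is self-dual.
   Context: For $N\ge 1$, $n\ge 2$ and $\nu,\lambda=\pm1$, Suzuki's Hopf algebra $A_{Nn}^{\nu\lambda}$ is the $\boldsymbol{k}$-algebra generated by $x_{11},x_{12},x_{21},x_{22}$ with relations $x_{11}^2=x_{22}^2$, $x_{12}^2=x_{21}^2$, $x_{ij}x_{lm}=0$ whenever $i-j\not\equiv l-m\pmod 2$, $x_{11}^{2N}+\nu x_{12}^{2N}=1$, $\underbrace{x_{11}x_{22}x_{11}\cdots}_{n}=\underbrace{x_{22}x_{11}x_{22}\cdots}_{n}$, $\underbrace{x_{21}x_{12}x_{21}\cdots}_{n}=\lambda\underbrace{x_{12}x_{21}x_{12}\cdots}_{n}$ (alternating words of length $n$), with $\Delta(x_{ij})=x_{i1}\otimes x_{1j}+x_{i2}\otimes x_{2j}$, $\varepsilon(x_{ij})=\delta_{ij}$, $S(x_{ij})=x_{ji}^{2N-1}$. It has dimension $4nN$. $A_{Nn}^{+\lambda}$ means $\nu=1$. A finite-dimensional Hopf algebra $A$ is self-dual if $A$ is isomorphic to the dual Hopf algebra $A^\ast$ as a Hopf algebra. *)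

theory Defs
  imports
    "HOL-Algebra.QuotRing"
    "HOL-Algebra.Algebraic_Closure_Type"
    "HOL-Library.Poly_Mapping"
    "HOL-Library.Numeral_Type"
begin

text \<open>
  The ground field is a type \<open>'k\<close> of class \<^class>\<open>field\<close>; vector spaces and algebras over it are
  records of the \<open>module\<close> type of HOL-Algebra over \<open>ring_of_type_algebra :: 'k ring\<close>. For plain
  vector spaces the fields \<open>mult\<close> and \<open>one\<close> are irrelevant.
\<close>

definition scalar_algebra :: "('k::field, 'k) module" where
  "scalar_algebra = ring.extend ring_of_type_algebra (module.fields (*))"

definition k_space :: "('k::field, 'a, 'm) module_scheme \<Rightarrow> bool" where
  "k_space V \<longleftrightarrow> module (ring_of_type_algebra :: 'k ring) V"

text \<open>The locale \<open>algebra\<close> of HOL-Algebra is restricted to commutative algebras.\<close>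

definition k_algebra :: "('k::field, 'a, 'm) module_scheme \<Rightarrow> bool" where
  "k_algebra A \<longleftrightarrow> k_space A \<and> ring A \<and>
     (\<forall>c. \<forall>x\<in>carrier A. \<forall>y\<in>carrier A.
        (c \<odot>\<^bsub>A\<^esub> x) \<otimes>\<^bsub>A\<^esub> y = c \<odot>\<^bsub>A\<^esub> (x \<otimes>\<^bsub>A\<^esub> y) \<and>
        x \<otimes>\<^bsub>A\<^esub> (c \<odot>\<^bsub>A\<^esub> y) = c \<odot>\<^bsub>A\<^esub> (x \<otimes>\<^bsub>A\<^esub> y))"

definition linear_maps ::
  "('k::field, 'a, 'm) module_scheme \<Rightarrow> ('k, 'b, 'n) module_scheme \<Rightarrow> ('a \<Rightarrow> 'b) set" where
  "linear_maps V W = {f \<in> carrier V \<rightarrow> carrier W.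
     (\<forall>x\<in>carrier V. \<forall>y\<in>carrier V. f (x \<oplus>\<^bsub>V\<^esub> y) = f x \<oplus>\<^bsub>W\<^esub> f y) \<and>
     (\<forall>c. \<forall>x\<in>carrier V. f (c \<odot>\<^bsub>V\<^esub> x) = c \<odot>\<^bsub>W\<^esub> f x)}"

definition algebra_maps ::
  "('k::field, 'a, 'm) module_scheme \<Rightarrow> ('k, 'b, 'n) module_scheme \<Rightarrow> ('a \<Rightarrow> 'b) set" where
  "algebra_maps A B = linear_maps A B \<inter> ring_hom A B"

definition finite_dimensional :: "('k::field, 'a, 'm) module_scheme \<Rightarrow> bool" where
  "finite_dimensional V \<longleftrightarrow> (\<exists>B. finite B \<and> B \<subseteq> carrier V \<and>
     (\<forall>x\<in>carrier V. \<exists>c :: 'a \<Rightarrow> 'k. x = (\<Oplus>\<^bsub>V\<^esub>b\<in>B. c b \<odot>\<^bsub>V\<^esub> b)))"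

definition opposite :: "('k, 'a) module \<Rightarrow> ('k, 'a) module" where
  "opposite A = A\<lparr>monoid.mult := \<lambda>x y. y \<otimes>\<^bsub>A\<^esub> x\<rparr>"

text \<open>
  The quotient by a subspace \<open>I\<close> (by a two-sided ideal, if \<open>M\<close> is an algebra). The union takes all
  representatives \<open>x\<close> of \<open>Q\<close>; all of them contribute the same coset.
\<close>

definition quotient :: "('k, 'a, 'm) module_scheme \<Rightarrow> 'a set \<Rightarrow> ('k, 'a set) module" where
  "quotient M I =
     ring.extend (M Quot I) (module.fields (\<lambda>c Q. \<Union>x\<in>Q. I +>\<^bsub>M\<^esub> (c \<odot>\<^bsub>M\<^esub> x)))"


section \<open>Tensor products\<close>

abbreviation pm_scale :: "'k::field \<Rightarrow> ('a \<Rightarrow>\<^sub>0 'k) \<Rightarrow> ('a \<Rightarrow>\<^sub>0 'k)" where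
  "pm_scale c p \<equiv> Poly_Mapping.map ((*) c) p"

definition free_space :: "'a set \<Rightarrow> ('k::field, 'a \<Rightarrow>\<^sub>0 'k) module" where
  "free_space S = \<lparr>carrier = {p. Poly_Mapping.keys p \<subseteq> S}, monoid.mult = undefined, one = undefined,
     zero = 0, add = (+), module.smult = pm_scale\<rparr>"

inductive_set tensor_null ::
  "('k::field, 'a, 'm) module_scheme \<Rightarrow> ('k, 'b, 'n) module_scheme \<Rightarrow> ('a \<times> 'b \<Rightarrow>\<^sub>0 'k) set"
  for V W where
  null_zero: "0 \<in> tensor_null V W"
| null_add: "p \<in> tensor_null V W \<Longrightarrow> q \<in> tensor_null V W \<Longrightarrow> p + q \<in> tensor_null V W"
| null_scale: "p \<in> tensor_null V W \<Longrightarrow> pm_scale c p \<in> tensor_null V W"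
| add_left: "v \<in> carrier V \<Longrightarrow> v' \<in> carrier V \<Longrightarrow> w \<in> carrier W \<Longrightarrow>
    Poly_Mapping.single (v \<oplus>\<^bsub>V\<^esub> v', w) 1 - Poly_Mapping.single (v, w) 1
      - Poly_Mapping.single (v', w) 1 \<in> tensor_null V W"
| add_right: "v \<in> carrier V \<Longrightarrow> w \<in> carrier W \<Longrightarrow> w' \<in> carrier W \<Longrightarrow>
    Poly_Mapping.single (v, w \<oplus>\<^bsub>W\<^esub> w') 1 - Poly_Mapping.single (v, w) 1
      - Poly_Mapping.single (v, w') 1 \<in> tensor_null V W"
| smult_left: "v \<in> carrier V \<Longrightarrow> w \<in> carrier W \<Longrightarrow>
    Poly_Mapping.single (c \<odot>\<^bsub>V\<^esub> v, w) 1 - pm_scale c (Poly_Mapping.single (v, w) 1) \<in> tensor_null V W"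
| smult_right: "v \<in> carrier V \<Longrightarrow> w \<in> carrier W \<Longrightarrow>
    Poly_Mapping.single (v, c \<odot>\<^bsub>W\<^esub> w) 1 - pm_scale c (Poly_Mapping.single (v, w) 1) \<in> tensor_null V W"

type_synonym ('k, 'a, 'b) tensor = "('a \<times> 'b \<Rightarrow>\<^sub>0 'k) set"

definition tensor_space ::
  "('k::field, 'a, 'm) module_scheme \<Rightarrow> ('k, 'b, 'n) module_scheme \<Rightarrow> ('k, ('k, 'a, 'b) tensor) module" where
  "tensor_space V W = quotient (free_space (carrier V \<times> carrier W)) (tensor_null V W)"

definition pure_tensor ::
  "('k::field, 'a, 'm) module_scheme \<Rightarrow> ('k, 'b, 'n) module_scheme \<Rightarrow> 'a \<Rightarrow> 'b \<Rightarrow> ('k, 'a, 'b) tensor" where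
  "pure_tensor V W v w =
     tensor_null V W +>\<^bsub>free_space (carrier V \<times> carrier W)\<^esub> Poly_Mapping.single (v, w) 1"

text \<open>
  The linear map \<open>V \<otimes> W \<rightarrow> Z\<close> induced by a bilinear map \<open>\<beta>\<close>. For bilinear \<open>\<beta>\<close> the image of a coset
  under the linear extension of \<open>\<beta>\<close> is a singleton, whose element is the value.
\<close>

definition tensor_lift ::
  "('k::field, 'c, 'm) module_scheme \<Rightarrow> ('a \<Rightarrow> 'b \<Rightarrow> 'c) \<Rightarrow> ('k, 'a, 'b) tensor \<Rightarrow> 'c" where
  "tensor_lift Z \<beta> Q = the_elem
     ((\<lambda>p. \<Oplus>\<^bsub>Z\<^esub>x\<in>Poly_Mapping.keys p. Poly_Mapping.lookup p x \<odot>\<^bsub>Z\<^esub> \<beta> (fst x) (snd x)) ` Q)"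

definition tensor_map ::
  "('k::field, 'c, 'm) module_scheme \<Rightarrow> ('k, 'd, 'n) module_scheme \<Rightarrow>
   ('a \<Rightarrow> 'c) \<Rightarrow> ('b \<Rightarrow> 'd) \<Rightarrow> ('k, 'a, 'b) tensor \<Rightarrow> ('k, 'c, 'd) tensor" where
  "tensor_map V' W' f g =
     tensor_lift (tensor_space V' W') (\<lambda>v w. pure_tensor V' W' (f v) (g w))"

definition tensor_assoc ::
  "('k::field, 'a, 'm) module_scheme \<Rightarrow> ('k, 'b, 'n) module_scheme \<Rightarrow> ('k, 'c, 'o) module_scheme \<Rightarrow>
   ('k, ('k, 'a, 'b) tensor, 'c) tensor \<Rightarrow> ('k, 'a, ('k, 'b, 'c) tensor) tensor" where
  "tensor_assoc U V W = (let VW = tensor_space V W; T = tensor_space U VW in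
     tensor_lift T (\<lambda>Q w. tensor_lift T (\<lambda>u v. pure_tensor U VW u (pure_tensor V W v w)) Q))"

text \<open>\<open>(v \<otimes> w)(v' \<otimes> w') = vv' \<otimes> ww'\<close>, extended bilinearly.\<close>

definition tensor_algebra ::
  "('k::field, 'a, 'm) module_scheme \<Rightarrow> ('k, 'b, 'n) module_scheme \<Rightarrow> ('k, ('k, 'a, 'b) tensor) module" where
  "tensor_algebra A B = (tensor_space A B)
     \<lparr>monoid.mult := \<lambda>P Q. tensor_lift (tensor_space A B) (\<lambda>v w.
                tensor_lift (tensor_space A B) (\<lambda>v' w'.
                  pure_tensor A B (v \<otimes>\<^bsub>A\<^esub> v') (w \<otimes>\<^bsub>B\<^esub> w')) Q) P,
      one := pure_tensor A B \<one>\<^bsub>A\<^esub> \<one>\<^bsub>B\<^esub>\<rparr>"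


section \<open>Hopf algebras and their duals\<close>

record (overloaded) ('k::zero, 'a) hopf = "('k, 'a) module" +
  comult :: "'a \<Rightarrow> ('a \<times> 'a \<Rightarrow>\<^sub>0 'k) set"
  counit :: "'a \<Rightarrow> 'k"
  antipode :: "'a \<Rightarrow> 'a"

definition hopf_algebra :: "('k::field, 'a) hopf \<Rightarrow> bool" where
  "hopf_algebra H \<longleftrightarrow>
     k_algebra H \<and>
     comult H \<in> algebra_maps H (tensor_algebra H H) \<and>
     counit H \<in> algebra_maps H scalar_algebra \<and>
     antipode H \<in> linear_maps H H \<and>
     (\<forall>x\<in>carrier H.
        tensor_assoc H H H (tensor_map (tensor_space H H) H (comult H) id (comult H x)) =
        tensor_map H (tensor_space H H) id (comult H) (comult H x)) \<and>
     (\<forall>x\<in>carrier H. tensor_lift H (\<lambda>a b. counit H a \<odot>\<^bsub>H\<^esub> b) (comult H x) = x) \<and>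
     (\<forall>x\<in>carrier H. tensor_lift H (\<lambda>a b. counit H b \<odot>\<^bsub>H\<^esub> a) (comult H x) = x) \<and>
     (\<forall>x\<in>carrier H. tensor_lift H (\<lambda>a b. antipode H a \<otimes>\<^bsub>H\<^esub> b) (comult H x) = counit H x \<odot>\<^bsub>H\<^esub> \<one>\<^bsub>H\<^esub>) \<and>
     (\<forall>x\<in>carrier H. tensor_lift H (\<lambda>a b. a \<otimes>\<^bsub>H\<^esub> antipode H b) (comult H x) = counit H x \<odot>\<^bsub>H\<^esub> \<one>\<^bsub>H\<^esub>)"

definition hopf_isos :: "('k::field, 'a) hopf \<Rightarrow> ('k, 'b) hopf \<Rightarrow> ('a \<Rightarrow> 'b) set" where
  "hopf_isos H G = {\<phi> \<in> algebra_maps H G. bij_betw \<phi> (carrier H) (carrier G) \<and>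
     (\<forall>x\<in>carrier H. comult G (\<phi> x) = tensor_map G G \<phi> \<phi> (comult H x)) \<and>
     (\<forall>x\<in>carrier H. counit G (\<phi> x) = counit H x) \<and>
     (\<forall>x\<in>carrier H. antipode G (\<phi> x) = \<phi> (antipode H x))}"

text \<open>
  The dual of a finite-dimensional Hopf algebra. Functionals are made extensional, so that equality
  of functions is equality of functionals. The product is \<open>fg = (f \<otimes> g) \<circ> \<Delta>\<close> with unit \<open>\<epsilon>\<close>.
\<close>

definition dual_algebra :: "('k::field, 'a) hopf \<Rightarrow> ('k, 'a \<Rightarrow> 'k) module" where
  "dual_algebra H =
     \<lparr>carrier = linear_maps H scalar_algebra \<inter> extensional (carrier H),
      monoid.mult = \<lambda>f g. \<lambda>x\<in>carrier H. tensor_lift scalar_algebra (\<lambda>a b. f a * g b) (comult H x),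
      one = \<lambda>x\<in>carrier H. counit H x,
      zero = \<lambda>x\<in>carrier H. 0,
      add = \<lambda>f g. \<lambda>x\<in>carrier H. f x + g x,
      module.smult = \<lambda>c f. \<lambda>x\<in>carrier H. c * f x\<rparr>"

text \<open>
  \<open>\<Delta>(f)\<close> is the preimage of \<open>f \<circ> m\<close> under the canonical map from \<open>H* \<otimes> H*\<close> to \<open>(H \<otimes> H)*\<close>, a
  bijection as \<open>H\<close> is finite-dimensional.
\<close>

definition dual_hopf :: "('k::field, 'a) hopf \<Rightarrow> ('k, 'a \<Rightarrow> 'k) hopf" where
  "dual_hopf H = module.extend (dual_algebra H) (hopf.fields
     (\<lambda>f. THE t. t \<in> carrier (tensor_space (dual_algebra H) (dual_algebra H)) \<and>
        (\<forall>a\<in>carrier H. \<forall>b\<in>carrier H.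
           tensor_lift scalar_algebra (\<lambda>g h. g a * h b) t = f (a \<otimes>\<^bsub>H\<^esub> b)))
     (\<lambda>f. f \<one>\<^bsub>H\<^esub>)
     (\<lambda>f. \<lambda>x\<in>carrier H. f (antipode H x)))"

definition self_dual :: "('k::field, 'a) hopf \<Rightarrow> bool" where
  "self_dual H \<longleftrightarrow>
     hopf_algebra H \<and> finite_dimensional H \<and> hopf_isos H (dual_hopf H) \<noteq> {}"


section \<open>Algebras given by generators and relations\<close>

text \<open>
  Words form the free monoid, so that the library's convolution product on \<^typ>\<open>'x list \<Rightarrow>\<^sub>0 'k\<close> is
  the product of the free associative algebra.
\<close>

instantiation list :: (type) monoid_add
begin
definition zero_list :: "'a list" where "zero_list = []"
definition plus_list :: "'a list \<Rightarrow> 'a list \<Rightarrow> 'a list" where "plus_list = (@)"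
instance by standard (simp_all add: zero_list_def plus_list_def)
end

definition free_algebra :: "('k::field, 'x list \<Rightarrow>\<^sub>0 'k) module" where
  "free_algebra = \<lparr>carrier = UNIV, monoid.mult = (*), one = 1, zero = 0, add = (+), module.smult = pm_scale\<rparr>"

definition free_gen :: "'x \<Rightarrow> ('x list \<Rightarrow>\<^sub>0 'k::field)" where
  "free_gen x = Poly_Mapping.single [x] 1"

definition presented_algebra :: "('x list \<Rightarrow>\<^sub>0 'k) set \<Rightarrow> ('k::field, ('x list \<Rightarrow>\<^sub>0 'k) set) module" where
  "presented_algebra R = quotient free_algebra (Idl\<^bsub>free_algebra\<^esub> R)"

definition presented_gen :: "('x list \<Rightarrow>\<^sub>0 'k) set \<Rightarrow> 'x \<Rightarrow> ('x list \<Rightarrow>\<^sub>0 'k::field) set" where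
  "presented_gen R x = (Idl\<^bsub>free_algebra\<^esub> R) +>\<^bsub>free_algebra\<^esub> free_gen x"

text \<open>
  The algebra map to \<open>B\<close> sending each generator \<open>x\<close> to \<open>f x\<close>: the one on the free algebra, and the
  one it induces on a presented algebra whose relations it respects.
\<close>

definition free_lift ::
  "('k::field, 'b, 'm) module_scheme \<Rightarrow> ('x \<Rightarrow> 'b) \<Rightarrow> ('x list \<Rightarrow>\<^sub>0 'k) \<Rightarrow> 'b" where
  "free_lift B f p = (\<Oplus>\<^bsub>B\<^esub>w\<in>Poly_Mapping.keys p.
     Poly_Mapping.lookup p w \<odot>\<^bsub>B\<^esub> foldr (\<lambda>x b. f x \<otimes>\<^bsub>B\<^esub> b) w \<one>\<^bsub>B\<^esub>)"

definition presented_lift ::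
  "('k::field, 'b, 'm) module_scheme \<Rightarrow> ('x \<Rightarrow> 'b) \<Rightarrow> ('x list \<Rightarrow>\<^sub>0 'k) set \<Rightarrow> 'b" where
  "presented_lift B f Q = the_elem (free_lift B f ` Q)"


section \<open>Suzuki's Hopf algebras\<close>

text \<open>The word \<open>aba\<dots>\<close> with \<open>n\<close> letters.\<close>

fun alternating :: "nat \<Rightarrow> 'a::monoid_mult \<Rightarrow> 'a \<Rightarrow> 'a" where
  "alternating 0 a b = 1"
| "alternating (Suc n) a b = a * alternating n b a"

text \<open>
  The indices \<open>i, j\<close> of \<open>x\<^sub>i\<^sub>j\<close> are the elements of the two-element type \<^typ>\<open>2\<close> of integers modulo
  2, in which \<open>2 = 0\<close>; equations between differences of indices are congruences modulo 2.
\<close>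

type_synonym idx = "2 \<times> 2"
type_synonym 'k suzuki = "(idx list \<Rightarrow>\<^sub>0 'k) set"

definition suzuki_relations :: "nat \<Rightarrow> nat \<Rightarrow> int \<Rightarrow> int \<Rightarrow> (idx list \<Rightarrow>\<^sub>0 'k::field) set" where
  "suzuki_relations N n \<nu> lam = (let x = \<lambda>i j. free_gen (i, j) in
     {x 1 1 ^ 2 - x 2 2 ^ 2,
      x 1 2 ^ 2 - x 2 1 ^ 2,
      x 1 1 ^ (2 * N) + of_int \<nu> * x 1 2 ^ (2 * N) - 1,
      alternating n (x 1 1) (x 2 2) - alternating n (x 2 2) (x 1 1),
      alternating n (x 2 1) (x 1 2) - of_int lam * alternating n (x 1 2) (x 2 1)}
     \<union> {x i j * x l m | i j l m. i - j \<noteq> l - m})"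

definition suzuki_algebra :: "nat \<Rightarrow> nat \<Rightarrow> int \<Rightarrow> int \<Rightarrow> ('k::field, 'k suzuki) module" where
  "suzuki_algebra N n \<nu> lam = presented_algebra (suzuki_relations N n \<nu> lam)"

definition suzuki_gen :: "nat \<Rightarrow> nat \<Rightarrow> int \<Rightarrow> int \<Rightarrow> 2 \<Rightarrow> 2 \<Rightarrow> 'k::field suzuki" where
  "suzuki_gen N n \<nu> lam i j = presented_gen (suzuki_relations N n \<nu> lam) (i, j)"

text \<open>The antipode is an antihomomorphism, that is, an algebra map to the opposite algebra.\<close>

definition suzuki_hopf :: "nat \<Rightarrow> nat \<Rightarrow> int \<Rightarrow> int \<Rightarrow> ('k::field, 'k suzuki) hopf" where
  "suzuki_hopf N n \<nu> lam =
     (let A = suzuki_algebra N n \<nu> lam; x = suzuki_gen N n \<nu> lam; T = tensor_algebra A A in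
      module.extend A (hopf.fields
        (presented_lift T
           (\<lambda>(i, j). pure_tensor A A (x i 1) (x 1 j) \<oplus>\<^bsub>T\<^esub> pure_tensor A A (x i 2) (x 2 j)))
        (presented_lift scalar_algebra (\<lambda>(i, j). if i = j then 1 else 0))
        (presented_lift (opposite A) (\<lambda>(i, j). x j i [^]\<^bsub>A\<^esub> (2 * N - 1)))))"

definition primitive_root :: "nat \<Rightarrow> 'k::field \<Rightarrow> bool" where
  "primitive_root m z \<longleftrightarrow> m > 0 \<and> z ^ m = 1 \<and> (\<forall>d. 0 < d \<and> d < m \<longrightarrow> z ^ d \<noteq> 1)"

end

theory Submission
  imports Defs
begin

text \<open>
  A product of generators vanishes unless all its letters \<open>x\<^sub>i\<^sub>j\<close> have the same type \<open>d = j - i\<close>. Since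
  \<open>x\<^sub>1\<^sub>1\<^sup>2 = x\<^sub>2\<^sub>2\<^sup>2\<close> and \<open>x\<^sub>1\<^sub>2\<^sup>2 = x\<^sub>2\<^sub>1\<^sup>2\<close>, such a product depends only on \<open>d\<close> and on the numbers \<open>a\<close> and \<open>b\<close> of
  letters for which the row index plus the position is even, respectively odd. The resulting elements
  \<open>U d a b\<close> span the algebra, satisfy \<open>U d (a + N) (b + N) = U d a b\<close> and
  \<open>U d (a + n) b = lam ^ d * U d a (b + n)\<close>, and have the coproduct
  \<open>U 0 a b \<otimes> U d a b + U 1 a b \<otimes> U (d + 1) b a\<close>.

  Given a primitive \<open>N\<close>-th root of unity \<open>ze\<close> and \<open>xi\<close> with \<open>xi ^ (2 * n) = lam\<close> and \<open>xi ^ 4\<close> of order \<open>n\<close>,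
  there is a symmetric Hopf pairing for which \<open>U d a b\<close> and \<open>U d' q r\<close> pair to
  \<open>ze ^ ((a + b) * (q + r)) * xi ^ ((a - b) * (q - r))\<close> if \<open>d \<equiv> q + r\<close> and \<open>d' \<equiv> a + b\<close> modulo 2, and
  to zero otherwise. On a spanning set of \<open>4nN\<close> of these elements its matrix is, up to invertible diagonal
  factors, a sum of Kronecker products of Fourier matrices of sizes \<open>n\<close> and \<open>N\<close>; this uses that \<open>N\<close> is odd.
  Hence the pairing is perfect and induces the isomorphism with the dual.
\<close>

section \<open>Linear algebra over records: spaces, quotients, tensor products, presented
  algebras\<close>

section \<open>Vector spaces and algebras as records\<close>

text \<open>A presentation yields maps out of the algebra but says nothing about linear
  independence, and a pairing has to respect the relations in both arguments. They are checked in
  one argument only: each \<open>pf d a b\<close> is a functional on the quotient, a matrix entry of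
  a two-dimensional representation, indexed by numbers and not by an element of the algebra.
  Symmetry of the values on the \<open>U d a b\<close> and invertibility of the Gram matrix supply
  the rest together: coordinate functionals, hence a basis, and a bilinear \<open>pairing\<close>
  defined through these coordinates. Symmetry also merges two Hopf conditions: the single identity
  \<open>pf_mult\<close> gives compatibility with products and with coproducts. The parameters
  \<open>al = ze * xi\<close> and \<open>be = ze / xi\<close> solve the relations:
  \<open>al * be = ze ^ 2\<close> must be an \<open>N\<close>-th root of unity, and
  \<open>(al / be) ^ n = xi ^ (2 * n)\<close> must equal \<open>lam\<close>. For
  \<open>lam = 1\<close> and \<open>n\<close> even there is no suitable \<open>xi\<close>: from
  \<open>xi ^ (2 * n) = 1\<close> and \<open>xi ^ 4\<close> of order \<open>n\<close>, the order of
  \<open>xi\<close> would be \<open>n\<close> or \<open>2 * n\<close>, and then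
  \<open>xi ^ 4\<close> has order at most \<open>n div 2\<close>. This is where the condition on
  \<open>lam\<close> and \<open>n\<close> enters.\<close>

locale kspace = abelian_group V
  for V :: "('k::field, 'a, 'm) module_scheme" (structure) +
  assumes smult_closed [simp, intro]: "x \<in> carrier V \<Longrightarrow> c \<odot> x \<in> carrier V"
    and smult_add_left: "x \<in> carrier V \<Longrightarrow> (c + d) \<odot> x = c \<odot> x \<oplus> d \<odot> x"
    and smult_add_right: "x \<in> carrier V \<Longrightarrow> y \<in> carrier V \<Longrightarrow> c \<odot> (x \<oplus> y) = c \<odot> x \<oplus> c \<odot> y"
    and smult_smult: "x \<in> carrier V \<Longrightarrow> c \<odot> (d \<odot> x) = (c * d) \<odot> x"
    and smult_one [simp]: "x \<in> carrier V \<Longrightarrow> 1 \<odot> x = x"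

text \<open>Passing to \<open>kspace\<close> removes the ring record from the scalars: they become
  plain field elements, so that simplification in the field applies to them directly.\<close>

lemma k_space_iff: "k_space (V :: ('k::field, 'a, 'm) module_scheme) \<longleftrightarrow> kspace V"
proof
  assume "k_space V"
  then interpret module "ring_of_type_algebra :: 'k ring" V by (simp add: k_space_def)
  show "kspace V"
    using smult_closed smult_l_distr smult_r_distr smult_assoc1 smult_one
    by unfold_locales (auto simp: ring_of_type_algebra_def)
next
  assume "kspace V"
  then interpret kspace V .
  show "k_space V"
    unfolding k_space_def
    by (intro moduleI cring_from_type_algebra abelian_group_axioms)
      (auto simp: ring_of_type_algebra_def smult_add_left smult_add_right smult_smult)
qed

locale kalgebra = kspace A + ring A
  for A :: "('k::field, 'a, 'm) module_scheme" (structure) +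
  assumes smult_mult_left: "x \<in> carrier A \<Longrightarrow> y \<in> carrier A \<Longrightarrow> (c \<odot> x) \<otimes> y = c \<odot> (x \<otimes> y)"
    and smult_mult_right: "x \<in> carrier A \<Longrightarrow> y \<in> carrier A \<Longrightarrow> x \<otimes> (c \<odot> y) = c \<odot> (x \<otimes> y)"

lemma k_algebra_iff: "k_algebra A \<longleftrightarrow> kalgebra A"
  unfolding k_algebra_def k_space_iff kalgebra_def kalgebra_axioms_def by blast

context kspace
begin

lemma smult_zero_left [simp]: "x \<in> carrier V \<Longrightarrow> 0 \<odot> x = \<zero>"
  using smult_add_left[of x 0 0] add.l_cancel_one' by force

lemma smult_zero_right [simp]: "c \<odot> \<zero> = \<zero>"
  using smult_add_right[of \<zero> \<zero> c] add.l_cancel_one' by force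

lemma smult_minus_one: "x \<in> carrier V \<Longrightarrow> (- 1) \<odot> x = \<ominus> x"
  by (metis ab_group_add_class.ab_left_minus add.inv_equality smult_add_left smult_closed smult_one smult_zero_left)

lemma smult_finsum:
  assumes "finite S" "\<And>i. i \<in> S \<Longrightarrow> f i \<in> carrier V"
  shows "c \<odot> (\<Oplus>i\<in>S. f i) = (\<Oplus>i\<in>S. c \<odot> f i)"
  using assms by (induction S rule: finite_induct) (auto simp: smult_add_right Pi_def)

end

section \<open>Linear maps\<close>

context
  fixes V :: "('k::field, 'a, 'm) module_scheme" and W :: "('k, 'b, 'n) module_scheme" and f
  assumes f: "f \<in> linear_maps V W"
begin

lemma linear_maps_closed: "x \<in> carrier V \<Longrightarrow> f x \<in> carrier W"
  using f by (auto simp: linear_maps_def)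

lemma linear_maps_add:
  "x \<in> carrier V \<Longrightarrow> y \<in> carrier V \<Longrightarrow> f (x \<oplus>\<^bsub>V\<^esub> y) = f x \<oplus>\<^bsub>W\<^esub> f y"
  using f by (auto simp: linear_maps_def)

lemma linear_maps_smult: "x \<in> carrier V \<Longrightarrow> f (c \<odot>\<^bsub>V\<^esub> x) = c \<odot>\<^bsub>W\<^esub> f x"
  using f by (auto simp: linear_maps_def)

lemma linear_maps_zero:
  assumes "kspace V" "kspace W" shows "f \<zero>\<^bsub>V\<^esub> = \<zero>\<^bsub>W\<^esub>"
proof -
  interpret V: kspace V by fact
  interpret W: kspace W by fact
  show ?thesis
    using linear_maps_smult[of "\<zero>\<^bsub>V\<^esub>" 0] linear_maps_closed[of "\<zero>\<^bsub>V\<^esub>"] by simp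
qed

lemma linear_maps_finsum:
  assumes "kspace V" "kspace W" "finite S" "\<And>i. i \<in> S \<Longrightarrow> g i \<in> carrier V"
  shows "f (\<Oplus>\<^bsub>V\<^esub>i\<in>S. g i) = (\<Oplus>\<^bsub>W\<^esub>i\<in>S. f (g i))"
proof -
  interpret V: kspace V by fact
  interpret W: kspace W by fact
  show ?thesis
    using assms(3,4)
    by (induction S rule: finite_induct)
      (auto simp: Pi_def linear_maps_add linear_maps_closed linear_maps_zero assms(1,2))
qed

end

lemma linear_mapsI:
  assumes "\<And>x. x \<in> carrier V \<Longrightarrow> f x \<in> carrier W"
    and "\<And>x y. x \<in> carrier V \<Longrightarrow> y \<in> carrier V \<Longrightarrow> f (x \<oplus>\<^bsub>V\<^esub> y) = f x \<oplus>\<^bsub>W\<^esub> f y"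
    and "\<And>c x. x \<in> carrier V \<Longrightarrow> f (c \<odot>\<^bsub>V\<^esub> x) = c \<odot>\<^bsub>W\<^esub> f x"
  shows "f \<in> linear_maps V W"
  using assms by (auto simp: linear_maps_def)

lemma linear_maps_id: "id \<in> linear_maps V V"
  by (auto simp: linear_maps_def)

lemma linear_maps_compose:
  "f \<in> linear_maps U V \<Longrightarrow> g \<in> linear_maps V W \<Longrightarrow> (\<lambda>x. g (f x)) \<in> linear_maps U W"
  by (auto simp: linear_maps_def Pi_def)

lemma linear_maps_plus:
  assumes "kspace W" "f \<in> linear_maps V W" "g \<in> linear_maps V W"
  shows "(\<lambda>x. f x \<oplus>\<^bsub>W\<^esub> g x) \<in> linear_maps V W"
proof -
  interpret W: kspace W by fact
  show ?thesis
    using assms(2,3)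
    by (auto simp: linear_maps_def Pi_def W.smult_add_right W.add.m_ac)
qed

lemma linear_maps_scaled:
  assumes "kspace W" "f \<in> linear_maps V W"
  shows "(\<lambda>x. c \<odot>\<^bsub>W\<^esub> f x) \<in> linear_maps V W"
proof -
  interpret W: kspace W by fact
  show ?thesis
    using assms(2)
    by (auto simp: linear_maps_def Pi_def W.smult_add_right W.smult_smult mult.commute)
qed

lemma scalar_algebra_simps [simp]:
  "carrier scalar_algebra = UNIV" "a \<oplus>\<^bsub>scalar_algebra\<^esub> b = a + b" "a \<otimes>\<^bsub>scalar_algebra\<^esub> b = a * b"
  "\<zero>\<^bsub>scalar_algebra\<^esub> = 0" "\<one>\<^bsub>scalar_algebra\<^esub> = 1" "c \<odot>\<^bsub>scalar_algebra\<^esub> a = c * a"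
  by (simp_all add: scalar_algebra_def ring.defs module.defs ring_of_type_algebra_def)

lemma kalgebra_scalar_algebra: "kalgebra (scalar_algebra :: ('k::field, 'k) module)"
proof -
  have "ring (scalar_algebra :: ('k, 'k) module)"
    by (rule ringI, rule abelian_groupI) (auto intro!: monoidI exI[of _ "- _"] simp: algebra_simps)
  then interpret ring "scalar_algebra :: ('k, 'k) module" .
  show ?thesis
    by unfold_locales (auto simp: algebra_simps)
qed

lemma kspace_scalar_algebra: "kspace (scalar_algebra :: ('k::field, 'k) module)"
  using kalgebra_scalar_algebra kalgebra.axioms(1) by blast

lemma finsum_scalar_algebra:
  fixes f :: "'i \<Rightarrow> 'k::field"
  assumes "finite S" shows "(\<Oplus>\<^bsub>scalar_algebra\<^esub>i\<in>S. f i) = (\<Sum>i\<in>S. f i)"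
proof -
  interpret kspace "scalar_algebra :: ('k, 'k) module" by (rule kspace_scalar_algebra)
  show ?thesis
    using assms by (induction S rule: finite_induct) auto
qed

section \<open>Linear extension from a basis\<close>

lemma lookup_pm_scale [simp]: "Poly_Mapping.lookup (pm_scale c p) x = c * Poly_Mapping.lookup p x"
  by (simp add: Poly_Mapping.map.rep_eq when_def)

lemma keys_pm_scale: "Poly_Mapping.keys (pm_scale c p) \<subseteq> Poly_Mapping.keys p"
  by (auto simp: in_keys_iff)

text \<open>The sum that occurs in both \<open>tensor_lift\<close> and \<open>free_lift\<close>;
  isolating it lets tensor products and free algebras share the same linearity facts.\<close>

definition lin_ext :: "('k::field, 'b, 'm) module_scheme \<Rightarrow> ('a \<Rightarrow> 'b) \<Rightarrow> ('a \<Rightarrow>\<^sub>0 'k) \<Rightarrow> 'b" where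
  "lin_ext Z b p = (\<Oplus>\<^bsub>Z\<^esub>x\<in>Poly_Mapping.keys p. Poly_Mapping.lookup p x \<odot>\<^bsub>Z\<^esub> b x)"

context kspace
begin

text \<open>Coefficients may cancel in a sum, so the supports of \<open>p\<close>, \<open>q\<close>
  and \<open>p + q\<close> differ. Summing over a common larger finite set makes the three sums
  comparable.\<close>

lemma lin_ext_superset:
  assumes "finite S" "Poly_Mapping.keys p \<subseteq> S" "\<And>x. x \<in> S \<Longrightarrow> b x \<in> carrier V"
  shows "lin_ext V b p = (\<Oplus>x\<in>S. Poly_Mapping.lookup p x \<odot> b x)"
  unfolding lin_ext_def
  by (rule add.finprod_mono_neutral_cong_left)
    (use assms in \<open>auto simp: not_in_keys_iff_lookup_eq_zero Pi_def\<close>)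

lemma lin_ext_closed:
  assumes "\<And>x. x \<in> Poly_Mapping.keys p \<Longrightarrow> b x \<in> carrier V"
  shows "lin_ext V b p \<in> carrier V"
  unfolding lin_ext_def using assms by (auto intro!: finsum_closed)

lemma lin_ext_zero [simp]: "lin_ext V b 0 = \<zero>"
  by (simp add: lin_ext_def)

lemma lin_ext_single:
  assumes "b x \<in> carrier V"
  shows "lin_ext V b (Poly_Mapping.single x c) = c \<odot> b x"
  using assms lin_ext_superset[of "{x}" "Poly_Mapping.single x c" b] by simp

lemma lin_ext_add:
  assumes "\<And>x. x \<in> Poly_Mapping.keys p \<union> Poly_Mapping.keys q \<Longrightarrow> b x \<in> carrier V"
  shows "lin_ext V b (p + q) = lin_ext V b p \<oplus> lin_ext V b q"
proof -
  let ?S = "Poly_Mapping.keys p \<union> Poly_Mapping.keys q"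
  have *: "lin_ext V b r = (\<Oplus>x\<in>?S. Poly_Mapping.lookup r x \<odot> b x)"
    if "Poly_Mapping.keys r \<subseteq> ?S" for r
    by (rule lin_ext_superset) (use assms that in auto)
  have "lin_ext V b (p + q)
      = (\<Oplus>x\<in>?S. Poly_Mapping.lookup p x \<odot> b x \<oplus> Poly_Mapping.lookup q x \<odot> b x)"
    unfolding *[OF Poly_Mapping.keys_add]
    by (rule finsum_cong') (use assms in \<open>auto simp: lookup_add smult_add_left\<close>)
  also have "\<dots> = lin_ext V b p \<oplus> lin_ext V b q"
    by (subst finsum_addf) (use assms in \<open>auto simp: *\<close>)
  finally show ?thesis .
qed

lemma lin_ext_scale:
  assumes "\<And>x. x \<in> Poly_Mapping.keys p \<Longrightarrow> b x \<in> carrier V"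
  shows "lin_ext V b (pm_scale c p) = c \<odot> lin_ext V b p"
proof -
  have "lin_ext V b (pm_scale c p)
      = (\<Oplus>x\<in>Poly_Mapping.keys p. Poly_Mapping.lookup (pm_scale c p) x \<odot> b x)"
    by (rule lin_ext_superset) (use assms keys_pm_scale[of c p] in auto)
  also have "\<dots> = c \<odot> lin_ext V b p"
    unfolding lin_ext_def
    by (subst smult_finsum) (use assms in \<open>auto intro!: finsum_cong' simp: smult_smult\<close>)
  finally show ?thesis .
qed

end

lemma free_space_simps [simp]:
  "carrier (free_space S) = {p. Poly_Mapping.keys p \<subseteq> S}" "p \<oplus>\<^bsub>free_space S\<^esub> q = p + q"
  "\<zero>\<^bsub>free_space S\<^esub> = 0" "c \<odot>\<^bsub>free_space S\<^esub> p = pm_scale c p"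
  by (simp_all add: free_space_def)

lemma pm_scale_simps:
  "pm_scale (c + d) p = pm_scale c p + pm_scale d p"
  "pm_scale c (p + q) = pm_scale c p + pm_scale c q"
  "pm_scale c (pm_scale d p) = pm_scale (c * d) p"
  "pm_scale 1 p = p"
  by (auto intro!: poly_mapping_eqI simp: lookup_add algebra_simps)

lemma kspace_free_space: "kspace (free_space S :: ('k::field, 'a \<Rightarrow>\<^sub>0 'k) module)"
proof -
  have "abelian_group (free_space S :: ('k, 'a \<Rightarrow>\<^sub>0 'k) module)"
  proof (rule abelian_groupI)
    fix p :: "'a \<Rightarrow>\<^sub>0 'k" assume "p \<in> carrier (free_space S)"
    then show "\<exists>q\<in>carrier (free_space S). q \<oplus>\<^bsub>free_space S\<^esub> p = \<zero>\<^bsub>free_space S\<^esub>"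
      by (intro bexI[of _ "- p"]) (auto simp: in_keys_iff subset_iff)
  qed (auto simp: algebra_simps dest!: subsetD[OF Poly_Mapping.keys_add])
  then interpret abelian_group "free_space S :: ('k, 'a \<Rightarrow>\<^sub>0 'k) module" .
  show ?thesis
    by unfold_locales (auto simp: pm_scale_simps intro: subset_trans[OF keys_pm_scale, THEN subsetD])
qed

lemma lin_ext_linear:
  assumes "kspace Z" "\<And>x. x \<in> S \<Longrightarrow> b x \<in> carrier Z"
  shows "lin_ext Z b \<in> linear_maps (free_space S) Z"
proof -
  interpret kspace Z by fact
  show ?thesis
    by (rule linear_mapsI) (auto simp: assms(2) subset_iff intro!: lin_ext_closed lin_ext_add lin_ext_scale)
qed

section \<open>Quotients\<close>

locale ksubspace = kspace V for V :: "('k::field, 'a, 'm) module_scheme" (structure) and I +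
  assumes subset: "I \<subseteq> carrier V"
    and zero_in: "\<zero> \<in> I"
    and add_in: "x \<in> I \<Longrightarrow> y \<in> I \<Longrightarrow> x \<oplus> y \<in> I"
    and smult_in: "x \<in> I \<Longrightarrow> c \<odot> x \<in> I"
begin

sublocale abelian_subgroup I V
proof (rule abelian_subgroupI3)
  show "additive_subgroup I V"
  proof (rule additive_subgroupI, rule subgroup.intro)
    show "inv\<^bsub>add_monoid V\<^esub> x \<in> I" if "x \<in> I" for x
      using smult_in[OF that, of "-1"] that subset by (auto simp: smult_minus_one a_inv_def)
  qed (use subset zero_in add_in in auto)
qed (rule abelian_group_axioms)

lemma coset_eq_iff:
  assumes "x \<in> carrier V" "y \<in> carrier V"
  shows "I +> x = I +> y \<longleftrightarrow> x \<ominus> y \<in> I"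
  using assms a_rcos_module_imp a_rcos_self a_repr_independence' a_rcos_module by (metis a_minus_def)

lemma mem_coset_iff:
  assumes "x \<in> carrier V"
  shows "y \<in> I +> x \<longleftrightarrow> y \<in> carrier V \<and> I +> y = I +> x"
  using assms a_rcos_self a_repr_independence' a_elemrcos_carrier by blast

lemma carrier_quotient: "carrier (quotient V I) = (\<lambda>x. I +> x) ` carrier V"
  by (auto simp: quotient_def ring.defs module.defs FactRing_def A_RCOSETS_def')

lemma zero_quotient: "\<zero>\<^bsub>quotient V I\<^esub> = I +> \<zero>"
  by (simp add: quotient_def ring.defs module.defs FactRing_def subset)

lemma add_quotient:
  "x \<in> carrier V \<Longrightarrow> y \<in> carrier V \<Longrightarrow> (I +> x) \<oplus>\<^bsub>quotient V I\<^esub> (I +> y) = I +> (x \<oplus> y)"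
  by (simp add: quotient_def ring.defs module.defs FactRing_def a_rcos_sum)

lemma smult_quotient:
  assumes "x \<in> carrier V"
  shows "c \<odot>\<^bsub>quotient V I\<^esub> (I +> x) = I +> (c \<odot> x)"
proof -
  have "I +> (c \<odot> y) = I +> (c \<odot> x)" if y: "y \<in> I +> x" for y
  proof -
    have yc: "y \<in> carrier V" and "y \<ominus> x \<in> I"
      using y assms by (auto simp: mem_coset_iff coset_eq_iff)
    then have "c \<odot> (y \<ominus> x) \<in> I" by (simp add: smult_in)
    moreover have "c \<odot> (y \<ominus> x) = c \<odot> y \<ominus> c \<odot> x"
      using yc assms by (simp add: a_minus_def smult_add_right smult_minus_one[symmetric] smult_smult mult.commute)
    ultimately show ?thesis using yc assms by (simp add: coset_eq_iff)
  qed
  moreover have "x \<in> I +> x" using assms by (simp add: a_rcos_self)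
  ultimately have "(\<Union>y\<in>I +> x. I +> (c \<odot> y)) = I +> (c \<odot> x)" by blast
  then show ?thesis by (simp add: quotient_def ring.defs module.defs)
qed

lemma kspace_quotient: "kspace (quotient V I)"
proof -
  have "abelian_group (quotient V I)"
  proof (rule abelian_groupI)
    fix Q assume "Q \<in> carrier (quotient V I)"
    then obtain x where x: "x \<in> carrier V" "Q = I +> x" by (auto simp: carrier_quotient)
    then show "\<exists>P\<in>carrier (quotient V I). P \<oplus>\<^bsub>quotient V I\<^esub> Q = \<zero>\<^bsub>quotient V I\<^esub>"
      by (intro bexI[of _ "I +> (\<ominus> x)"]) (auto simp: carrier_quotient add_quotient zero_quotient l_neg)
  qed (auto simp: carrier_quotient add_quotient zero_quotient a_ac simp del: a_coset_add_zero)
  then interpret Q: abelian_group "quotient V I" .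
  show ?thesis
    by unfold_locales
      (auto simp: carrier_quotient add_quotient smult_quotient smult_add_left smult_add_right smult_smult)
qed

text \<open>A linear map that kills \<open>I\<close> is constant on each coset, so the image of a
  coset is a singleton. This is what gives \<open>the_elem\<close> its meaning in all maps induced
  on quotients.\<close>

lemma image_coset:
  assumes "kspace W" "f \<in> linear_maps V W" "\<And>x. x \<in> I \<Longrightarrow> f x = \<zero>\<^bsub>W\<^esub>" "x \<in> carrier V"
  shows "the_elem (f ` (I +> x)) = f x"
proof -
  interpret W: kspace W by fact
  have "f y = f x" if y: "y \<in> I +> x" for y
  proof -
    have "\<exists>h\<in>I. y = h \<oplus> x"
      using y by (simp add: a_r_coset_def')
    then obtain h where h: "h \<in> I" "y = h \<oplus> x"
      by (elim bexE)
    have "f y = f h \<oplus>\<^bsub>W\<^esub> f x"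
      unfolding h(2) by (rule linear_maps_add[OF assms(2) subsetD[OF subset h(1)] assms(4)])
    then show ?thesis
      using assms(3)[OF h(1)] linear_maps_closed[OF assms(2,4)] by simp
  qed
  then have "f ` (I +> x) = (\<lambda>_. f x) ` (I +> x)"
    by (rule image_cong[OF refl])
  moreover have "I +> x \<noteq> {}"
    using a_rcos_self[OF assms(4)] by (metis empty_iff)
  ultimately show ?thesis by (simp add: image_constant_conv)
qed

lemma quotient_map_linear:
  assumes "kspace W" "f \<in> linear_maps V W" "\<And>x. x \<in> I \<Longrightarrow> f x = \<zero>\<^bsub>W\<^esub>"
  shows "(\<lambda>Q. the_elem (f ` Q)) \<in> linear_maps (quotient V I) W"
  by (rule linear_mapsI)
    (auto simp: carrier_quotient add_quotient smult_quotient image_coset[OF assms]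
      linear_maps_closed[OF assms(2)] linear_maps_add[OF assms(2)] linear_maps_smult[OF assms(2)])

end

section \<open>Tensor products\<close>

definition bilinear_maps ::
  "('k::field, 'a, 'm) module_scheme \<Rightarrow> ('k, 'b, 'n) module_scheme \<Rightarrow> ('k, 'c, 'o) module_scheme \<Rightarrow>
   ('a \<Rightarrow> 'b \<Rightarrow> 'c) set" where
  "bilinear_maps V W Z = {\<beta>. (\<forall>v\<in>carrier V. \<beta> v \<in> linear_maps W Z) \<and>
     (\<forall>w\<in>carrier W. (\<lambda>v. \<beta> v w) \<in> linear_maps V Z)}"

lemma bilinear_mapsI:
  assumes "\<And>v. v \<in> carrier V \<Longrightarrow> \<beta> v \<in> linear_maps W Z"
    and "\<And>w. w \<in> carrier W \<Longrightarrow> (\<lambda>v. \<beta> v w) \<in> linear_maps V Z"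
  shows "\<beta> \<in> bilinear_maps V W Z"
  using assms by (auto simp: bilinear_maps_def)

lemma bilinear_mapsD:
  assumes "\<beta> \<in> bilinear_maps V W Z"
  shows "v \<in> carrier V \<Longrightarrow> \<beta> v \<in> linear_maps W Z"
    and "w \<in> carrier W \<Longrightarrow> (\<lambda>v. \<beta> v w) \<in> linear_maps V Z"
  using assms by (auto simp: bilinear_maps_def)

lemma keys_minus_subset: "Poly_Mapping.keys (p - q) \<subseteq> Poly_Mapping.keys p \<union> Poly_Mapping.keys q"
  by (auto simp: in_keys_iff lookup_minus)

locale kspace_pair = V: kspace V + W: kspace W
  for V :: "('k::field, 'a, 'm) module_scheme" and W :: "('k, 'b, 'n) module_scheme"
begin

lemma tensor_null_keys:
  assumes "p \<in> tensor_null V W" shows "Poly_Mapping.keys p \<subseteq> carrier V \<times> carrier W"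
  using assms
proof (induction rule: tensor_null.induct)
  case (null_add p q)
  then show ?case using Poly_Mapping.keys_add[of p q] by blast
next
  case (null_scale p c)
  then show ?case using keys_pm_scale[of c p] by blast
next
  case (add_left v v' w)
  then show ?case
    by (intro order_trans[OF keys_minus_subset] Un_least) auto
next
  case (add_right v w w')
  then show ?case
    by (intro order_trans[OF keys_minus_subset] Un_least) auto
next
  case (smult_left v w c)
  then show ?case
    by (intro order_trans[OF keys_minus_subset] Un_least order_trans[OF keys_pm_scale]) auto
next
  case (smult_right v w c)
  then show ?case
    by (intro order_trans[OF keys_minus_subset] Un_least order_trans[OF keys_pm_scale]) auto
qed auto

sublocale N: ksubspace "free_space (carrier V \<times> carrier W)" "tensor_null V W"
proof -
  interpret F: kspace "free_space (carrier V \<times> carrier W) :: ('k, 'a \<times> 'b \<Rightarrow>\<^sub>0 'k) module"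
    by (rule kspace_free_space)
  show "ksubspace (free_space (carrier V \<times> carrier W)) (tensor_null V W)"
    by unfold_locales (auto dest: subsetD[OF tensor_null_keys] intro: tensor_null.intros)
qed

lemma kspace_tensor_space: "kspace (tensor_space V W)"
  unfolding tensor_space_def by (rule N.kspace_quotient)

sublocale T: kspace "tensor_space V W"
  by (rule kspace_tensor_space)

lemma single_in_free_space:
  "v \<in> carrier V \<Longrightarrow> w \<in> carrier W \<Longrightarrow>
    Poly_Mapping.single (v, w) c \<in> carrier (free_space (carrier V \<times> carrier W))"
  by simp

lemma free_space_minus:
  fixes p q :: "'a \<times> 'b \<Rightarrow>\<^sub>0 'k"
  assumes "p \<in> carrier (free_space (carrier V \<times> carrier W))" "q \<in> carrier (free_space (carrier V \<times> carrier W))"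
  shows "p \<ominus>\<^bsub>free_space (carrier V \<times> carrier W)\<^esub> q = p - q"
proof -
  have "\<ominus>\<^bsub>free_space (carrier V \<times> carrier W)\<^esub> q = pm_scale (- 1) q"
    using N.smult_minus_one[OF assms(2)] by simp
  also have "\<dots> = - q"
    by (auto intro: poly_mapping_eqI)
  finally show ?thesis by (simp add: a_minus_def)
qed

lemma pure_tensor_closed [simp, intro]:
  "v \<in> carrier V \<Longrightarrow> w \<in> carrier W \<Longrightarrow> pure_tensor V W v w \<in> carrier (tensor_space V W)"
  unfolding tensor_space_def pure_tensor_def N.carrier_quotient
  by (rule imageI, rule single_in_free_space)

lemma coset_eqI:
  assumes "p - q \<in> tensor_null V W" "Poly_Mapping.keys p \<subseteq> carrier V \<times> carrier W"
    "Poly_Mapping.keys q \<subseteq> carrier V \<times> carrier W"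
  shows "tensor_null V W +>\<^bsub>free_space (carrier V \<times> carrier W)\<^esub> p =
    tensor_null V W +>\<^bsub>free_space (carrier V \<times> carrier W)\<^esub> q"
  using assms by (subst N.coset_eq_iff) (simp_all add: free_space_minus)

lemma pure_tensor_add_left:
  assumes "v \<in> carrier V" "v' \<in> carrier V" "w \<in> carrier W"
  shows "pure_tensor V W (v \<oplus>\<^bsub>V\<^esub> v') w =
    pure_tensor V W v w \<oplus>\<^bsub>tensor_space V W\<^esub> pure_tensor V W v' w"
  unfolding tensor_space_def pure_tensor_def
  by (subst N.add_quotient, use assms in simp, use assms in simp, rule coset_eqI)
    (use assms tensor_null.add_left[OF assms] in
      \<open>auto simp: algebra_simps dest!: subsetD[OF Poly_Mapping.keys_add]\<close>)

lemma pure_tensor_add_right: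
  assumes "v \<in> carrier V" "w \<in> carrier W" "w' \<in> carrier W"
  shows "pure_tensor V W v (w \<oplus>\<^bsub>W\<^esub> w') =
    pure_tensor V W v w \<oplus>\<^bsub>tensor_space V W\<^esub> pure_tensor V W v w'"
  unfolding tensor_space_def pure_tensor_def
  by (subst N.add_quotient, use assms in simp, use assms in simp, rule coset_eqI)
    (use assms tensor_null.add_right[OF assms] in
      \<open>auto simp: algebra_simps dest!: subsetD[OF Poly_Mapping.keys_add]\<close>)

lemma pure_tensor_smult_left:
  assumes "v \<in> carrier V" "w \<in> carrier W"
  shows "pure_tensor V W (c \<odot>\<^bsub>V\<^esub> v) w = c \<odot>\<^bsub>tensor_space V W\<^esub> pure_tensor V W v w"
  unfolding tensor_space_def pure_tensor_def
  by (subst N.smult_quotient, use assms in simp, rule coset_eqI)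
    (use assms tensor_null.smult_left[OF assms, of c] in
      \<open>auto dest!: subsetD[OF keys_pm_scale] simp del: map_single\<close>)

lemma pure_tensor_smult_right:
  assumes "v \<in> carrier V" "w \<in> carrier W"
  shows "pure_tensor V W v (c \<odot>\<^bsub>W\<^esub> w) = c \<odot>\<^bsub>tensor_space V W\<^esub> pure_tensor V W v w"
  unfolding tensor_space_def pure_tensor_def
  by (subst N.smult_quotient, use assms in simp, rule coset_eqI)
    (use assms tensor_null.smult_right[OF assms, of c] in
      \<open>auto dest!: subsetD[OF keys_pm_scale] simp del: map_single\<close>)

lemma pure_tensor_bilinear: "pure_tensor V W \<in> bilinear_maps V W (tensor_space V W)"
  by (intro bilinear_mapsI linear_mapsI)
    (simp_all add: pure_tensor_add_left pure_tensor_add_right pure_tensor_smult_left pure_tensor_smult_right)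

lemma pure_tensor_zero_left: "w \<in> carrier W \<Longrightarrow> pure_tensor V W \<zero>\<^bsub>V\<^esub> w = \<zero>\<^bsub>tensor_space V W\<^esub>"
  using pure_tensor_smult_left[of "\<zero>\<^bsub>V\<^esub>" w 0] by simp

lemma pure_tensor_zero_right: "v \<in> carrier V \<Longrightarrow> pure_tensor V W v \<zero>\<^bsub>W\<^esub> = \<zero>\<^bsub>tensor_space V W\<^esub>"
  using pure_tensor_smult_right[of v "\<zero>\<^bsub>W\<^esub>" 0] by simp

text \<open>Scalars can be absorbed into the left factor, and zero is the pure tensor of two zeros.
  Hence pure tensors generate additively, and no case for scalars or for zero is required.\<close>

lemma tensor_induct [consumes 1, case_names pure add]:
  assumes "t \<in> carrier (tensor_space V W)"
    and pure: "\<And>v w. v \<in> carrier V \<Longrightarrow> w \<in> carrier W \<Longrightarrow> P (pure_tensor V W v w)"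
    and add: "\<And>s t. s \<in> carrier (tensor_space V W) \<Longrightarrow> t \<in> carrier (tensor_space V W) \<Longrightarrow>
      P s \<Longrightarrow> P t \<Longrightarrow> P (s \<oplus>\<^bsub>tensor_space V W\<^esub> t)"
  shows "P t"
proof -
  let ?F = "free_space (carrier V \<times> carrier W) :: ('k, 'a \<times> 'b \<Rightarrow>\<^sub>0 'k) module"
  let ?q = "\<lambda>p. tensor_null V W +>\<^bsub>?F\<^esub> p"
  have single: "?q (Poly_Mapping.single (v, w) c) = pure_tensor V W (c \<odot>\<^bsub>V\<^esub> v) w"
    if "v \<in> carrier V" "w \<in> carrier W" for v w c
    using pure_tensor_smult_left[OF that, of c] N.smult_quotient[of "Poly_Mapping.single (v, w) 1" c] that
    unfolding pure_tensor_def tensor_space_def by simp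
  have "P (?q p)" if "Poly_Mapping.keys p \<subseteq> carrier V \<times> carrier W" for p
    using that
  proof (induction p rule: update_induct)
    case const
    show ?case
      using single[of "\<zero>\<^bsub>V\<^esub>" "\<zero>\<^bsub>W\<^esub>" 0] pure[of "\<zero>\<^bsub>V\<^esub>" "\<zero>\<^bsub>W\<^esub>"] by simp
  next
    case (update p k c)
    obtain v w where k: "k = (v, w)" by (cases k)
    have upd: "Poly_Mapping.update k c p = p + Poly_Mapping.single k c"
      using update.hyps
      by (intro poly_mapping_eqI) (auto simp: lookup_update lookup_add lookup_single in_keys_iff when_def)
    have vw: "v \<in> carrier V" "w \<in> carrier W" and p: "Poly_Mapping.keys p \<subseteq> carrier V \<times> carrier W"
      using update.prems update.hyps by (auto simp: k keys_update)
    have "?q (Poly_Mapping.update k c p) = ?q p \<oplus>\<^bsub>tensor_space V W\<^esub> ?q (Poly_Mapping.single k c)"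
      unfolding upd tensor_space_def by (subst N.add_quotient) (use p vw in \<open>auto simp: k\<close>)
    moreover have "?q p \<in> carrier (tensor_space V W)"
      using p by (auto simp: tensor_space_def N.carrier_quotient)
    ultimately show ?case
      using vw update.IH[OF p] by (auto simp: k single intro!: add pure)
  qed
  then show ?thesis
    using assms(1) by (auto simp: tensor_space_def N.carrier_quotient)
qed

text \<open>Bilinearity of \<open>\<beta>\<close> is exactly what makes its linear extension vanish
  on the generators of \<open>tensor_null\<close>, so the extension descends to the
  quotient.\<close>

lemma
  assumes "kspace Z" "\<beta> \<in> bilinear_maps V W Z"
  shows tensor_lift_linear: "tensor_lift Z \<beta> \<in> linear_maps (tensor_space V W) Z"
    and tensor_lift_pure: "v \<in> carrier V \<Longrightarrow> w \<in> carrier W \<Longrightarrow> tensor_lift Z \<beta> (pure_tensor V W v w) = \<beta> v w"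
proof -
  interpret Z: kspace Z by fact
  let ?F = "free_space (carrier V \<times> carrier W) :: ('k, 'a \<times> 'b \<Rightarrow>\<^sub>0 'k) module"
  let ?f = "lin_ext Z (\<lambda>x. \<beta> (fst x) (snd x)) :: ('a \<times> 'b \<Rightarrow>\<^sub>0 'k) \<Rightarrow> _"
  note b = bilinear_mapsD[OF assms(2)]
  have closed: "\<beta> v w \<in> carrier Z" if "v \<in> carrier V" "w \<in> carrier W" for v w
    using linear_maps_closed[OF b(1)] that by blast
  have lin: "?f \<in> linear_maps ?F Z"
    by (rule lin_ext_linear[OF assms(1)]) (auto simp: closed)
  have add: "?f (p + q) = ?f p \<oplus>\<^bsub>Z\<^esub> ?f q"
    if "p \<in> carrier ?F" "q \<in> carrier ?F" for p q
    using linear_maps_add[OF lin that] by simp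
  have scale: "?f (pm_scale c p) = c \<odot>\<^bsub>Z\<^esub> ?f p" if "p \<in> carrier ?F" for c p
    using linear_maps_smult[OF lin that] by simp
  have single: "?f (Poly_Mapping.single (v, w) c) = c \<odot>\<^bsub>Z\<^esub> \<beta> v w" if "v \<in> carrier V" "w \<in> carrier W" for v w c
    by (subst Z.lin_ext_single) (use that closed in auto)
  have diff: "?f (p - q) = ?f p \<ominus>\<^bsub>Z\<^esub> ?f q" if "p \<in> carrier ?F" "q \<in> carrier ?F" for p q
  proof -
    have "?f (p - q) = ?f (p + pm_scale (- 1) q)"
      by (intro arg_cong[of _ _ ?f] poly_mapping_eqI) (simp add: lookup_add lookup_minus)
    moreover have "pm_scale (- 1) q \<in> carrier ?F"
      using that(2) keys_pm_scale[of "- 1" q] by auto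
    ultimately show ?thesis
      using that linear_maps_closed[OF lin that(2)]
      by (simp add: add scale Z.smult_minus_one a_minus_def)
  qed
  have cancel: "x \<oplus>\<^bsub>Z\<^esub> y \<ominus>\<^bsub>Z\<^esub> x \<ominus>\<^bsub>Z\<^esub> y = \<zero>\<^bsub>Z\<^esub>" if "x \<in> carrier Z" "y \<in> carrier Z" for x y
  proof -
    have "x \<oplus>\<^bsub>Z\<^esub> y \<ominus>\<^bsub>Z\<^esub> x \<ominus>\<^bsub>Z\<^esub> y = (x \<oplus>\<^bsub>Z\<^esub> y) \<ominus>\<^bsub>Z\<^esub> (x \<oplus>\<^bsub>Z\<^esub> y)"
      using that by (simp add: a_minus_def Z.minus_add Z.a_assoc)
    then show ?thesis using that by (simp add: a_minus_def Z.r_neg)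
  qed
  have F: "Poly_Mapping.single (v, w) c \<in> carrier ?F" if "v \<in> carrier V" "w \<in> carrier W" for v w and c :: 'k
    using that by simp
  have D: "p - q \<in> carrier ?F" if "p \<in> carrier ?F" "q \<in> carrier ?F" for p q
    using that keys_minus_subset[of p q] by auto
  have null: "?f p = \<zero>\<^bsub>Z\<^esub>" if "p \<in> tensor_null V W" for p
    using that
  proof (induction rule: tensor_null.induct)
    case (null_add p q)
    then show ?case using tensor_null_keys by (simp add: add)
  next
    case (null_scale p c)
    then show ?case using tensor_null_keys by (simp add: scale)
  next
    case (add_left v v' w)
    then show ?case
      by (simp only: diff F D V.a_closed single Z.smult_one closed linear_maps_add[OF b(2)])
        (simp add: closed cancel)
  next
    case (add_right v w w')
    then show ?case
      by (simp only: diff F D W.a_closed single Z.smult_one closed linear_maps_add[OF b(1)])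
        (simp add: closed cancel)
  next
    case (smult_left v w c)
    then show ?case
      by (simp only: map_single mult_zero_right mult_1_right diff F D V.smult_closed single Z.smult_one closed linear_maps_smult[OF b(2)])
        (simp add: closed a_minus_def Z.r_neg)
  next
    case (smult_right v w c)
    then show ?case
      by (simp only: map_single mult_zero_right mult_1_right diff F D W.smult_closed single Z.smult_one closed linear_maps_smult[OF b(1)])
        (simp add: closed a_minus_def Z.r_neg)
  qed simp
  show "tensor_lift Z \<beta> \<in> linear_maps (tensor_space V W) Z"
    using N.quotient_map_linear[OF assms(1) lin null]
    unfolding tensor_lift_def lin_ext_def tensor_space_def by blast
  show "tensor_lift Z \<beta> (pure_tensor V W v w) = \<beta> v w" if "v \<in> carrier V" "w \<in> carrier W"
    using N.image_coset[OF assms(1) lin null F[OF that, of 1]]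
    unfolding tensor_lift_def pure_tensor_def lin_ext_def[symmetric] single[OF that]
    using closed[OF that] by simp
qed

lemma tensor_maps_eq:
  assumes "f \<in> linear_maps (tensor_space V W) Z" "g \<in> linear_maps (tensor_space V W) Z"
    and "\<And>v w. v \<in> carrier V \<Longrightarrow> w \<in> carrier W \<Longrightarrow> f (pure_tensor V W v w) = g (pure_tensor V W v w)"
    and "t \<in> carrier (tensor_space V W)"
  shows "f t = g t"
  using assms(4)
  by (induction t rule: tensor_induct) (simp_all add: assms(3) linear_maps_add[OF assms(1)] linear_maps_add[OF assms(2)])

text \<open>A family of linear maps on a tensor product depends linearly on a parameter as soon as its
  values on pure tensors do.\<close>

lemma tensor_lift_linear_param:
  assumes Z: "kspace Z" and \<beta>: "\<And>u. u \<in> carrier U \<Longrightarrow> \<beta> u \<in> bilinear_maps V W Z" and U: "kspace U"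
    and lin: "\<And>v w. v \<in> carrier V \<Longrightarrow> w \<in> carrier W \<Longrightarrow> (\<lambda>u. \<beta> u v w) \<in> linear_maps U Z"
    and t: "t \<in> carrier (tensor_space V W)"
  shows "(\<lambda>u. tensor_lift Z (\<beta> u) t) \<in> linear_maps U Z"
proof (rule linear_mapsI)
  interpret U: kspace U by fact
  interpret Z: kspace Z by fact
  note l = tensor_lift_linear[OF Z \<beta>] and p = tensor_lift_pure[OF Z \<beta>]
  show "tensor_lift Z (\<beta> u) t \<in> carrier Z" if "u \<in> carrier U" for u
    by (rule linear_maps_closed[OF l[OF that] t])
  show "tensor_lift Z (\<beta> (u \<oplus>\<^bsub>U\<^esub> u')) t = tensor_lift Z (\<beta> u) t \<oplus>\<^bsub>Z\<^esub> tensor_lift Z (\<beta> u') t"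
    if "u \<in> carrier U" "u' \<in> carrier U" for u u'
    using t
    by (rule tensor_maps_eq[OF l linear_maps_plus[OF Z l l], rotated -1])
      (simp_all add: that p linear_maps_add[OF lin])
  show "tensor_lift Z (\<beta> (c \<odot>\<^bsub>U\<^esub> u)) t = c \<odot>\<^bsub>Z\<^esub> tensor_lift Z (\<beta> u) t" if "u \<in> carrier U" for u c
    using t
    by (rule tensor_maps_eq[OF l linear_maps_scaled[OF Z l], rotated -1])
      (simp_all add: that p linear_maps_smult[OF lin])
qed

end

lemma bilinear_maps_compose:
  assumes "\<beta> \<in> bilinear_maps V' W' Z" "f \<in> linear_maps V V'" "g \<in> linear_maps W W'"
  shows "(\<lambda>v w. \<beta> (f v) (g w)) \<in> bilinear_maps V W Z"
proof (rule bilinear_mapsI)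
  fix v assume "v \<in> carrier V"
  then show "(\<lambda>w. \<beta> (f v) (g w)) \<in> linear_maps W Z"
    by (intro linear_maps_compose[OF assms(3)] bilinear_mapsD(1)[OF assms(1)] linear_maps_closed[OF assms(2)])
next
  fix w assume "w \<in> carrier W"
  then show "(\<lambda>v. \<beta> (f v) (g w)) \<in> linear_maps V Z"
    by (intro linear_maps_compose[OF assms(2)] bilinear_mapsD(2)[OF assms(1)] linear_maps_closed[OF assms(3)])
qed

lemma
  assumes "kspace V" "kspace W" "kspace V'" "kspace W'" "f \<in> linear_maps V V'" "g \<in> linear_maps W W'"
  shows tensor_map_linear: "tensor_map V' W' f g \<in> linear_maps (tensor_space V W) (tensor_space V' W')"
    and tensor_map_pure: "v \<in> carrier V \<Longrightarrow> w \<in> carrier W \<Longrightarrow>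
      tensor_map V' W' f g (pure_tensor V W v w) = pure_tensor V' W' (f v) (g w)"
proof -
  interpret P: kspace_pair V W using assms by (simp add: kspace_pair_def)
  interpret P': kspace_pair V' W' using assms by (simp add: kspace_pair_def)
  note b = P'.kspace_tensor_space bilinear_maps_compose[OF P'.pure_tensor_bilinear assms(5,6)]
  show "tensor_map V' W' f g \<in> linear_maps (tensor_space V W) (tensor_space V' W')"
    unfolding tensor_map_def by (rule P.tensor_lift_linear[OF b])
  show "v \<in> carrier V \<Longrightarrow> w \<in> carrier W \<Longrightarrow>
      tensor_map V' W' f g (pure_tensor V W v w) = pure_tensor V' W' (f v) (g w)"
    unfolding tensor_map_def by (rule P.tensor_lift_pure[OF b])
qed

lemma
  assumes "kspace U" "kspace V" "kspace W"
  shows tensor_assoc_linear: "tensor_assoc U V W \<in>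
      linear_maps (tensor_space (tensor_space U V) W) (tensor_space U (tensor_space V W))"
    and tensor_assoc_pure: "u \<in> carrier U \<Longrightarrow> v \<in> carrier V \<Longrightarrow> w \<in> carrier W \<Longrightarrow>
      tensor_assoc U V W (pure_tensor (tensor_space U V) W (pure_tensor U V u v) w) =
      pure_tensor U (tensor_space V W) u (pure_tensor V W v w)"
proof -
  interpret UV: kspace_pair U V using assms by (simp add: kspace_pair_def)
  interpret VW: kspace_pair V W using assms by (simp add: kspace_pair_def)
  interpret UV_W: kspace_pair "tensor_space U V" W
    using assms by (simp add: kspace_pair_def UV.kspace_tensor_space)
  interpret U_VW: kspace_pair U "tensor_space V W"
    using assms by (simp add: kspace_pair_def VW.kspace_tensor_space)
  let ?T = "tensor_space U (tensor_space V W)"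
  let ?\<beta> = "\<lambda>w u v. pure_tensor U (tensor_space V W) u (pure_tensor V W v w)"
  note T = U_VW.kspace_tensor_space
  have in_W: "?\<beta> w \<in> bilinear_maps U V ?T" if "w \<in> carrier W" for w
    using bilinear_maps_compose[OF U_VW.pure_tensor_bilinear linear_maps_id
      bilinear_mapsD(2)[OF VW.pure_tensor_bilinear that]] by simp
  have in_UV: "(\<lambda>w. ?\<beta> w u v) \<in> linear_maps W ?T" if "u \<in> carrier U" "v \<in> carrier V" for u v
    by (rule linear_maps_compose[OF bilinear_mapsD(1)[OF VW.pure_tensor_bilinear that(2)]
      bilinear_mapsD(1)[OF U_VW.pure_tensor_bilinear that(1)]])
  have b: "(\<lambda>Q w. tensor_lift ?T (?\<beta> w) Q) \<in> bilinear_maps (tensor_space U V) W ?T"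
    by (intro bilinear_mapsI UV.tensor_lift_linear_param[OF T] UV.tensor_lift_linear[OF T] in_W in_UV assms(3))
  show "tensor_assoc U V W \<in> linear_maps (tensor_space (tensor_space U V) W) ?T"
    unfolding tensor_assoc_def Let_def by (rule UV_W.tensor_lift_linear[OF T b])
  show "tensor_assoc U V W (pure_tensor (tensor_space U V) W (pure_tensor U V u v) w) =
      pure_tensor U (tensor_space V W) u (pure_tensor V W v w)"
    if "u \<in> carrier U" "v \<in> carrier V" "w \<in> carrier W"
    unfolding tensor_assoc_def Let_def
    using that by (simp add: UV_W.tensor_lift_pure[OF T b] UV.tensor_lift_pure[OF T in_W])
qed

section \<open>Tensor products of algebras\<close>

locale kalgebra_pair = A: kalgebra A + B: kalgebra B
  for A :: "('k::field, 'a, 'm) module_scheme" and B :: "('k, 'b, 'n) module_scheme"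
begin

sublocale kspace_pair A B
  by unfold_locales

abbreviation "AB \<equiv> tensor_algebra A B"

lemma tensor_algebra_simps [simp]:
  "carrier AB = carrier (tensor_space A B)" "s \<oplus>\<^bsub>AB\<^esub> t = s \<oplus>\<^bsub>tensor_space A B\<^esub> t"
  "\<zero>\<^bsub>AB\<^esub> = \<zero>\<^bsub>tensor_space A B\<^esub>" "c \<odot>\<^bsub>AB\<^esub> t = c \<odot>\<^bsub>tensor_space A B\<^esub> t"
  "\<one>\<^bsub>AB\<^esub> = pure_tensor A B \<one>\<^bsub>A\<^esub> \<one>\<^bsub>B\<^esub>"
  by (simp_all add: tensor_algebra_def)

lemma linear_maps_tensor_algebra [simp]:
  "linear_maps V AB = linear_maps V (tensor_space A B)" "linear_maps AB V = linear_maps (tensor_space A B) V"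
  by (simp_all add: linear_maps_def)

lemma mult_bilinear:
  "(\<otimes>\<^bsub>A\<^esub>) \<in> bilinear_maps A A A" "(\<otimes>\<^bsub>B\<^esub>) \<in> bilinear_maps B B B"
  by (intro bilinear_mapsI linear_mapsI;
    simp add: A.r_distr A.l_distr A.smult_mult_right A.smult_mult_left
      B.r_distr B.l_distr B.smult_mult_right B.smult_mult_left)+

text \<open>Left multiplication by the pure tensor of \<open>v\<close> and \<open>w\<close>. The
  product of \<open>tensor_algebra\<close> is a nested lift: this map is the inner lift, and lifting
  its dependence on \<open>v\<close> and \<open>w\<close> gives the outer one.\<close>

definition inner_mult where
  "inner_mult v w = tensor_lift (tensor_space A B) (\<lambda>v' w'. pure_tensor A B (v \<otimes>\<^bsub>A\<^esub> v') (w \<otimes>\<^bsub>B\<^esub> w'))"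

lemma inner_bilinear:
  assumes "v \<in> carrier A" "w \<in> carrier B"
  shows "(\<lambda>v' w'. pure_tensor A B (v \<otimes>\<^bsub>A\<^esub> v') (w \<otimes>\<^bsub>B\<^esub> w')) \<in> bilinear_maps A B (tensor_space A B)"
  using assms
  by (intro bilinear_maps_compose[OF pure_tensor_bilinear] bilinear_mapsD(1)[OF mult_bilinear(1)]
    bilinear_mapsD(1)[OF mult_bilinear(2)]) auto

lemma outer_bilinear:
  assumes "t \<in> carrier (tensor_space A B)"
  shows "(\<lambda>v w. inner_mult v w t) \<in> bilinear_maps A B (tensor_space A B)"
proof (rule bilinear_mapsI)
  fix v assume v: "v \<in> carrier A"
  show "(\<lambda>w. inner_mult v w t) \<in> linear_maps B (tensor_space A B)"
    unfolding inner_mult_def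
  proof (rule tensor_lift_linear_param[OF kspace_tensor_space inner_bilinear B.kspace_axioms _ assms])
    fix v' w' assume vw': "v' \<in> carrier A" "w' \<in> carrier B"
    show "(\<lambda>w. pure_tensor A B (v \<otimes>\<^bsub>A\<^esub> v') (w \<otimes>\<^bsub>B\<^esub> w')) \<in> linear_maps B (tensor_space A B)"
      using v vw' by (intro linear_maps_compose[OF bilinear_mapsD(2)[OF mult_bilinear(2)]]
        bilinear_mapsD(1)[OF pure_tensor_bilinear]) auto
  qed (use v in auto)
next
  fix w assume w: "w \<in> carrier B"
  show "(\<lambda>v. inner_mult v w t) \<in> linear_maps A (tensor_space A B)"
    unfolding inner_mult_def
  proof (rule tensor_lift_linear_param[OF kspace_tensor_space inner_bilinear A.kspace_axioms _ assms])
    fix v' w' assume vw': "v' \<in> carrier A" "w' \<in> carrier B"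
    show "(\<lambda>v. pure_tensor A B (v \<otimes>\<^bsub>A\<^esub> v') (w \<otimes>\<^bsub>B\<^esub> w')) \<in> linear_maps A (tensor_space A B)"
      using w vw' by (intro linear_maps_compose[OF bilinear_mapsD(2)[OF mult_bilinear(1)]]
        bilinear_mapsD(2)[OF pure_tensor_bilinear]) auto
  qed (use w in auto)
qed

lemma tensor_mult_eq: "s \<otimes>\<^bsub>AB\<^esub> t = tensor_lift (tensor_space A B) (\<lambda>v w. inner_mult v w t) s"
  by (simp add: tensor_algebra_def inner_mult_def)

lemma tensor_mult_left_linear:
  "t \<in> carrier (tensor_space A B) \<Longrightarrow> (\<lambda>s. s \<otimes>\<^bsub>AB\<^esub> t) \<in> linear_maps (tensor_space A B) (tensor_space A B)"
  unfolding tensor_mult_eq by (intro tensor_lift_linear kspace_tensor_space outer_bilinear)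

lemma tensor_mult_right_linear:
  assumes "s \<in> carrier (tensor_space A B)"
  shows "(\<lambda>t. s \<otimes>\<^bsub>AB\<^esub> t) \<in> linear_maps (tensor_space A B) (tensor_space A B)"
  unfolding tensor_mult_eq
proof (rule tensor_lift_linear_param[OF kspace_tensor_space outer_bilinear kspace_tensor_space _ assms])
  fix v w assume "v \<in> carrier A" "w \<in> carrier B"
  then show "(\<lambda>t. inner_mult v w t) \<in> linear_maps (tensor_space A B) (tensor_space A B)"
    unfolding inner_mult_def by (intro tensor_lift_linear kspace_tensor_space inner_bilinear)
qed

lemma tensor_mult_pure:
  assumes "v \<in> carrier A" "w \<in> carrier B" "v' \<in> carrier A" "w' \<in> carrier B"
  shows "pure_tensor A B v w \<otimes>\<^bsub>AB\<^esub> pure_tensor A B v' w' = pure_tensor A B (v \<otimes>\<^bsub>A\<^esub> v') (w \<otimes>\<^bsub>B\<^esub> w')"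
proof -
  have "pure_tensor A B v w \<otimes>\<^bsub>AB\<^esub> pure_tensor A B v' w' = inner_mult v w (pure_tensor A B v' w')"
    unfolding tensor_mult_eq
    by (rule tensor_lift_pure[OF kspace_tensor_space outer_bilinear]) (use assms in auto)
  also have "\<dots> = pure_tensor A B (v \<otimes>\<^bsub>A\<^esub> v') (w \<otimes>\<^bsub>B\<^esub> w')"
    unfolding inner_mult_def
    by (rule tensor_lift_pure[OF kspace_tensor_space inner_bilinear]) (use assms in auto)
  finally show ?thesis .
qed

text \<open>Once the product is linear in each factor, the ring laws reduce by
  \<open>tensor_induct\<close> to pure tensors, where they are the laws of the two algebras.\<close>

lemma kalgebra_tensor_algebra: "kalgebra AB"
proof -
  note L = tensor_mult_left_linear and R = tensor_mult_right_linear
  note cl = linear_maps_closed[OF L]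
  have assoc: "(s \<otimes>\<^bsub>AB\<^esub> t) \<otimes>\<^bsub>AB\<^esub> u = s \<otimes>\<^bsub>AB\<^esub> (t \<otimes>\<^bsub>AB\<^esub> u)"
    if s: "s \<in> carrier (tensor_space A B)" and t: "t \<in> carrier (tensor_space A B)"
      and u: "u \<in> carrier (tensor_space A B)" for s t u
    using u
  proof (induction u rule: tensor_induct)
    case (pure a b)
    show ?case
      using t
    proof (induction t rule: tensor_induct)
      case (pure a' b')
      show ?case
        using s
      proof (induction s rule: tensor_induct)
        case (pure a'' b'')
        then show ?case
          using \<open>a \<in> _\<close> \<open>b \<in> _\<close> \<open>a' \<in> _\<close> \<open>b' \<in> _\<close>
          by (simp add: tensor_mult_pure A.m_assoc B.m_assoc)
      next
        case (add s t)
        then show ?case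
          using \<open>a \<in> _\<close> \<open>b \<in> _\<close> \<open>a' \<in> _\<close> \<open>b' \<in> _\<close>
          by (simp add: linear_maps_add[OF L] cl)
      qed
    next
      case (add t t')
      then show ?case
        using \<open>a \<in> _\<close> \<open>b \<in> _\<close> s
        by (simp add: linear_maps_add[OF L] linear_maps_add[OF R] cl)
    qed
  next
    case (add u u')
    then show ?case
      using s t by (simp add: linear_maps_add[OF R] cl)
  qed
  have one: "\<one>\<^bsub>AB\<^esub> \<otimes>\<^bsub>AB\<^esub> t = t" "t \<otimes>\<^bsub>AB\<^esub> \<one>\<^bsub>AB\<^esub> = t" if "t \<in> carrier (tensor_space A B)" for t
    using that
    by (induction t rule: tensor_induct; simp add: tensor_mult_pure linear_maps_add[OF L] linear_maps_add[OF R])+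
  have "abelian_group AB"
    by (rule abelian_groupI) (simp_all add: T.a_ac T.add.l_inv_ex T.add.r_inv_ex)
  moreover have "monoid AB"
    by (rule monoidI) (auto simp: assoc one[simplified] cl)
  ultimately interpret ring AB
    by (rule ringI) (simp_all add: linear_maps_add[OF L] linear_maps_add[OF R])
  show ?thesis
    by unfold_locales (simp_all add: T.smult_add_left T.smult_add_right T.smult_smult
      linear_maps_smult[OF L] linear_maps_smult[OF R])
qed

end

section \<open>Presented algebras\<close>

lemma algebra_mapsI:
  assumes "f \<in> linear_maps A B"
    and "\<And>x y. x \<in> carrier A \<Longrightarrow> y \<in> carrier A \<Longrightarrow> f (x \<otimes>\<^bsub>A\<^esub> y) = f x \<otimes>\<^bsub>B\<^esub> f y"
    and "f \<one>\<^bsub>A\<^esub> = \<one>\<^bsub>B\<^esub>"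
  shows "f \<in> algebra_maps A B"
  using assms by (auto simp: algebra_maps_def linear_maps_def ring_hom_def)

lemma algebra_mapsD:
  assumes "f \<in> algebra_maps A B"
  shows "f \<in> linear_maps A B"
    and "x \<in> carrier A \<Longrightarrow> y \<in> carrier A \<Longrightarrow> f (x \<otimes>\<^bsub>A\<^esub> y) = f x \<otimes>\<^bsub>B\<^esub> f y"
    and "f \<one>\<^bsub>A\<^esub> = \<one>\<^bsub>B\<^esub>"
  using assms by (auto simp: algebra_maps_def ring_hom_def)

lemma poly_mapping_single_induct [case_names zero add]:
  assumes "P 0" "\<And>p k c. P p \<Longrightarrow> P (p + Poly_Mapping.single k c)"
  shows "P (p :: 'a \<Rightarrow>\<^sub>0 'k::comm_monoid_add)"
proof (induction p rule: update_induct)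
  case const
  then show ?case by (rule assms(1))
next
  case (update p k c)
  have "Poly_Mapping.update k c p = p + Poly_Mapping.single k c"
    using update.hyps
    by (intro poly_mapping_eqI) (auto simp: lookup_update lookup_add lookup_single in_keys_iff when_def)
  then show ?case using assms(2)[OF update.IH] by simp
qed

lemma pm_scale_mult_left: "pm_scale c p * q = pm_scale c (p * (q :: 'a::monoid_add \<Rightarrow>\<^sub>0 'k::field))"
  by (simp add: mult_map_scale_conv_mult mult.assoc)

text \<open>A scalar acts as a monomial at the empty word. Such monomials are central: the empty
  word is neutral on both sides and coefficients commute.\<close>

lemma pm_scale_mult_right: "p * pm_scale c q = pm_scale c (p * (q :: 'a::monoid_add \<Rightarrow>\<^sub>0 'k::field))"
proof -
  have "p * Poly_Mapping.single 0 c = Poly_Mapping.single 0 c * p"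
    by (induction p rule: poly_mapping_single_induct) (simp_all add: distrib_left distrib_right mult_single mult.commute)
  then show ?thesis by (simp add: mult_map_scale_conv_mult mult.assoc[symmetric])
qed

lemma free_algebra_simps [simp]:
  "carrier free_algebra = UNIV" "p \<oplus>\<^bsub>free_algebra\<^esub> q = p + q" "p \<otimes>\<^bsub>free_algebra\<^esub> q = p * q"
  "\<zero>\<^bsub>free_algebra\<^esub> = 0" "\<one>\<^bsub>free_algebra\<^esub> = 1" "c \<odot>\<^bsub>free_algebra\<^esub> p = pm_scale c p"
  by (simp_all add: free_algebra_def)

lemma kalgebra_free_algebra: "kalgebra (free_algebra :: ('k::field, 'x list \<Rightarrow>\<^sub>0 'k) module)"
proof -
  have "ring (free_algebra :: ('k, 'x list \<Rightarrow>\<^sub>0 'k) module)"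
    by (rule ringI, rule abelian_groupI) (auto intro!: monoidI exI[of _ "- _"] simp: algebra_simps)
  then interpret ring "free_algebra :: ('k, 'x list \<Rightarrow>\<^sub>0 'k) module" .
  show ?thesis
    by unfold_locales (simp_all add: pm_scale_simps pm_scale_mult_left pm_scale_mult_right)
qed

lemma linear_maps_free_algebra: "linear_maps free_algebra W = linear_maps (free_space UNIV) W"
  by (simp add: linear_maps_def)

locale kideal = kalgebra A + ideal I A for A :: "('k::field, 'a, 'm) module_scheme" (structure) and I
begin

sublocale S: ksubspace A I
proof
  show "I \<subseteq> carrier A" by (rule a_subset)
  show "c \<odot> x \<in> I" if "x \<in> I" for x c
  proof -
    \<comment> \<open>Scalar multiples are ring multiples, so an ideal of rings is automatically a
      subspace.\<close>
    have "c \<odot> x = (c \<odot> \<one>) \<otimes> x"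
      using that by (simp add: smult_mult_left)
    then show ?thesis
      using that by (metis I_l_closed one_closed smult_closed)
  qed
qed auto

lemma mult_quotient:
  "x \<in> carrier A \<Longrightarrow> y \<in> carrier A \<Longrightarrow> (I +> x) \<otimes>\<^bsub>quotient A I\<^esub> (I +> y) = I +> (x \<otimes> y)"
  by (simp add: quotient_def ring.defs module.defs FactRing_def rcoset_mult_add)

lemma one_quotient: "\<one>\<^bsub>quotient A I\<^esub> = I +> \<one>"
  by (simp add: quotient_def ring.defs module.defs FactRing_def)

lemma kalgebra_quotient: "kalgebra (quotient A I)"
proof -
  interpret Q: kspace "quotient A I" by (rule S.kspace_quotient)
  have "ring (quotient A I)"
    by (rule ringI[OF Q.abelian_group_axioms monoidI])
      (auto simp: S.carrier_quotient mult_quotient one_quotient S.add_quotient m_assoc l_distr r_distr)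
  then interpret R: ring "quotient A I" .
  show ?thesis
    by unfold_locales
      (auto simp: S.carrier_quotient mult_quotient S.smult_quotient smult_mult_left smult_mult_right)
qed

end

lemma kideal_Idl:
  fixes R :: "('x list \<Rightarrow>\<^sub>0 'k::field) set"
  shows "kideal free_algebra (Idl\<^bsub>free_algebra\<^esub> R)"
proof -
  interpret kalgebra "free_algebra :: ('k, 'x list \<Rightarrow>\<^sub>0 'k) module" by (rule kalgebra_free_algebra)
  show ?thesis
    by (intro kideal.intro kalgebra_axioms genideal_ideal) simp
qed

definition presented_proj :: "('x list \<Rightarrow>\<^sub>0 'k) set \<Rightarrow> ('x list \<Rightarrow>\<^sub>0 'k) \<Rightarrow> ('x list \<Rightarrow>\<^sub>0 'k::field) set" where
  "presented_proj R p = (Idl\<^bsub>free_algebra\<^esub> R) +>\<^bsub>free_algebra\<^esub> p"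

context
  fixes R :: "('x list \<Rightarrow>\<^sub>0 'k::field) set"
begin

interpretation I: kideal "free_algebra :: ('k, 'x list \<Rightarrow>\<^sub>0 'k) module" "Idl\<^bsub>free_algebra\<^esub> R"
  by (rule kideal_Idl)

lemma kalgebra_presented_algebra: "kalgebra (presented_algebra R)"
  unfolding presented_algebra_def by (rule I.kalgebra_quotient)

lemma carrier_presented_algebra: "carrier (presented_algebra R) = range (presented_proj R)"
  by (simp add: presented_algebra_def presented_proj_def[abs_def] I.S.carrier_quotient)

lemma presented_proj_simps:
  "presented_proj R p \<oplus>\<^bsub>presented_algebra R\<^esub> presented_proj R q = presented_proj R (p + q)"
  "presented_proj R p \<otimes>\<^bsub>presented_algebra R\<^esub> presented_proj R q = presented_proj R (p * q)"
  "c \<odot>\<^bsub>presented_algebra R\<^esub> presented_proj R p = presented_proj R (pm_scale c p)"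
  "\<zero>\<^bsub>presented_algebra R\<^esub> = presented_proj R 0"
  "\<one>\<^bsub>presented_algebra R\<^esub> = presented_proj R 1"
  using I.S.add_quotient[of p q] I.mult_quotient[of p q] I.S.smult_quotient[of p c]
    I.S.zero_quotient I.one_quotient
  by (simp_all add: presented_algebra_def presented_proj_def)

lemma presented_proj_relation:
  assumes "p - q \<in> R" shows "presented_proj R p = presented_proj R q"
proof -
  have "p \<ominus>\<^bsub>free_algebra\<^esub> q = p - q"
  proof -
    have "pm_scale (- 1) q = - q" by (auto intro: poly_mapping_eqI)
    then show ?thesis using I.smult_minus_one[of q] by (simp add: a_minus_def)
  qed
  then show ?thesis
    unfolding presented_proj_def
    using assms I.genideal_self[of R] by (subst I.S.coset_eq_iff) auto
qed

lemma presented_gen_eq: "presented_gen R x = presented_proj R (free_gen x)"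
  by (simp add: presented_gen_def presented_proj_def)

lemma presented_linear:
  assumes "kspace W" "f \<in> linear_maps free_algebra W" "\<And>x. x \<in> Idl\<^bsub>free_algebra\<^esub> R \<Longrightarrow> f x = \<zero>\<^bsub>W\<^esub>"
  shows "(\<lambda>Q. the_elem (f ` Q)) \<in> linear_maps (presented_algebra R) W"
    and "the_elem (f ` presented_proj R p) = f p"
  using I.S.quotient_map_linear[OF assms] I.S.image_coset[OF assms, of p]
  by (simp_all add: presented_algebra_def presented_proj_def)

text \<open>Letters and scalars generate the free algebra, so closure under multiplication by single
  letters suffices for a two-sided ideal. This suits functionals that are not multiplicative but
  change in a controlled way when one letter is added at either end.\<close>

lemma Idl_induct:
  assumes "x \<in> Idl\<^bsub>free_algebra\<^esub> R" and R: "\<And>r. r \<in> R \<Longrightarrow> P r"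
    and "P 0" and add: "\<And>p q. P p \<Longrightarrow> P q \<Longrightarrow> P (p + q)" and scale: "\<And>c p. P p \<Longrightarrow> P (pm_scale c p)"
    and left: "\<And>i p. P p \<Longrightarrow> P (Poly_Mapping.single [i] 1 * p)"
    and right: "\<And>i p. P p \<Longrightarrow> P (p * Poly_Mapping.single [i] 1)"
  shows "P x"
proof -
  have single_Cons: "Poly_Mapping.single (i # w) (1 :: 'k) = Poly_Mapping.single [i] 1 * Poly_Mapping.single w 1"
    for i :: 'x and w
    by (simp add: mult_single plus_list_def)
  have word_left: "P (Poly_Mapping.single w 1 * p)" if "P p" for w p
  proof (induction w)
    case Nil
    then show ?case using that by (simp flip: zero_list_def)
  next
    case (Cons i w)
    then show ?case using left by (simp add: single_Cons[of i w] mult.assoc)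
  qed
  have word_right: "P (p * Poly_Mapping.single w 1)" if "P p" for w p
    using that
  proof (induction w arbitrary: p)
    case Nil
    then show ?case by (simp flip: zero_list_def)
  next
    case (Cons i w)
    then show ?case using right by (simp add: single_Cons[of i w] flip: mult.assoc)
  qed
  have "P (Poly_Mapping.single w c * p)" if "P p" for w c p
    using scale[OF word_left[OF that], of c w] by (simp flip: pm_scale_mult_left)
  then have mult_left: "P (q * p)" if "P p" for p q
    by (induction q rule: poly_mapping_single_induct) (simp_all add: \<open>P 0\<close> distrib_right add that)
  have "P (p * Poly_Mapping.single w c)" if "P p" for w c p
    using scale[OF word_right[OF that], of c w] by (simp flip: pm_scale_mult_right)
  then have mult_right: "P (p * q)" if "P p" for p q
    by (induction q rule: poly_mapping_single_induct) (simp_all add: \<open>P 0\<close> distrib_left add that)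
  have "ideal {p. P p} free_algebra"
  proof (rule idealI[OF I.ring_axioms])
    show "subgroup {p. P p} (add_monoid (free_algebra :: ('k, 'x list \<Rightarrow>\<^sub>0 'k) module))"
    proof (rule I.add.subgroupI)
      fix p assume "p \<in> {p. P p}"
      then have "P (pm_scale (- 1) p)" using scale by blast
      then show "\<ominus>\<^bsub>free_algebra\<^esub> p \<in> {p. P p}"
        using I.smult_minus_one[of p] by simp
    qed (use \<open>P 0\<close> add in auto)
  qed (use mult_left mult_right in auto)
  then have "Idl\<^bsub>free_algebra\<^esub> R \<subseteq> {p. P p}"
    using R by (intro I.genideal_minimal) auto
  then show ?thesis using assms(1) by blast
qed

end

section \<open>Universal property\<close>

definition word_value :: "('k::field, 'b, 'm) module_scheme \<Rightarrow> ('x \<Rightarrow> 'b) \<Rightarrow> 'x list \<Rightarrow> 'b" where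
  "word_value B f w = foldr (\<lambda>x b. f x \<otimes>\<^bsub>B\<^esub> b) w \<one>\<^bsub>B\<^esub>"

lemma word_value_simps [simp]:
  "word_value B f [] = \<one>\<^bsub>B\<^esub>" "word_value B f (x # w) = f x \<otimes>\<^bsub>B\<^esub> word_value B f w"
  by (simp_all add: word_value_def)

lemma free_lift_eq: "free_lift B f = lin_ext B (word_value B f)"
  by (simp add: fun_eq_iff free_lift_def lin_ext_def word_value_def)

context kalgebra
begin

context
  fixes f :: "'x \<Rightarrow> 'a" assumes f: "\<And>x. f x \<in> carrier A"
begin

lemma word_value_closed [simp]: "word_value A f w \<in> carrier A"
  by (induction w) (simp_all add: f)

lemma word_value_append: "word_value A f (v @ w) = word_value A f v \<otimes> word_value A f w"
  by (induction v) (simp_all add: f m_assoc)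

lemma free_lift_linear: "free_lift A f \<in> linear_maps free_algebra A"
  unfolding free_lift_eq linear_maps_free_algebra by (rule lin_ext_linear[OF kspace_axioms]) simp

lemma free_lift_single: "free_lift A f (Poly_Mapping.single w c) = c \<odot> word_value A f w"
  unfolding free_lift_eq by (rule lin_ext_single) simp

lemma free_lift_algebra_map: "free_lift A f \<in> algebra_maps free_algebra A"
proof (rule algebra_mapsI[OF free_lift_linear])
  note add = linear_maps_add[OF free_lift_linear, simplified] and cl = linear_maps_closed[OF free_lift_linear, simplified]
  have zero: "free_lift A f 0 = \<zero>" by (simp add: free_lift_eq)
  have single: "free_lift A f (Poly_Mapping.single v c * q) =
      free_lift A f (Poly_Mapping.single v c) \<otimes> free_lift A f q" for v c q
    by (induction q rule: poly_mapping_single_induct)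
      (simp_all add: zero add cl distrib_left r_distr mult_single free_lift_single plus_list_def
        word_value_append smult_mult_left smult_mult_right smult_smult mult.commute)
  show "free_lift A f (p \<otimes>\<^bsub>free_algebra\<^esub> q) = free_lift A f p \<otimes> free_lift A f q" for p q
    by (induction p rule: poly_mapping_single_induct) (simp_all add: zero add cl distrib_right l_distr single)
  have "free_lift A f (Poly_Mapping.single [] 1) = \<one>"
    by (simp add: free_lift_single)
  then show "free_lift A f \<one>\<^bsub>free_algebra\<^esub> = \<one>"
    by (simp flip: zero_list_def)
qed

lemma presented_lift_algebra_map:
  assumes kill: "\<And>r. r \<in> R \<Longrightarrow> free_lift A f r = \<zero>"
  shows "presented_lift A f \<in> algebra_maps (presented_algebra R) A"
    and "presented_lift A f (presented_proj R p) = free_lift A f p"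
proof -
  note l = free_lift_linear and m = algebra_mapsD(2)[OF free_lift_algebra_map, simplified]
  note cl = linear_maps_closed[OF l, simplified]
  have "free_lift A f r = \<zero>" if "r \<in> Idl\<^bsub>free_algebra\<^esub> R" for r
    using that
    by (rule Idl_induct)
      (use linear_maps_add[OF l] linear_maps_smult[OF l] in \<open>simp_all add: kill m cl\<close>, simp add: free_lift_eq)
  note p = presented_linear[OF kspace_axioms l this]
  have eq: "presented_lift A f (presented_proj R p) = free_lift A f p" for p
    using p(2) by (simp add: presented_lift_def)
  show "presented_lift A f (presented_proj R p) = free_lift A f p" by (rule eq)
  show "presented_lift A f \<in> algebra_maps (presented_algebra R) A"
  proof (rule algebra_mapsI)
    show "presented_lift A f \<in> linear_maps (presented_algebra R) A"
      using p(1) by (simp add: presented_lift_def[abs_def])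
  qed (use algebra_mapsD(3)[OF free_lift_algebra_map] in
      \<open>auto simp: carrier_presented_algebra presented_proj_simps eq m\<close>)
qed

end

end

lemma opposite_simps [simp]:
  "carrier (opposite A) = carrier A" "x \<oplus>\<^bsub>opposite A\<^esub> y = x \<oplus>\<^bsub>A\<^esub> y" "x \<otimes>\<^bsub>opposite A\<^esub> y = y \<otimes>\<^bsub>A\<^esub> x"
  "\<zero>\<^bsub>opposite A\<^esub> = \<zero>\<^bsub>A\<^esub>" "\<one>\<^bsub>opposite A\<^esub> = \<one>\<^bsub>A\<^esub>" "c \<odot>\<^bsub>opposite A\<^esub> x = c \<odot>\<^bsub>A\<^esub> x"
  by (simp_all add: opposite_def)

lemma linear_maps_opposite [simp]: "linear_maps V (opposite A) = linear_maps V A"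
  by (simp add: linear_maps_def)

lemma kalgebra_opposite:
  assumes "kalgebra A" shows "kalgebra (opposite A)"
proof -
  interpret kalgebra A by fact
  have "abelian_group (opposite A)"
    by (rule abelian_groupI) (simp_all add: a_ac add.l_inv_ex add.r_inv_ex)
  moreover have "monoid (opposite A)"
    by (rule monoidI) (simp_all add: m_assoc)
  ultimately interpret O: ring "opposite A"
    by (rule ringI) (simp_all add: l_distr r_distr)
  show ?thesis
    by unfold_locales (simp_all add: smult_add_left smult_add_right smult_smult smult_mult_left smult_mult_right)
qed

section \<open>Dependence on the underlying vector space only\<close>

text \<open>A Hopf algebra record and the algebra record it extends have different types, so they
  cannot be equated; the comparison is made field by field. Tensor spaces use only the four fields
  listed here.\<close>

locale same_space =
  fixes V :: "('k::field, 'a, 'm) module_scheme" and V' :: "('k, 'a, 'n) module_scheme"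
  assumes same_carrier: "carrier V' = carrier V" and same_add: "add V' = add V"
    and same_zero: "zero V' = zero V" and same_smult: "module.smult V' = module.smult V"
begin

lemma tensor_null_same: "tensor_null V' V' = tensor_null V V"
proof (intro equalityI subsetI)
  fix p assume "p \<in> tensor_null V' V'"
  then show "p \<in> tensor_null V V"
    by induction (simp_all only: same_carrier same_add same_smult tensor_null.intros)
next
  fix p assume "p \<in> tensor_null V V"
  then show "p \<in> tensor_null V' V'"
    by induction (simp_all only: same_carrier[symmetric] same_add[symmetric] same_smult[symmetric] tensor_null.intros)
qed

lemma tensor_space_same: "tensor_space V' V' = tensor_space V V"
  by (simp add: tensor_space_def tensor_null_same same_carrier)

lemma pure_tensor_same: "pure_tensor V' V' = pure_tensor V V"
  by (simp add: fun_eq_iff pure_tensor_def tensor_null_same same_carrier)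

lemma finsum_same: "finsum V' = finsum V"
  by (simp add: fun_eq_iff finsum_def finprod_def same_carrier same_add same_zero)

end

section \<open>Normal forms in Suzuki's algebra\<close>

section \<open>Words and their invariants\<close>

lemma two_cases: "(i :: 2) = 0 \<or> i = 1"
proof (cases i)
  case (of_int z)
  then have "z = 0 \<or> z = 1" by auto
  with of_int show ?thesis by auto
qed

lemma two_simps [simp]: "(2 :: 2) = 0" "1 + 1 = (0 :: 2)" "- i = (i :: 2)" "i - j = i + (j :: 2)"
  "i + i = (0::2)" "i + (i + j) = (j::2)"
  using two_cases[of i] two_cases[of j] by auto

lemma of_nat_two: "(of_nat m :: 2) = (if even m then 0 else 1)"
  by (induction m) auto

text \<open>Letter \<open>t\<close> (counted from 0) of a word with row indices \<open>r\<close> is characterized by \<open>r\<^sub>t + t\<close>;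
  \<open>rows\<close> passes between the two descriptions, and \<open>cnt\<close> counts the letters with a given
  value. All words of one type with the same counts represent the same element.\<close>

fun rows :: "2 \<Rightarrow> 2 list \<Rightarrow> 2 list" where
  "rows k [] = []"
| "rows k (e # es) = (e + k) # rows (k + 1) es"

fun cnt :: "2 \<Rightarrow> 2 list \<Rightarrow> nat" where
  "cnt e [] = 0"
| "cnt e (i # r) = (if i = e then 1 else 0) + cnt (e + 1) r"

lemma length_rows [simp]: "length (rows k es) = length es"
  by (induction es arbitrary: k) simp_all

lemma rows_eq_Nil [simp]: "rows k es = [] \<longleftrightarrow> es = []"
  by (cases es) simp_all

lemma rows_append: "rows k (es @ fs) = rows k es @ rows (k + of_nat (length es)) fs"
  by (induction es arbitrary: k) (simp_all add: add.assoc add.commute)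

lemma rows_rows [simp]: "rows k (rows k es) = es"
  by (induction es arbitrary: k) (simp_all add: add.assoc)

lemma rows_map_add: "rows k (map (\<lambda>e. e + c) es) = rows (k + c) es"
  by (induction es arbitrary: k) (simp_all add: add_ac)

lemma cnt_rows: "cnt e (rows k es) = count_list es (e + k)"
proof (induction es arbitrary: e k)
  case (Cons f es)
  have "f + k = e \<longleftrightarrow> f = e + k"
    using two_cases[of e] two_cases[of f] two_cases[of k] by auto
  then show ?case using Cons by (simp add: add.commute add.left_commute)
qed simp

lemma count_list_replicate: "count_list (replicate m x) y = (if x = y then m else 0)"
  by (induction m) auto

lemma cnt_append: "cnt e (r @ s) = cnt e r + cnt (e + of_nat (length r)) s"
  by (induction r arbitrary: e) (simp_all add: add_ac)

lemma cnt_shift: "cnt e (map (\<lambda>i. i + c) r) = cnt (e + c) r"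
proof (induction r arbitrary: e)
  case (Cons i r)
  have "i + c = e \<longleftrightarrow> i = e + c"
    using two_cases[of e] two_cases[of i] two_cases[of c] by auto
  then show ?case using Cons by (simp add: add_ac)
qed simp

lemma cnt_replicate_even: "cnt e (replicate (2 * m) i) = m"
proof (induction m arbitrary: e)
  case (Suc m)
  have "(i = e \<and> i \<noteq> e + 1) \<or> (i \<noteq> e \<and> i = e + 1)"
    using two_cases[of e] two_cases[of i] by auto
  then show ?case using Suc[of e] by auto
qed simp

lemma cnt_replicate_odd: "cnt e (replicate (Suc (2 * m)) i) = (if i = e then Suc m else m)"
  using cnt_replicate_even[of "e + 1" m i] by simp

section \<open>Suzuki's algebra\<close>

definition gen_word :: "2 \<Rightarrow> 2 list \<Rightarrow> (idx list \<Rightarrow>\<^sub>0 'k::field)" where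
  "gen_word d r = Poly_Mapping.single (map (\<lambda>i. (i, i + d)) r) 1"

lemma gen_word_append: "gen_word d (r @ s) = gen_word d r * gen_word d s"
  by (simp add: gen_word_def mult_single plus_list_def)

lemma single_Nil: "Poly_Mapping.single [] 1 = 1"
  by (simp flip: zero_list_def)

lemma gen_word_Nil: "gen_word d [] = 1"
  by (simp add: gen_word_def single_Nil)

lemma free_gen_eq: "free_gen (i, j) = gen_word (i + j) [i]"
  by (simp add: free_gen_def gen_word_def)

lemma gen_word_power: "gen_word d [i] ^ m = gen_word d (replicate m i)"
  by (induction m) (simp_all add: gen_word_Nil flip: gen_word_append)

text \<open>In an alternating word the row index and the position change together, so their sum is
  constant. Under \<open>rows\<close> the word becomes a constant list, and an alternating relation
  trades \<open>n\<close> letters of one kind for \<open>n\<close> of the other.\<close>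

lemma alternating_gen_word: "alternating m (gen_word d [i]) (gen_word d [i + 1]) = gen_word d (rows i (replicate m 0))"
proof (induction m arbitrary: i)
  case (Suc m)
  from Suc[of "i + 1"] show ?case
    by (simp add: add.assoc flip: gen_word_append)
qed (simp add: gen_word_Nil)

lemma of_int_mult_eq: "of_int z * p = pm_scale (of_int z) (p :: 'x list \<Rightarrow>\<^sub>0 'k::field)"
  by (simp add: mult_map_scale_conv_mult)

text \<open>Since \<open>2 = 0\<close> in the index type, \<open>x\<^sub>1\<^sub>1\<close> and
  \<open>x\<^sub>2\<^sub>2\<close> are the letters of type 0 with rows 1 and 0, while
  \<open>x\<^sub>1\<^sub>2\<close> and \<open>x\<^sub>2\<^sub>1\<close> are those of type 1 with
  rows 1 and 0. Both types then obey relations of the same shape, apart from the sign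
  \<open>lam\<close>.\<close>

lemma suzuki_relations_eq:
  "suzuki_relations N n 1 lam =
    {gen_word 0 [1, 1] - gen_word 0 [0, 0], gen_word 1 [1, 1] - gen_word 1 [0, 0],
     gen_word 0 (replicate (2 * N) 1) + gen_word 1 (replicate (2 * N) 1) - 1,
     gen_word 0 (rows 1 (replicate n 0)) - gen_word 0 (rows 0 (replicate n 0)),
     gen_word 1 (rows 0 (replicate n 0)) - pm_scale (of_int lam) (gen_word 1 (rows 1 (replicate n 0)))}
    \<union> {gen_word d [i] * gen_word d' [l] | i d l d'. d \<noteq> d'}"
proof -
  have pow: "gen_word d [i] ^ 2 = gen_word d [i, i]" for d i
    by (simp add: power2_eq_square flip: gen_word_append)
  have alt: "alternating n (gen_word d [1]) (gen_word d [0]) = gen_word d (rows 1 (replicate n 0))"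
    "alternating n (gen_word d [0]) (gen_word d [1]) = gen_word d (rows 0 (replicate n 0))" for d
    using alternating_gen_word[of n d 1] alternating_gen_word[of n d 0] by simp_all
  have mixed: "{gen_word (i + j) [i] * gen_word (l + m) [l] | i j l m. i + j \<noteq> l + m} =
      {gen_word d [i] * gen_word d' [l] | i d l d'. (d :: 2) \<noteq> d'}" (is "?L = ?R")
  proof (intro equalityI subsetI)
    fix x assume "x \<in> ?R"
    then obtain i d l d' where x: "x = gen_word d [i] * gen_word d' [l]" "d \<noteq> d'" by blast
    \<comment> \<open>The column index is recovered from row and type as
      \<open>i + d\<close>.\<close>
    have "x = gen_word (i + (i + d)) [i] * gen_word (l + (l + d')) [l]" "i + (i + d) \<noteq> l + (l + d')"
      using x by simp_all
    then show "x \<in> ?L" by blast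
  qed blast
  show ?thesis
    unfolding suzuki_relations_def Let_def
    by (simp only: free_gen_eq two_simps add_0 add_0_right of_int_1 mult_1_left pow alt gen_word_power of_int_mult_eq mixed)
      (simp add: numeral_2_eq_2)
qed

text \<open>If the type is not constant along a word, it changes between two adjacent letters; that
  product of two letters is a relation.\<close>

lemma word_cases:
  assumes "w \<noteq> []"
  obtains (pure) d r where "r \<noteq> []" "w = map (\<lambda>i. (i, i + d)) r"
  | (mixed) u v i j d d' where "d \<noteq> d'" "w = u @ [(i, i + d), (j, j + d')] @ (v :: idx list)"
  using assms
proof (induction w arbitrary: thesis)
  case (Cons x w)
  obtain i j where "x = (i, j)" by (cases x)
  then have x: "x = (i, i + (i + j))" by simp
  define d where "d = i + j"
  show ?case
  proof (cases "w = []")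
    case True
    show ?thesis
      by (rule Cons.prems(1)[of "[i]" d]) (simp_all only: True x d_def list.map list.simps not_False_eq_True)
  next
    case False
    show ?thesis
    proof (rule Cons.IH)
      fix d' r assume r: "r \<noteq> []" "w = map (\<lambda>i. (i, i + d')) r"
      show ?thesis
      proof (cases "d = d'")
        case True
        show ?thesis
          by (rule Cons.prems(1)[of "i # r" d']) (simp_all only: True[symmetric] x r d_def list.map list.simps not_False_eq_True)
      next
        case False
        obtain j s where s: "r = j # s" using r(1) by (cases r) auto
        show ?thesis
          by (rule Cons.prems(2)[of d d' "[]" i j "map (\<lambda>i. (i, i + d')) s", OF False])
            (simp only: x r s d_def list.map append.simps)
      qed
    next
      fix u v j l d1 d2 assume w: "d1 \<noteq> d2" "w = u @ [(j, j + d1), (l, l + d2)] @ v"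
      show ?thesis
        by (rule Cons.prems(2)[of d1 d2 "x # u" j l v, OF w(1)]) (simp only: w append.simps)
    qed (rule False)
  qed
qed simp

text \<open>With this sign, both relations between alternating words read
  \<open>gen_word d (rows 0 (replicate n 0)) = sgn_of lam d * gen_word d (rows 1 (replicate n 0))\<close>.\<close>

definition sgn_of :: "int \<Rightarrow> 2 \<Rightarrow> 'k::field" where
  "sgn_of lam d = (if d = 0 then 1 else of_int lam)"

text \<open>Stated for linear maps, not algebra maps, because it serves both for the universal
  property and for functionals on the free algebra that are not multiplicative.\<close>

lemma relation_zero:
  assumes W: "kspace W" and f: "f \<in> linear_maps free_algebra W"
    and square: "\<And>d. f (gen_word d [1, 1]) = f (gen_word d [0, 0])"
    and unit: "f (gen_word 0 (replicate (2 * N) 1)) \<oplus>\<^bsub>W\<^esub> f (gen_word 1 (replicate (2 * N) 1)) = f 1"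
    and alt: "\<And>d. f (gen_word d (rows 0 (replicate n 0))) =
      sgn_of lam d \<odot>\<^bsub>W\<^esub> f (gen_word d (rows 1 (replicate n 0)))"
    and mixed: "\<And>d d' i j. d \<noteq> d' \<Longrightarrow> f (gen_word d [i] * gen_word d' [j]) = \<zero>\<^bsub>W\<^esub>"
    and r: "r \<in> suzuki_relations N n 1 lam"
  shows "f r = \<zero>\<^bsub>W\<^esub>"
proof -
  interpret W: kspace W by fact
  note cl = linear_maps_closed[OF f, simplified]
  note add = linear_maps_add[OF f, simplified] and scale = linear_maps_smult[OF f, simplified]
  have diff: "f (p - q) = f p \<ominus>\<^bsub>W\<^esub> f q" for p q
  proof -
    have "f (p - q) = f (p + pm_scale (- 1) q)"
      by (intro arg_cong[of _ _ f] poly_mapping_eqI) (simp add: lookup_add lookup_minus)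
    then show ?thesis
      by (simp add: add scale cl W.smult_minus_one a_minus_def)
  qed
  have [simp]: "x \<ominus>\<^bsub>W\<^esub> x = \<zero>\<^bsub>W\<^esub>" if "x \<in> carrier W" for x
    using that by (simp add: a_minus_def W.r_neg)
  have alt0: "f (gen_word 0 (rows 0 (replicate n 0))) = f (gen_word 0 (rows 1 (replicate n 0)))"
    using alt[of 0] by (simp add: sgn_of_def cl)
  have alt1: "f (gen_word 1 (rows 0 (replicate n 0))) = of_int lam \<odot>\<^bsub>W\<^esub> f (gen_word 1 (rows 1 (replicate n 0)))"
    using alt[of 1] by (simp add: sgn_of_def)
  from r show ?thesis
    unfolding suzuki_relations_eq
    by (elim UnE insertE emptyE CollectE exE conjE)
      (simp_all only: diff add scale square alt0 alt1 unit, simp_all add: cl mixed)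
qed

text \<open>The argument \<open>K\<close> ties the locale to a ground field, which \<open>N\<close>,
  \<open>n\<close> and \<open>lam\<close> do not mention.\<close>

locale suzuki =
  fixes N n :: nat and lam :: int and K :: "'k::field itself"
  assumes N: "N \<ge> 1" and n: "n \<ge> 1" and lam: "lam = 1 \<or> lam = - 1"
begin

abbreviation "R \<equiv> suzuki_relations N n 1 lam :: (idx list \<Rightarrow>\<^sub>0 'k) set"

abbreviation A :: "('k, 'k suzuki) module" where "A \<equiv> suzuki_algebra N n 1 lam"

definition mon :: "2 \<Rightarrow> 2 list \<Rightarrow> 'k suzuki" where
  "mon d r = presented_proj R (gen_word d r)"

lemma kalgebra_A: "kalgebra A"
  unfolding suzuki_algebra_def by (rule kalgebra_presented_algebra)

sublocale A: kalgebra A by (rule kalgebra_A)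

lemmas proj_simps = presented_proj_simps[of R, folded suzuki_algebra_def]
lemmas carrier_A = carrier_presented_algebra[of R, folded suzuki_algebra_def]

lemma mon_closed [simp]: "mon d r \<in> carrier A"
  by (simp add: mon_def carrier_A)

lemma mon_append: "mon d (r @ s) = mon d r \<otimes>\<^bsub>A\<^esub> mon d s"
  by (simp add: mon_def proj_simps gen_word_append)

lemma mon_Cons: "mon d (i # s) = mon d [i] \<otimes>\<^bsub>A\<^esub> mon d s"
  using mon_append[of d "[i]" s] by simp

lemma mon_Nil: "mon d [] = \<one>\<^bsub>A\<^esub>"
  by (simp add: mon_def proj_simps gen_word_Nil)

lemma proj_zero: "p \<in> R \<Longrightarrow> presented_proj R p = \<zero>\<^bsub>A\<^esub>"
  using presented_proj_relation[of p 0 R] by (simp add: proj_simps)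

lemma proj_eq: "p - q \<in> R \<Longrightarrow> presented_proj R p = presented_proj R q"
  by (rule presented_proj_relation)

lemma in_R:
  "gen_word 0 [1, 1] - gen_word 0 [0, 0] \<in> R" "gen_word 1 [1, 1] - gen_word 1 [0, 0] \<in> R"
  "gen_word 0 (replicate (2 * N) 1) + gen_word 1 (replicate (2 * N) 1) - 1 \<in> R"
  "gen_word 0 (rows 1 (replicate n 0)) - gen_word 0 (rows 0 (replicate n 0)) \<in> R"
  "gen_word 1 (rows 0 (replicate n 0)) - pm_scale (of_int lam) (gen_word 1 (rows 1 (replicate n 0))) \<in> R"
  "d \<noteq> d' \<Longrightarrow> gen_word d [i] * gen_word d' [j] \<in> R"
  unfolding suzuki_relations_eq by blast+

lemma mon_mult_mixed_letters:
  assumes "d \<noteq> d'" shows "mon d [i] \<otimes>\<^bsub>A\<^esub> mon d' [j] = \<zero>\<^bsub>A\<^esub>"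
  using proj_zero[OF in_R(6)[OF assms]] by (simp only: mon_def proj_simps(2))

lemma mon_mult_mixed:
  assumes "d \<noteq> d'" "r \<noteq> []" "s \<noteq> []" shows "mon d r \<otimes>\<^bsub>A\<^esub> mon d' s = \<zero>\<^bsub>A\<^esub>"
proof -
  obtain r' i where r: "r = r' @ [i]" using assms(2) by (cases r rule: rev_cases) auto
  obtain j s' where s: "s = j # s'" using assms(3) by (cases s) auto
  have "mon d r \<otimes>\<^bsub>A\<^esub> mon d' s = mon d r' \<otimes>\<^bsub>A\<^esub> (mon d [i] \<otimes>\<^bsub>A\<^esub> mon d' [j]) \<otimes>\<^bsub>A\<^esub> mon d' s'"
    by (simp add: r s mon_append mon_Cons[of d' j s'] A.m_assoc)
  then show ?thesis by (simp add: mon_mult_mixed_letters assms(1))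
qed

lemma mon_square: "mon d [i, i] = mon d [j, j]"
proof -
  have "mon d [1, 1] = mon d [0, 0]"
    using two_cases[of d] proj_eq[OF in_R(1)] proj_eq[OF in_R(2)] unfolding mon_def by metis
  then show ?thesis using two_cases[of i] two_cases[of j] by auto
qed

lemma mon_unit: "mon 0 (replicate (2 * N) 1) \<oplus>\<^bsub>A\<^esub> mon 1 (replicate (2 * N) 1) = \<one>\<^bsub>A\<^esub>"
  unfolding mon_def proj_simps by (rule proj_eq) (rule in_R)

lemma mon_alt: "mon d (rows 0 (replicate n 0)) = sgn_of lam d \<odot>\<^bsub>A\<^esub> mon d (rows 1 (replicate n 0))"
proof -
  have "mon 0 (rows 1 (replicate n 0)) = mon 0 (rows 0 (replicate n 0))"
    unfolding mon_def by (rule proj_eq) (rule in_R)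
  moreover have "mon 1 (rows 0 (replicate n 0)) = of_int lam \<odot>\<^bsub>A\<^esub> mon 1 (rows 1 (replicate n 0))"
    unfolding mon_def proj_simps by (rule proj_eq) (rule in_R)
  ultimately show ?thesis using two_cases[of d] by (auto simp: sgn_of_def)
qed

lemma mon_Cons_cong: "mon d r = mon d s \<Longrightarrow> mon d (i # r) = mon d (i # s)"
  using mon_Cons[of d i r] mon_Cons[of d i s] by simp

lemma mon_swap: "mon d (rows k (e # f # es)) = mon d (rows k (f # e # es))"
proof (cases "e = f")
  case False
  then have "f = e + 1" using two_cases[of e] two_cases[of f] by auto
  then have "mon d (rows k (e # f # es)) = mon d [e + k, e + k] \<otimes>\<^bsub>A\<^esub> mon d (rows k es)"
    "mon d (rows k (f # e # es)) = mon d [f + k, f + k] \<otimes>\<^bsub>A\<^esub> mon d (rows k es)"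
    by (simp_all add: add_ac flip: mon_append)
  then show ?thesis using mon_square[of d "e + k" "f + k"] by simp
qed simp

lemma mon_move: "mon d (rows k (es @ f # fs)) = mon d (rows k (f # es @ fs))"
proof (induction es arbitrary: k)
  case (Cons e es)
  have "mon d (rows k (e # (es @ f # fs))) = mon d (rows k (e # f # es @ fs))"
    using mon_Cons_cong[OF Cons.IH] by simp
  also have "\<dots> = mon d (rows k (f # e # es @ fs))" by (rule mon_swap)
  finally show ?case by simp
qed simp

lemma mon_mset: "mset es = mset fs \<Longrightarrow> mon d (rows k es) = mon d (rows k fs)"
proof (induction es arbitrary: fs k)
  case (Cons e es)
  then have "e \<in> set fs" by (metis list.set_intros(1) mset_eq_setD)
  then obtain xs ys where fs: "fs = xs @ e # ys" by (meson split_list)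
  have "mon d (rows (k + 1) es) = mon d (rows (k + 1) (xs @ ys))"
    by (rule Cons.IH) (use Cons.prems fs in simp)
  from mon_Cons_cong[OF this, of "e + k"] have "mon d (rows k (e # es)) = mon d (rows k (e # xs @ ys))"
    by simp
  then show ?case unfolding fs mon_move .
qed simp

text \<open>As \<open>rows 0\<close> is an involution, equal counts mean that the two lists of kinds
  are permutations of each other, and adjacent swaps generate all permutations.\<close>

lemma mon_cong:
  assumes "cnt 0 r = cnt 0 s" "cnt 1 r = cnt 1 s" shows "mon d r = mon d s"
proof -
  have "count_list (rows 0 r) e = count_list (rows 0 s) e" for e
    using assms two_cases[of e] cnt_rows[of _ 0 "rows 0 r"] cnt_rows[of _ 0 "rows 0 s"] by auto
  then have "mset (rows 0 r) = mset (rows 0 s)"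
    by (intro multiset_eqI) (simp add: count_mset)
  from mon_mset[OF this, of d 0] show ?thesis by simp
qed

text \<open>The shift by \<open>N\<close> makes the word nonempty and does not change the element it represents.\<close>

definition U :: "2 \<Rightarrow> nat \<Rightarrow> nat \<Rightarrow> 'k suzuki" where
  "U d a b = mon d (rows 0 (replicate (a + N) 0 @ replicate (b + N) 1))"

lemma U_closed [simp]: "U d a b \<in> carrier A"
  by (simp add: U_def)

lemma cnt_U_word:
  "cnt 0 (rows 0 (replicate a 0 @ replicate b 1)) = a" "cnt 1 (rows 0 (replicate a 0 @ replicate b 1)) = b"
  by (simp_all add: cnt_rows count_list_replicate)

text \<open>Multiply by the unit, written as the sum of a word of type 0 and a word of type 1: for
  nonempty \<open>r\<close> the summand of the other type is annihilated.\<close>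

lemma mon_append_unit:
  assumes "r \<noteq> []" shows "mon d (r @ replicate (2 * N) 1) = mon d r"
proof -
  have ne: "replicate (2 * N) (1 :: 2) \<noteq> []" using N by simp
  have "mon d r = mon d r \<otimes>\<^bsub>A\<^esub> (mon 0 (replicate (2 * N) 1) \<oplus>\<^bsub>A\<^esub> mon 1 (replicate (2 * N) 1))"
    by (simp only: mon_unit A.r_one mon_closed)
  also have "\<dots> = mon d r \<otimes>\<^bsub>A\<^esub> mon 0 (replicate (2 * N) 1) \<oplus>\<^bsub>A\<^esub> mon d r \<otimes>\<^bsub>A\<^esub> mon 1 (replicate (2 * N) 1)"
    by (simp add: A.r_distr)
  also have "\<dots> = mon d r \<otimes>\<^bsub>A\<^esub> mon d (replicate (2 * N) 1)"
    using two_cases[of d] mon_mult_mixed[OF _ assms ne] by auto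
  finally show ?thesis by (simp add: mon_append)
qed

lemma mon_eq_U:
  assumes "r \<noteq> []" shows "mon d r = U d (cnt 0 r) (cnt 1 r)"
proof -
  have "mon d r = mon d (r @ replicate (2 * N) 1)"
    by (rule mon_append_unit[OF assms, symmetric])
  also have "\<dots> = U d (cnt 0 r) (cnt 1 r)"
    unfolding U_def by (rule mon_cong) (simp_all add: cnt_U_word cnt_append cnt_replicate_even)
  finally show ?thesis .
qed

lemma U_eqI: "r \<noteq> [] \<Longrightarrow> cnt 0 r = a \<Longrightarrow> cnt 1 r = b \<Longrightarrow> mon d r = U d a b"
  using mon_eq_U[of r d] by simp

lemma U_word_nonempty: "rows 0 (replicate (a + N) 0 @ replicate (b + N) 1) \<noteq> []"
  using N by simp

text \<open>The word that defines \<open>U d a b\<close> already has counts \<open>a + N\<close> and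
  \<open>b + N\<close>; reading these counts off gives the left-hand side.\<close>

lemma U_shift: "U d (a + N) (b + N) = U d a b"
proof -
  have "mon d (rows 0 (replicate (a + N) 0 @ replicate (b + N) 1)) = U d (a + N) (b + N)"
    by (rule U_eqI[OF U_word_nonempty cnt_U_word])
  then show ?thesis by (simp only: U_def[of d a b])
qed

lemma U_shifts: "U d (a + m * N) (b + m * N) = U d a b"
proof (induction m)
  case (Suc m)
  have "U d (a + Suc m * N) (b + Suc m * N) = U d (a + m * N + N) (b + m * N + N)"
    by (simp add: ac_simps)
  then show ?case by (simp only: U_shift Suc)
qed simp

lemma U_alt: "U d (a + n) b = sgn_of lam d \<odot>\<^bsub>A\<^esub> U d a (b + n)"
proof -
  let ?es = "replicate (a + N) 0 @ replicate (b + N) (1 :: 2)"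
  \<comment> \<open>After a prefix of \<open>n\<close> letters the remaining letters sit at
    positions shifted by \<open>n\<close>. This remainder is common to both sides, which differ only
    in the alternating prefix.\<close>
  let ?w = "rows (of_nat n) ?es"
  have rows1: "rows 0 (replicate n 1) = rows 1 (replicate n 0)"
    using rows_map_add[of 0 1 "replicate n 0"] by simp
  have "U d (a + n) b = mon d (rows 0 (replicate n 0 @ ?es))"
    by (subst U_shift[symmetric], rule U_eqI[symmetric]) (use N in \<open>auto simp: cnt_rows count_list_replicate\<close>)
  also have "\<dots> = mon d (rows 0 (replicate n 0)) \<otimes>\<^bsub>A\<^esub> mon d ?w"
    by (simp add: rows_append mon_append)
  also have "\<dots> = sgn_of lam d \<odot>\<^bsub>A\<^esub> (mon d (rows 0 (replicate n 1)) \<otimes>\<^bsub>A\<^esub> mon d ?w)"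
    by (simp add: mon_alt[of d] A.smult_mult_left rows1)
  also have "mon d (rows 0 (replicate n 1)) \<otimes>\<^bsub>A\<^esub> mon d ?w = mon d (rows 0 (replicate n 1 @ ?es))"
    by (simp add: rows_append mon_append)
  also have "\<dots> = U d a (b + n)"
    by (subst U_shift[symmetric], rule U_eqI) (use N in \<open>auto simp: cnt_rows count_list_replicate\<close>)
  finally show ?thesis .
qed

text \<open>Concatenation shifts the positions in the second word by the length of the first, whose
  parity is that of \<open>a + b\<close>. An odd shift exchanges the two kinds of letters in the
  second factor.\<close>

lemma U_mult:
  "U d a b \<otimes>\<^bsub>A\<^esub> U d' a' b' =
    (if d \<noteq> d' then \<zero>\<^bsub>A\<^esub> else if even (a + b) then U d (a + a') (b + b') else U d (a + b') (b + a'))"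
proof (cases "d = d'")
  case False
  then show ?thesis
    unfolding U_def using mon_mult_mixed[OF False U_word_nonempty U_word_nonempty] by simp
next
  case True
  let ?w = "\<lambda>a b. rows 0 (replicate (a + N) 0 @ replicate (b + N) 1)"
  have len: "length (?w a b) = a + b + 2 * N" by simp
  have "U d a b \<otimes>\<^bsub>A\<^esub> U d a' b' = mon d (?w a b @ ?w a' b')"
    by (simp add: U_def mon_append)
  also have "\<dots> = U d (cnt 0 (?w a b @ ?w a' b')) (cnt 1 (?w a b @ ?w a' b'))"
    by (rule mon_eq_U) (use U_word_nonempty in simp)
  also have "\<dots> = (if even (a + b) then U d (a + a' + 2 * N) (b + b' + 2 * N)
      else U d (a + b' + 2 * N) (b + a' + 2 * N))"
  proof (cases "even (a + b)")
    case True
    then have "(of_nat (length (?w a b)) :: 2) = 0" unfolding len of_nat_two by simp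
    then show ?thesis
      using True by (simp add: cnt_append cnt_U_word mult_2 mult_2_right ac_simps del: length_rows length_append)
  next
    case False
    then have "(of_nat (length (?w a b)) :: 2) = 1" unfolding len of_nat_two by simp
    then show ?thesis
      using False by (simp add: cnt_append cnt_U_word mult_2 mult_2_right ac_simps del: length_rows length_append)
  qed
  finally show ?thesis
    using True by (simp add: U_shifts)
qed

lemma one_eq: "\<one>\<^bsub>A\<^esub> = U 0 0 0 \<oplus>\<^bsub>A\<^esub> U 1 0 0"
proof -
  have "mon d (replicate (2 * N) 1) = U d 0 0" for d
    unfolding U_def by (rule mon_cong) (simp_all add: cnt_U_word cnt_replicate_even del: replicate.simps)
  then show ?thesis using mon_unit by simp
qed

text \<open>The \<open>U d a b\<close> span: by \<open>word_cases\<close> a nonempty word is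
  homogeneous, hence some \<open>U d a b\<close>, or it is zero, and the empty word is the sum in
  \<open>one_eq\<close>.\<close>

lemma A_induct [consumes 1, case_names add U]:
  assumes "x \<in> carrier A"
    and add: "\<And>x y. x \<in> carrier A \<Longrightarrow> y \<in> carrier A \<Longrightarrow> P x \<Longrightarrow> P y \<Longrightarrow> P (x \<oplus>\<^bsub>A\<^esub> y)"
    and U: "\<And>c d a b. P (c \<odot>\<^bsub>A\<^esub> U d a b)"
  shows "P x"
proof -
  have zero: "P \<zero>\<^bsub>A\<^esub>" using U[of 0 0 0 0] by simp
  have word: "P (c \<odot>\<^bsub>A\<^esub> presented_proj R (Poly_Mapping.single w 1))" for c w
  proof (cases "w = []")
    case True
    then have "presented_proj R (Poly_Mapping.single w 1) = U 0 0 0 \<oplus>\<^bsub>A\<^esub> U 1 0 0"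
      using one_eq by (simp add: proj_simps flip: zero_list_def)
    then show ?thesis using add U by (simp add: A.smult_add_right)
  next
    case False
    then show ?thesis
    proof (cases rule: word_cases)
      case (pure d r)
      then have "presented_proj R (Poly_Mapping.single w 1) = U d (cnt 0 r) (cnt 1 r)"
        using mon_eq_U[of r d] by (simp add: mon_def gen_word_def)
      then show ?thesis using U by simp
    next
      case (mixed u v i j d d')
      have "Poly_Mapping.single w (1 :: 'k) =
          Poly_Mapping.single u 1 * (gen_word d [i] * gen_word d' [j]) * Poly_Mapping.single v 1"
        by (simp add: mixed(2) gen_word_def mult_single plus_list_def)
      then have "presented_proj R (Poly_Mapping.single w 1) =
          presented_proj R (Poly_Mapping.single u 1) \<otimes>\<^bsub>A\<^esub> (mon d [i] \<otimes>\<^bsub>A\<^esub> mon d' [j]) \<otimes>\<^bsub>A\<^esub>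
          presented_proj R (Poly_Mapping.single v 1)"
        by (simp add: proj_simps mon_def)
      then show ?thesis
        using zero by (simp add: mon_mult_mixed_letters[OF mixed(1)] carrier_A)
    qed
  qed
  have "P (presented_proj R p)" for p
  proof (induction p rule: poly_mapping_single_induct)
    case zero
    then show ?case using \<open>P \<zero>\<^bsub>A\<^esub>\<close> by (simp add: proj_simps)
  next
    case (add p w c)
    then have "P (presented_proj R p \<oplus>\<^bsub>A\<^esub> c \<odot>\<^bsub>A\<^esub> presented_proj R (Poly_Mapping.single w 1))"
      by (intro assms(2) word) (auto simp: carrier_A proj_simps)
    then show ?case by (simp add: proj_simps)
  qed
  then show ?thesis using assms(1) by (auto simp: carrier_A)
qed

lemma A_maps_eq:
  assumes "f \<in> linear_maps A Z" "g \<in> linear_maps A Z" "\<And>d a b. f (U d a b) = g (U d a b)" "x \<in> carrier A"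
  shows "f x = g x"
  using assms(4)
  by (induction x rule: A_induct)
    (simp_all add: assms(3) linear_maps_add[OF assms(1)] linear_maps_add[OF assms(2)]
      linear_maps_smult[OF assms(1)] linear_maps_smult[OF assms(2)])

end

section \<open>Structure maps evaluated on \<open>U d a b\<close>, and the Hopf algebra
  axioms\<close>

section \<open>The Hopf algebra structure\<close>

text \<open>Row indices of the antipode of a homogeneous word, for \<open>m = 2 * N - 1\<close>: the
  order of letters is reversed, and \<open>x\<^sub>i\<^sub>j\<close> with \<open>j = i + d\<close>
  becomes the \<open>m\<close>-th power of \<open>x\<^sub>j\<^sub>i\<close>, whose row is
  \<open>i + d\<close>.\<close>

fun srows :: "nat \<Rightarrow> 2 \<Rightarrow> 2 list \<Rightarrow> 2 list" where
  "srows m d [] = []"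
| "srows m d (i # r) = srows m d r @ replicate m (i + d)"

lemma length_srows: "length (srows m d r) = m * length r"
  by (induction r) simp_all

lemma cnt_srows:
  "cnt e (srows (Suc (2 * m)) d r) = m * length r + cnt (e + d + of_nat (length r) + 1) r"
proof (induction r)
  case (Cons i r)
  have len: "(of_nat (Suc (2 * m) * length r) :: 2) = of_nat (length r)"
    by (simp add: of_nat_two)
  have eq: "i + d = e + of_nat (length r) \<longleftrightarrow> i = e + d + of_nat (length r)"
    using two_cases[of i] two_cases[of d] two_cases[of e] by (auto simp: of_nat_two)
  have "cnt e (srows (Suc (2 * m)) d (i # r)) = m * length r + cnt (e + d + of_nat (length r) + 1) r
      + (if i = e + d + of_nat (length r) then Suc m else m)"
    using Cons by (simp only: srows.simps cnt_append length_srows len cnt_replicate_odd eq)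
  also have "\<dots> = m * length (i # r) + cnt (e + d + of_nat (length (i # r)) + 1) (i # r)"
    by (simp add: add_ac)
  finally show ?case .
qed simp

context suzuki
begin

abbreviation H :: "('k, 'k suzuki) hopf" where "H \<equiv> suzuki_hopf N n 1 lam"

abbreviation "word_lift B f d r \<equiv> word_value B f (map (\<lambda>i. (i, i + d)) r)"

lemma sgn_of_square: "sgn_of lam d * sgn_of lam d = (1 :: 'k)"
  using lam by (auto simp: sgn_of_def)

lemma sgn_of_0 [simp]: "sgn_of lam 0 = 1"
  by (simp add: sgn_of_def)

lemma sgn_of_add:
  "sgn_of lam 1 * sgn_of lam (d + 1) = (sgn_of lam d :: 'k)"
  "sgn_of lam (d + 1) * sgn_of lam 1 = (sgn_of lam d :: 'k)"
  using lam two_cases[of d] by (auto simp: sgn_of_def)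

text \<open>The universal property in terms of homogeneous words, so that for each structure map
  only the values on such words have to be computed.\<close>

lemma suzuki_lift:
  fixes B :: "('k, 'b, 'n) module_scheme"
  assumes B: "kalgebra B" and f: "\<And>x. f x \<in> carrier B"
    and square: "\<And>d. word_lift B f d [1, 1] = word_lift B f d [0, 0]"
    and unit: "word_lift B f 0 (replicate (2 * N) 1) \<oplus>\<^bsub>B\<^esub> word_lift B f 1 (replicate (2 * N) 1) = \<one>\<^bsub>B\<^esub>"
    and alt: "\<And>d. word_lift B f d (rows 0 (replicate n 0)) =
      sgn_of lam d \<odot>\<^bsub>B\<^esub> word_lift B f d (rows 1 (replicate n 0))"
    and mixed: "\<And>d d' i j. d \<noteq> d' \<Longrightarrow> f (i, i + d) \<otimes>\<^bsub>B\<^esub> f (j, j + d') = \<zero>\<^bsub>B\<^esub>"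
  shows "presented_lift B f \<in> algebra_maps A B"
    and "presented_lift B f (mon d r) = word_lift B f d r"
proof -
  interpret B: kalgebra B by fact
  have gen: "free_lift B f (gen_word d r) = word_lift B f d r" for d r
    by (simp add: gen_word_def B.free_lift_single[of f, OF f] B.word_value_closed[of f, OF f])
  note alg = B.free_lift_algebra_map[of f, OF f]
  have kill: "free_lift B f r = \<zero>\<^bsub>B\<^esub>" if "r \<in> R" for r
  proof (rule relation_zero[OF B.kspace_axioms B.free_lift_linear[of f, OF f] _ _ _ _ that])
    show "free_lift B f (gen_word d [i] * gen_word d' [j]) = \<zero>\<^bsub>B\<^esub>" if "d \<noteq> d'" for d d' i j
      using algebra_mapsD(2)[OF alg] mixed[OF that] by (simp add: gen f)
  qed (use algebra_mapsD(3)[OF alg] square unit alt in \<open>simp_all only: gen free_algebra_simps\<close>)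
  show "presented_lift B f \<in> algebra_maps A B"
    using B.presented_lift_algebra_map(1)[of f R, OF f kill] by (simp add: suzuki_algebra_def)
  show "presented_lift B f (mon d r) = word_lift B f d r"
    using B.presented_lift_algebra_map(2)[of f R, OF f kill] by (simp add: mon_def gen)
qed

lemma suzuki_gen_eq: "suzuki_gen N n 1 lam i j = mon (i + j) [i]"
  by (simp add: suzuki_gen_def presented_gen_eq mon_def free_gen_eq)

lemma H_simps [simp]:
  "carrier H = carrier A" "add H = add A" "zero H = zero A" "monoid.mult H = monoid.mult A"
  "one H = one A" "module.smult H = module.smult A"
  by (simp_all add: suzuki_hopf_def Let_def module.defs hopf.defs)

lemma rep_nonempty: "replicate (2 * N) x \<noteq> []" "rows k (replicate n x) \<noteq> []"
  using N n by simp_all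

lemma mon_replicate: "mon d (replicate (2 * N) i) = U d 0 0"
proof -
  have "mon d (replicate (2 * N) i) = U d (0 + 1 * N) (0 + 1 * N)"
    by (rule U_eqI[OF rep_nonempty(1)]) (simp_all add: cnt_replicate_even)
  then show ?thesis by (simp only: U_shifts)
qed

lemma map_add_replicate: "map (\<lambda>i. i + c) (replicate m x) = replicate m (x + c)"
  by simp

subsection \<open>Counit\<close>

lemma counit_algebra_map: "counit H \<in> algebra_maps H scalar_algebra"
  and counit_U: "counit H (U d a b) = (if d = 0 then 1 else 0)"
proof -
  let ?f = "\<lambda>(i :: 2, j). if i = j then 1 else 0 :: 'k"
  have ne: "i = i + d \<longleftrightarrow> d = 0" for i d :: "2"
    using two_cases[of i] two_cases[of d] by auto
  have val: "word_lift scalar_algebra ?f d r = (if d = 0 then 1 else 0)" if "r \<noteq> []" for d r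
    using that
  proof (induction r)
    case (Cons i r)
    then show ?case by (cases "r = []") (auto simp: ne)
  qed simp
  have C: "counit H = presented_lift scalar_algebra ?f"
    by (simp add: suzuki_hopf_def Let_def module.defs hopf.defs)
  note lift = suzuki_lift[of scalar_algebra ?f, OF kalgebra_scalar_algebra]
  have 1: "presented_lift scalar_algebra ?f \<in> algebra_maps A scalar_algebra"
    by (rule lift(1)) (simp_all only: val rep_nonempty list.distinct not_False_eq_True, auto simp: sgn_of_def ne)
  have 2: "presented_lift scalar_algebra ?f (mon d r) = word_lift scalar_algebra ?f d r" for d r
    by (rule lift(2)) (simp_all only: val rep_nonempty list.distinct not_False_eq_True, auto simp: sgn_of_def ne)
  show "counit H \<in> algebra_maps H scalar_algebra"
    using 1 unfolding C by (simp add: algebra_maps_def linear_maps_def ring_hom_def)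
  show "counit H (U d a b) = (if d = 0 then 1 else 0)"
    unfolding C U_def 2 by (rule val) (rule U_word_nonempty)
qed

subsection \<open>Antipode\<close>

text \<open>Each letter becomes \<open>2 * (N - 1) + 1\<close> letters, which add
  \<open>N - 1\<close> to both counts and leave one extra letter. Reversal in a word of length
  \<open>L\<close> and the change of row by \<open>d\<close> turn kind \<open>e\<close> into
  \<open>e + d + L + 1\<close>; so the kinds are exchanged exactly when \<open>d\<close> is the
  parity of \<open>L\<close>, that is, of \<open>a + b\<close>.\<close>

lemma antipode_linear: "antipode H \<in> linear_maps H H"
  and antipode_U: "antipode H (U d a b) =
    (if d = of_nat (a + b) then U d ((N - 1) * (a + b) + b) ((N - 1) * (a + b) + a)
     else U d ((N - 1) * (a + b) + a) ((N - 1) * (a + b) + b))"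
proof -
  let ?f = "\<lambda>(i, j). mon (i + j) [j] [^]\<^bsub>A\<^esub> (2 * N - 1)"
  define M where "M = N - 1"
  have M: "2 * N - 1 = Suc (2 * M)" "N = Suc M" using N by (simp_all add: M_def)
  have pow: "mon d [i] [^]\<^bsub>A\<^esub> m = mon d (replicate m i)" for d i m
  proof (induction m)
    case (Suc m)
    then show ?case by (simp add: mon_append[of d "replicate m i" "[i]", symmetric] replicate_append_same)
  qed (simp add: mon_Nil)
  have f: "?f (i, i + d) = mon d (replicate (Suc (2 * M)) (i + d))" for i d
    by (simp only: split two_simps pow M(1))
  have val: "word_lift (opposite A) ?f d r = mon d (srows (Suc (2 * M)) d r)" for d r
  proof (induction r)
    case (Cons i r)
    have "word_lift (opposite A) ?f d (i # r) = word_lift (opposite A) ?f d r \<otimes>\<^bsub>A\<^esub> ?f (i, i + d)"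
      by (simp del: split)
    then show ?case
      by (simp only: Cons f srows.simps mon_append)
  qed (simp add: mon_Nil)
  have C: "antipode H = presented_lift (opposite A) ?f"
    by (simp add: suzuki_hopf_def Let_def module.defs hopf.defs suzuki_gen_eq add.commute)
  have ne: "r \<noteq> [] \<Longrightarrow> srows (Suc (2 * M)) d r \<noteq> []" for d r
    by (cases r) simp_all
  have U: "mon d (srows (Suc (2 * M)) d r) =
      U d (M * length r + cnt (d + of_nat (length r) + 1) r) (M * length r + cnt (d + of_nat (length r)) r)"
    if "r \<noteq> []" for d r
    by (rule U_eqI[OF ne[OF that]]) (simp_all add: cnt_srows add_ac)
  note lift = suzuki_lift[of "opposite A" ?f, OF kalgebra_opposite[OF kalgebra_A]]
  have closed: "?f x \<in> carrier (opposite A)" for x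
    by (cases x) simp
  have square: "word_lift (opposite A) ?f d [1, 1] = word_lift (opposite A) ?f d [0, 0]" for d
    unfolding val by (rule mon_cong) (simp_all only: cnt_srows, use two_cases[of d] in auto)
  have unit: "word_lift (opposite A) ?f 0 (replicate (2 * N) 1) \<oplus>\<^bsub>opposite A\<^esub>
      word_lift (opposite A) ?f 1 (replicate (2 * N) 1) = \<one>\<^bsub>opposite A\<^esub>"
  proof -
    have "mon d (srows (Suc (2 * M)) d (replicate (2 * N) 1)) = U d (0 + (2 * M + 1) * N) (0 + (2 * M + 1) * N)" for d
      unfolding U[OF rep_nonempty(1)] by (simp only: cnt_replicate_even length_replicate) (simp add: algebra_simps)
    then show ?thesis
      unfolding val U_shifts using one_eq by simp
  qed
  have alt: "word_lift (opposite A) ?f d (rows 0 (replicate n 0)) =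
      sgn_of lam d \<odot>\<^bsub>opposite A\<^esub> word_lift (opposite A) ?f d (rows 1 (replicate n 0))" for d
  proof -
    have 1: "U d (M * n + n) (M * n) = sgn_of lam d \<odot>\<^bsub>A\<^esub> U d (M * n) (M * n + n)"
      by (rule U_alt)
    then have 2: "U d (M * n) (M * n + n) = sgn_of lam d \<odot>\<^bsub>A\<^esub> U d (M * n + n) (M * n)"
      by (simp add: A.smult_smult sgn_of_square)
    show ?thesis
      unfolding val U[OF rep_nonempty(2)]
      using 1 2 two_cases[of "d + of_nat n"] by (auto simp: cnt_rows count_list_replicate add.commute)
  qed
  have mixed: "?f (i, i + d) \<otimes>\<^bsub>opposite A\<^esub> ?f (j, j + d') = \<zero>\<^bsub>opposite A\<^esub>" if "d \<noteq> d'" for i j d d'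
    unfolding f using that by (simp add: mon_mult_mixed)
  note conds = closed square unit alt mixed
  have lift_mon: "presented_lift (opposite A) ?f (mon d r) = mon d (srows (Suc (2 * M)) d r)" for d r
    by (rule trans[OF lift(2)[OF conds] val])
  show "antipode H \<in> linear_maps H H"
    using algebra_mapsD(1)[OF lift(1)[OF conds]] unfolding C by (simp add: linear_maps_def)
  let ?w = "rows 0 (replicate (a + N) 0 @ replicate (b + N) 1)"
  have length: "length ?w = a + b + 2 * N" by simp
  have len: "length ?w = a + b + 2 * N" "(of_nat (length ?w) :: 2) = of_nat (a + b)"
    unfolding length of_nat_two by simp_all
  define e where "e = (of_nat (a + b) :: 2)"
  have shift: "U d (M * length ?w + (x + N)) (M * length ?w + (y + N)) = U d (M * (a + b) + x) (M * (a + b) + y)" for x y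
  proof -
    have "M * length ?w + (z + N) = M * (a + b) + z + (2 * M + 1) * N" for z
      unfolding length by (simp add: algebra_simps)
    then show ?thesis by (simp only: U_shifts)
  qed
  have "antipode H (U d a b) =
      U d (M * length ?w + cnt (d + e + 1) ?w) (M * length ?w + cnt (d + e) ?w)"
    unfolding C U_def[of d a b] lift_mon e_def len(2)[symmetric] by (rule U[OF U_word_nonempty])
  also have "\<dots> = (if d = e then U d (M * (a + b) + b) (M * (a + b) + a)
     else U d (M * (a + b) + a) (M * (a + b) + b))"
  proof (cases "d = e")
    case True
    then have "d + e = 0" by simp
    then show ?thesis unfolding \<open>d + e = 0\<close> add_0 cnt_U_word shift using True by simp
  next
    case False
    then have "d + e = 1" using two_cases[of d] two_cases[of e] by auto
    then show ?thesis unfolding \<open>d + e = 1\<close> two_simps(2) cnt_U_word shift using False by simp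
  qed
  finally show "antipode H (U d a b) =
    (if d = of_nat (a + b) then U d ((N - 1) * (a + b) + b) ((N - 1) * (a + b) + a)
     else U d ((N - 1) * (a + b) + a) ((N - 1) * (a + b) + b))"
    unfolding e_def M_def .
qed

subsection \<open>Comultiplication\<close>

sublocale AA: kalgebra_pair A A
  by unfold_locales

text \<open>The two summands of the coproduct of a letter of type \<open>d\<close> have types
  \<open>(0, d)\<close> and \<open>(1, d + 1)\<close>. In a product of such coproducts the mixed
  terms vanish, so a whole word again has two summands; the right factor of the second has its row
  indices shifted by 1.\<close>

abbreviation comult_word :: "2 \<Rightarrow> 2 list \<Rightarrow> ('k, 'k suzuki, 'k suzuki) tensor" where
  "comult_word d r \<equiv> pure_tensor A A (mon 0 r) (mon d r)
    \<oplus>\<^bsub>tensor_space A A\<^esub> pure_tensor A A (mon 1 r) (mon (d + 1) (map (\<lambda>i. i + 1) r))"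

lemma tensor_mult_sums:
  assumes "p \<in> carrier (tensor_space A A)" "p' \<in> carrier (tensor_space A A)"
    "q \<in> carrier (tensor_space A A)" "q' \<in> carrier (tensor_space A A)"
    and "p \<otimes>\<^bsub>tensor_algebra A A\<^esub> q' = \<zero>\<^bsub>tensor_space A A\<^esub>" "p' \<otimes>\<^bsub>tensor_algebra A A\<^esub> q = \<zero>\<^bsub>tensor_space A A\<^esub>"
  shows "(p \<oplus>\<^bsub>tensor_space A A\<^esub> p') \<otimes>\<^bsub>tensor_algebra A A\<^esub> (q \<oplus>\<^bsub>tensor_space A A\<^esub> q') =
    p \<otimes>\<^bsub>tensor_algebra A A\<^esub> q \<oplus>\<^bsub>tensor_space A A\<^esub> p' \<otimes>\<^bsub>tensor_algebra A A\<^esub> q'"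
proof -
  interpret AA': kalgebra "tensor_algebra A A" by (rule AA.kalgebra_tensor_algebra)
  show ?thesis
    using assms AA'.l_distr AA'.r_distr AA'.m_closed by simp
qed

lemma comult_word_append:
  assumes "r \<noteq> []" "s \<noteq> []"
  shows "comult_word d r \<otimes>\<^bsub>tensor_algebra A A\<^esub> comult_word d s = comult_word d (r @ s)"
  using assms
  by (subst tensor_mult_sums)
    (simp_all add: AA.tensor_mult_pure mon_mult_mixed AA.pure_tensor_zero_left flip: mon_append)

lemma comult_word_mixed:
  assumes "d \<noteq> d'" "r \<noteq> []" "s \<noteq> []"
  shows "comult_word d r \<otimes>\<^bsub>tensor_algebra A A\<^esub> comult_word d' s = \<zero>\<^bsub>tensor_space A A\<^esub>"
  using assms
  by (subst tensor_mult_sums)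
    (simp_all add: AA.tensor_mult_pure mon_mult_mixed AA.pure_tensor_zero_left AA.pure_tensor_zero_right)

lemma comult_algebra_map: "comult H \<in> algebra_maps A (tensor_algebra A A)"
  and comult_mon: "r \<noteq> [] \<Longrightarrow> comult H (mon d r) = comult_word d r"
proof -
  let ?T = "tensor_space A A"
  let ?f = "\<lambda>(i, j). pure_tensor A A (mon (i + 1) [i]) (mon (1 + j) [1])
    \<oplus>\<^bsub>tensor_algebra A A\<^esub> pure_tensor A A (mon (i + 2) [i]) (mon (2 + j) [2])"
  have f: "?f (i, i + d) = comult_word d [i]" for i d
    using two_cases[of i] by (auto simp: AA.T.a_comm add.commute)
  have closed: "?f x \<in> carrier (tensor_algebra A A)" for x
    by (cases x) simp
  have val: "word_lift (tensor_algebra A A) ?f d r = comult_word d r" if "r \<noteq> []" for d r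
    using that
  proof (induction r)
    case (Cons i r)
    show ?case
    proof (cases "r = []")
      case True
      interpret AA': kalgebra "tensor_algebra A A" by (rule AA.kalgebra_tensor_algebra)
      have "word_lift (tensor_algebra A A) ?f d (i # r) = comult_word d [i] \<otimes>\<^bsub>tensor_algebra A A\<^esub> \<one>\<^bsub>tensor_algebra A A\<^esub>"
        using True by (simp only: list.map word_value_simps f)
      also have "\<dots> = comult_word d (i # r)"
        by (subst AA'.r_one) (simp_all add: True)
      finally show ?thesis .
    next
      case False
      have "word_lift (tensor_algebra A A) ?f d (i # r) = comult_word d [i] \<otimes>\<^bsub>tensor_algebra A A\<^esub> comult_word d r"
        by (simp only: list.map word_value_simps f Cons.IH[OF False])
      also have "\<dots> = comult_word d ([i] @ r)"
        by (rule comult_word_append) (use False in auto)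
      finally show ?thesis by simp
    qed
  qed simp
  have C: "comult H = presented_lift (tensor_algebra A A) ?f"
    by (simp add: suzuki_hopf_def Let_def module.defs hopf.defs suzuki_gen_eq)
  have square: "word_lift (tensor_algebra A A) ?f d [1, 1] = word_lift (tensor_algebra A A) ?f d [0, 0]" for d
  proof -
    have "comult_word d [1, 1] = comult_word d [0, 0]"
      using mon_square[of _ 1 0] by simp
    then show ?thesis by (simp only: val list.distinct not_False_eq_True)
  qed
  have unit: "word_lift (tensor_algebra A A) ?f 0 (replicate (2 * N) 1) \<oplus>\<^bsub>tensor_algebra A A\<^esub>
      word_lift (tensor_algebra A A) ?f 1 (replicate (2 * N) 1) = \<one>\<^bsub>tensor_algebra A A\<^esub>"
    unfolding val[OF rep_nonempty(1)] map_add_replicate mon_replicate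
    by (simp add: one_eq AA.pure_tensor_add_left AA.pure_tensor_add_right AA.T.a_ac)
  have alt: "word_lift (tensor_algebra A A) ?f d (rows 0 (replicate n 0)) =
      sgn_of lam d \<odot>\<^bsub>tensor_algebra A A\<^esub> word_lift (tensor_algebra A A) ?f d (rows 1 (replicate n 0))" for d
  proof -
    have map: "map (\<lambda>i. i + 1) (rows k (replicate m 0)) = rows (k + 1) (replicate m 0)" for k m
      by (induction m arbitrary: k) simp_all
    have 0: "mon d (rows 0 (replicate n 0)) = sgn_of lam d \<odot>\<^bsub>A\<^esub> mon d (rows 1 (replicate n 0))" for d
      by (rule mon_alt)
    then have 1: "mon d (rows 1 (replicate n 0)) = sgn_of lam d \<odot>\<^bsub>A\<^esub> mon d (rows 0 (replicate n 0))" for d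
      by (simp add: A.smult_smult sgn_of_square)
    \<comment> \<open>In the second summand the shift of rows exchanges the two alternating words in
      the right factor. Hence both its factors are rewritten in opposite directions, and the signs
      combine as \<open>sgn_of lam 1 * sgn_of lam (d + 1) = sgn_of lam d\<close>.\<close>
    have "comult_word d (rows 0 (replicate n 0)) = sgn_of lam d \<odot>\<^bsub>?T\<^esub> comult_word d (rows 1 (replicate n 0))"
      unfolding map
      by (subst 0[of 0], subst 0[of d], subst 0[of 1])
        (simp add: 1[of "d + 1"] AA.pure_tensor_smult_left AA.pure_tensor_smult_right
          AA.T.smult_smult AA.T.smult_add_right sgn_of_add)
    then show ?thesis unfolding val[OF rep_nonempty(2)] by simp
  qed
  have mixed: "?f (i, i + d) \<otimes>\<^bsub>tensor_algebra A A\<^esub> ?f (j, j + d') = \<zero>\<^bsub>tensor_algebra A A\<^esub>"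
    if "d \<noteq> d'" for i j d d'
    unfolding f unfolding AA.tensor_algebra_simps by (rule comult_word_mixed[OF that]) simp_all
  note lift = suzuki_lift[of "tensor_algebra A A" ?f, OF AA.kalgebra_tensor_algebra closed square unit alt mixed]
  show "comult H \<in> algebra_maps A (tensor_algebra A A)"
    unfolding C by (rule lift(1))
  show "comult H (mon d r) = comult_word d r" if "r \<noteq> []"
    unfolding C by (rule trans[OF lift(2) val[OF that]])
qed

lemma comult_U:
  "comult H (U d a b) = pure_tensor A A (U 0 a b) (U d a b) \<oplus>\<^bsub>tensor_space A A\<^esub> pure_tensor A A (U 1 a b) (U (d + 1) b a)"
proof -
  let ?w = "rows 0 (replicate (a + N) 0 @ replicate (b + N) 1)"
  have "mon d (map (\<lambda>i. i + 1) ?w) = U d (b + N) (a + N)" for d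
    by (rule U_eqI) (simp_all only: cnt_shift, use U_word_nonempty cnt_U_word in simp_all)
  then show ?thesis
    using comult_mon[OF U_word_nonempty, of d a b] unfolding U_def[symmetric] U_shift by simp
qed

subsection \<open>Hopf algebra axioms\<close>

lemma same_space_H: "same_space A H"
  by unfold_locales simp_all

lemma tensor_space_H: "tensor_space A A = tensor_space H H" and pure_tensor_H: "pure_tensor A A = pure_tensor H H"
  using same_space.tensor_space_same[OF same_space_H] same_space.pure_tensor_same[OF same_space_H] by simp_all

lemma kalgebra_H: "kalgebra H"
proof -
  have "abelian_group H"
    by (rule abelian_groupI) (simp_all add: A.a_ac A.add.l_inv_ex A.add.r_inv_ex)
  moreover have "monoid H"
    by (rule monoidI) (simp_all add: A.m_assoc)
  ultimately interpret H: ring H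
    by (rule ringI) (simp_all add: A.l_distr A.r_distr)
  show ?thesis
    by unfold_locales (simp_all add: A.smult_add_left A.smult_add_right A.smult_smult A.smult_mult_left A.smult_mult_right)
qed

sublocale HH: kalgebra_pair H H
  using kalgebra_H by (simp add: kalgebra_pair_def)

lemma linear_maps_H: "linear_maps H V = linear_maps A V" "linear_maps V H = linear_maps V A"
  by (simp_all add: linear_maps_def)

lemma comult_linear: "comult H \<in> linear_maps H (tensor_space H H)"
  using algebra_mapsD(1)[OF comult_algebra_map] by (simp add: linear_maps_H tensor_space_H)

lemma comult_closed: "x \<in> carrier A \<Longrightarrow> comult H x \<in> carrier (tensor_space H H)"
  using linear_maps_closed[OF comult_linear] by simp

lemma comult_H_U:
  "comult H (U d a b) = pure_tensor H H (U 0 a b) (U d a b) \<oplus>\<^bsub>tensor_space H H\<^esub> pure_tensor H H (U 1 a b) (U (d + 1) b a)"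
  using comult_U by (simp add: tensor_space_H pure_tensor_H)

lemma H_maps_eq:
  assumes "f \<in> linear_maps H Z" "g \<in> linear_maps H Z" "\<And>d a b. f (U d a b) = g (U d a b)" "x \<in> carrier H"
  shows "f x = g x"
  using A_maps_eq[of f Z g x] assms by (simp add: linear_maps_H)

text \<open>The counit and antipode axioms, and products in the dual, all have this form. Linearity
  in \<open>x\<close> and the explicit value reduce each of them to a two-term identity for
  \<open>U d a b\<close>.\<close>

lemma comult_lift:
  assumes Z: "kspace Z" and b: "\<beta> \<in> bilinear_maps H H Z"
  shows "(\<lambda>x. tensor_lift Z \<beta> (comult H x)) \<in> linear_maps H Z"
    and "tensor_lift Z \<beta> (comult H (U d a b)) = \<beta> (U 0 a b) (U d a b) \<oplus>\<^bsub>Z\<^esub> \<beta> (U 1 a b) (U (d + 1) b a)"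
proof -
  note l = HH.tensor_lift_linear[OF Z b] and p = HH.tensor_lift_pure[OF Z b]
  show "(\<lambda>x. tensor_lift Z \<beta> (comult H x)) \<in> linear_maps H Z"
    by (rule linear_maps_compose[OF comult_linear l])
  show "tensor_lift Z \<beta> (comult H (U d a b)) = \<beta> (U 0 a b) (U d a b) \<oplus>\<^bsub>Z\<^esub> \<beta> (U 1 a b) (U (d + 1) b a)"
    by (simp add: comult_H_U linear_maps_add[OF l] p)
qed

lemma kspace_H: "kspace H"
  by (rule kalgebra.axioms(1)[OF kalgebra_H])

lemma scalar_action_linear:
  assumes "f \<in> linear_maps H scalar_algebra" "v \<in> carrier H"
  shows "(\<lambda>x. f x \<odot>\<^bsub>H\<^esub> v) \<in> linear_maps H H"
  using assms by (intro linear_mapsI)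
    (simp_all add: linear_maps_add[OF assms(1), simplified] linear_maps_smult[OF assms(1), simplified] A.smult_add_left A.smult_smult)

lemma coassociative:
  assumes "x \<in> carrier H"
  shows "tensor_assoc H H H (tensor_map (tensor_space H H) H (comult H) id (comult H x)) =
    tensor_map H (tensor_space H H) id (comult H) (comult H x)"
proof (rule H_maps_eq[OF _ _ _ assms])
  note T = HH.kspace_tensor_space
  note ml = tensor_map_linear[OF kspace_H kspace_H T kspace_H comult_linear linear_maps_id]
  note mlp = tensor_map_pure[OF kspace_H kspace_H T kspace_H comult_linear linear_maps_id]
  note mr = tensor_map_linear[OF kspace_H kspace_H kspace_H T linear_maps_id comult_linear]
  note mrp = tensor_map_pure[OF kspace_H kspace_H kspace_H T linear_maps_id comult_linear]
  note as = tensor_assoc_linear[OF kspace_H kspace_H kspace_H]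
  note asp = tensor_assoc_pure[OF kspace_H kspace_H kspace_H]
  interpret L: kspace_pair "tensor_space H H" H by (simp add: kspace_pair_def T kspace_H)
  interpret R: kspace_pair H "tensor_space H H" by (simp add: kspace_pair_def T kspace_H)
  show "(\<lambda>x. tensor_assoc H H H (tensor_map (tensor_space H H) H (comult H) id (comult H x)))
      \<in> linear_maps H (tensor_space H (tensor_space H H))"
    by (rule linear_maps_compose[OF linear_maps_compose[OF comult_linear ml] as])
  show "(\<lambda>x. tensor_map H (tensor_space H H) id (comult H) (comult H x))
      \<in> linear_maps H (tensor_space H (tensor_space H H))"
    by (rule linear_maps_compose[OF comult_linear mr])
  show "tensor_assoc H H H (tensor_map (tensor_space H H) H (comult H) id (comult H (U d a b))) =
    tensor_map H (tensor_space H H) id (comult H) (comult H (U d a b))" for d a b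
    by (simp add: comult_H_U linear_maps_add[OF ml] mlp L.pure_tensor_add_left linear_maps_add[OF as] asp
      linear_maps_add[OF mr] mrp R.pure_tensor_add_right R.T.a_ac add.assoc)
qed

text \<open>These are the individual terms of the two antipode axioms on \<open>U d a b\<close>. If
  the types agree, both counts become \<open>(a + b) * N\<close>, a multiple of \<open>N\<close>,
  and shifting gives \<open>U 0 0 0\<close> or \<open>U 1 0 0\<close>; these add up to the
  unit.\<close>

lemma antipode_mult:
  "antipode H (U 0 a b) \<otimes>\<^bsub>A\<^esub> U d a b = (if d = 0 then U 0 0 0 else \<zero>\<^bsub>A\<^esub>)"
  "antipode H (U 1 a b) \<otimes>\<^bsub>A\<^esub> U (d + 1) b a = (if d = 0 then U 1 0 0 else \<zero>\<^bsub>A\<^esub>)"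
  "U 0 a b \<otimes>\<^bsub>A\<^esub> antipode H (U d a b) = (if d = 0 then U 0 0 0 else \<zero>\<^bsub>A\<^esub>)"
  "U 1 a b \<otimes>\<^bsub>A\<^esub> antipode H (U (d + 1) b a) = (if d = 0 then U 1 0 0 else \<zero>\<^bsub>A\<^esub>)"
proof -
  define m where "m = (N - 1) * (a + b)"
  have m': "(N - 1) * (b + a) = m" by (simp add: m_def add.commute)
  obtain M where M: "N = Suc M" using N by (cases N) auto
  have shift: "U d (m + a + b) (m + a + b) = U d 0 0" for d
  proof -
    have "m + a + b = 0 + (a + b) * N" by (simp add: m_def M algebra_simps)
    then show ?thesis by (simp only: U_shifts)
  qed
  have par: "even (m + b + (m + a)) \<longleftrightarrow> even (a + b)" "even (m + a + (m + b)) \<longleftrightarrow> even (a + b)"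
    by auto
  have e: "(1 :: 2) = d + 1 \<longleftrightarrow> d = 0" "(0 :: 2) = d \<longleftrightarrow> d = 0" for d
    using two_cases[of d] by auto
  have ac: "m + b + a = m + a + b" "a + (m + b) = m + a + b" "b + (m + a) = m + a + b" by simp_all
  note simps = antipode_U m_def[symmetric] m' U_mult par e shift ac of_nat_two
  show "antipode H (U 0 a b) \<otimes>\<^bsub>A\<^esub> U d a b = (if d = 0 then U 0 0 0 else \<zero>\<^bsub>A\<^esub>)"
    "antipode H (U 1 a b) \<otimes>\<^bsub>A\<^esub> U (d + 1) b a = (if d = 0 then U 1 0 0 else \<zero>\<^bsub>A\<^esub>)"
    by (cases "even (a + b)"; simp only: simps if_True if_False simp_thms zero_neq_one one_neq_zero; simp)+
  show "U 0 a b \<otimes>\<^bsub>A\<^esub> antipode H (U d a b) = (if d = 0 then U 0 0 0 else \<zero>\<^bsub>A\<^esub>)"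
    "U 1 a b \<otimes>\<^bsub>A\<^esub> antipode H (U (d + 1) b a) = (if d = 0 then U 1 0 0 else \<zero>\<^bsub>A\<^esub>)"
    using two_cases[of d]
    by (cases "even (a + b)"; auto simp only: simps if_True if_False simp_thms zero_neq_one one_neq_zero two_simps add_0 add.commute[of b a])+
qed

lemma hopf_algebra_H: "hopf_algebra H"
  unfolding hopf_algebra_def
proof (intro conjI ballI)
  show "k_algebra H" by (simp add: k_algebra_iff kalgebra_H)
  have AA': "tensor_algebra A A = tensor_algebra H H"
    by (simp add: tensor_algebra_def tensor_space_H pure_tensor_H)
  show "comult H \<in> algebra_maps H (tensor_algebra H H)"
    using comult_algebra_map unfolding AA' by (simp add: algebra_maps_def linear_maps_H ring_hom_def)
  show "counit H \<in> algebra_maps H scalar_algebra" by (rule counit_algebra_map)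
  show "antipode H \<in> linear_maps H H" by (rule antipode_linear)
  fix x assume x: "x \<in> carrier H"
  show "tensor_assoc H H H (tensor_map (tensor_space H H) H (comult H) id (comult H x)) =
        tensor_map H (tensor_space H H) id (comult H) (comult H x)"
    by (rule coassociative[OF x])
  note eps = algebra_mapsD(1)[OF counit_algebra_map]
  have b1: "(\<lambda>a b. counit H a \<odot>\<^bsub>H\<^esub> b) \<in> bilinear_maps H H H"
    by (intro bilinear_mapsI scalar_action_linear eps linear_mapsI)
      (simp_all add: A.smult_add_right A.smult_smult mult.commute)
  have b2: "(\<lambda>a b. counit H b \<odot>\<^bsub>H\<^esub> a) \<in> bilinear_maps H H H"
    by (intro bilinear_mapsI scalar_action_linear eps linear_mapsI)
      (simp_all add: A.smult_add_right A.smult_smult mult.commute)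
  show "tensor_lift H (\<lambda>a b. counit H a \<odot>\<^bsub>H\<^esub> b) (comult H x) = x"
    by (rule H_maps_eq[OF comult_lift(1)[OF kspace_H b1] linear_maps_id[unfolded id_def] _ x])
      (unfold comult_lift(2)[OF kspace_H b1], simp add: counit_U)
  show "tensor_lift H (\<lambda>a b. counit H b \<odot>\<^bsub>H\<^esub> a) (comult H x) = x"
  proof (rule H_maps_eq[OF comult_lift(1)[OF kspace_H b2] linear_maps_id[unfolded id_def] _ x])
    fix d a b
    show "tensor_lift H (\<lambda>a b. counit H b \<odot>\<^bsub>H\<^esub> a) (comult H (U d a b)) = U d a b"
      \<comment> \<open>The counit keeps the summand whose right factor has type 0: the first for
        \<open>d = 0\<close>, the second for \<open>d = 1\<close>. Its left factor is
        \<open>U d a b\<close> in both cases.\<close>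
      unfolding comult_lift(2)[OF kspace_H b2] using two_cases[of d] by (auto simp: counit_U)
  qed
  note mult = HH.mult_bilinear(1)
  have b3: "(\<lambda>a b. antipode H a \<otimes>\<^bsub>H\<^esub> b) \<in> bilinear_maps H H H"
    using bilinear_maps_compose[OF mult antipode_linear linear_maps_id] by simp
  have b4: "(\<lambda>a b. a \<otimes>\<^bsub>H\<^esub> antipode H b) \<in> bilinear_maps H H H"
    using bilinear_maps_compose[OF mult linear_maps_id antipode_linear] by simp
  have r: "(\<lambda>x. counit H x \<odot>\<^bsub>H\<^esub> \<one>\<^bsub>H\<^esub>) \<in> linear_maps H H"
    by (rule scalar_action_linear[OF eps]) simp
  show "tensor_lift H (\<lambda>a b. antipode H a \<otimes>\<^bsub>H\<^esub> b) (comult H x) = counit H x \<odot>\<^bsub>H\<^esub> \<one>\<^bsub>H\<^esub>"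
  proof (rule H_maps_eq[OF comult_lift(1)[OF kspace_H b3] r _ x])
    fix d a b
    show "tensor_lift H (\<lambda>a b. antipode H a \<otimes>\<^bsub>H\<^esub> b) (comult H (U d a b)) = counit H (U d a b) \<odot>\<^bsub>H\<^esub> \<one>\<^bsub>H\<^esub>"
      unfolding comult_lift(2)[OF kspace_H b3] by (simp add: antipode_mult counit_U one_eq)
  qed
  show "tensor_lift H (\<lambda>a b. a \<otimes>\<^bsub>H\<^esub> antipode H b) (comult H x) = counit H x \<odot>\<^bsub>H\<^esub> \<one>\<^bsub>H\<^esub>"
  proof (rule H_maps_eq[OF comult_lift(1)[OF kspace_H b4] r _ x])
    fix d a b
    show "tensor_lift H (\<lambda>a b. a \<otimes>\<^bsub>H\<^esub> antipode H b) (comult H (U d a b)) = counit H (U d a b) \<odot>\<^bsub>H\<^esub> \<one>\<^bsub>H\<^esub>"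
      unfolding comult_lift(2)[OF kspace_H b4] by (simp add: antipode_mult counit_U one_eq)
  qed
qed

end

section \<open>Functionals that descend to the quotient\<close>

section \<open>Linear functionals\<close>

text \<open>Entry \<open>(0, e)\<close> of the product of the matrices with zero diagonal and
  off-diagonal entries \<open>c i\<close> (row 0) and \<open>c (i + 1)\<close> (row 1), one for each
  letter of type \<open>d\<close> and row index \<open>i\<close>; letters of the other type act as
  zero. Exchanging the two values of \<open>c\<close> amounts to starting in row 1.\<close>

fun word_functional :: "2 \<Rightarrow> 2 \<Rightarrow> (2 \<Rightarrow> 'k::field) \<Rightarrow> idx list \<Rightarrow> 'k" where
  "word_functional e d c [] = (if e = 0 then 1 else 0)"
| "word_functional e d c (x # w) =
    (if fst x + snd x = d then c (fst x) * word_functional (e + 1) d (\<lambda>i. c (i + 1)) w else 0)"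

text \<open>The recursion peels letters off the left. A two-sided ideal also demands the effect of a
  letter on the right, whose weight depends on the parity of the position, here read off from
  \<open>e\<close>.\<close>

lemma word_functional_append:
  "word_functional e d c (w @ [x]) =
    (if fst x + snd x = d then c (fst x + e + 1) * word_functional (e + 1) d c w else 0)"
proof (induction w arbitrary: e c)
  case Nil
  then show ?case using two_cases[of e] by auto
next
  case (Cons y w)
  then show ?case by (simp add: add_ac)
qed

lemma word_functional_word:
  "word_functional e d c (map (\<lambda>i. (i, i + d')) r) =
    (if e = of_nat (length r) \<and> (d = d' \<or> r = []) then c 0 ^ cnt 0 r * c 1 ^ cnt 1 r else 0)"
proof (induction r arbitrary: e c)
  case (Cons i r)
  have "e + 1 = of_nat (length r) \<longleftrightarrow> e = of_nat (length (i # r))"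
    using two_cases[of e] two_cases[of "of_nat (length r)"] by auto
  then show ?case
    unfolding list.map word_functional.simps Cons using two_cases[of i] by auto
qed simp

context suzuki
begin

text \<open>The unit relation and the alternating relation for the matrices behind
  \<open>word_functional\<close>. The relation between squares holds for any \<open>c\<close>, as
  both squares are the scalar matrix \<open>c 0 * c 1\<close>.\<close>

definition compatible :: "2 \<Rightarrow> (2 \<Rightarrow> 'k) \<Rightarrow> bool" where
  "compatible d c \<longleftrightarrow> (c 0 * c 1) ^ N = 1 \<and> c 0 ^ n = sgn_of lam d * c 1 ^ n"

definition functional :: "2 \<Rightarrow> 2 \<Rightarrow> (2 \<Rightarrow> 'k) \<Rightarrow> 'k suzuki \<Rightarrow> 'k" where
  "functional e d c Q = the_elem (lin_ext scalar_algebra (word_functional e d c) ` Q)"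

lemma compatible_swap:
  assumes "compatible d c" shows "compatible d (\<lambda>i. c (i + 1))"
proof -
  have "sgn_of lam d * c 0 ^ n = (sgn_of lam d * sgn_of lam d) * c 1 ^ n"
    using assms by (simp add: compatible_def)
  then show ?thesis
    using assms by (simp add: compatible_def sgn_of_square mult.commute)
qed

lemma functional_linear: "compatible d c \<Longrightarrow> functional e d c \<in> linear_maps A scalar_algebra"
  and functional_mon: "compatible d c \<Longrightarrow> functional e d c (mon d' r) =
    (if e = of_nat (length r) \<and> (d = d' \<or> r = []) then c 0 ^ cnt 0 r * c 1 ^ cnt 1 r else 0)"
proof -
  let ?L = "\<lambda>e c. lin_ext scalar_algebra (word_functional e d c) :: (idx list \<Rightarrow>\<^sub>0 'k) \<Rightarrow> 'k"
  interpret S: kspace "scalar_algebra :: ('k, 'k) module" by (rule kspace_scalar_algebra)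
  have lin: "?L e c \<in> linear_maps free_algebra scalar_algebra" for e c
    unfolding linear_maps_free_algebra by (rule lin_ext_linear[OF kspace_scalar_algebra]) simp
  note add = linear_maps_add[OF lin, simplified] and scale = linear_maps_smult[OF lin, simplified]
  have single: "?L e c (Poly_Mapping.single w a) = a * word_functional e d c w" for e c w a
    by (subst S.lin_ext_single) simp_all
  have word: "?L e c (gen_word d' r) = word_functional e d c (map (\<lambda>i. (i, i + d')) r)" for e c d' r
    by (simp add: gen_word_def single)
  have one: "?L e c 1 = (if e = 0 then 1 else 0)" for e c
    using single[of e c "[]" 1] by (simp add: single_Nil)
  have zero: "?L e c 0 = 0" for e c by (simp add: lin_ext_def)
  have left: "?L e c (Poly_Mapping.single [x] 1 * p) =
      (if fst x + snd x = d then c (fst x) * ?L (e + 1) (\<lambda>i. c (i + 1)) p else 0)" for e c x p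
    by (induction p rule: poly_mapping_single_induct)
      (simp_all add: zero distrib_left add mult_single plus_list_def single algebra_simps)
  have right: "?L e c (p * Poly_Mapping.single [x] 1) =
      (if fst x + snd x = d then c (fst x + e + 1) * ?L (e + 1) c p else 0)" for e c x p
    by (induction p rule: poly_mapping_single_induct)
      (simp_all add: zero distrib_right add mult_single plus_list_def single word_functional_append algebra_simps)
  have base: "?L e c r = 0" if "r \<in> R" "compatible d c" for r e c
  proof -
    have "?L e c r = \<zero>\<^bsub>scalar_algebra\<^esub>"
    proof (rule relation_zero[OF kspace_scalar_algebra lin _ _ _ _ that(1)])
      show "?L e c (gen_word d' [1, 1]) = ?L e c (gen_word d' [0, 0])" for d'
        by (simp add: word)
      show "?L e c (gen_word 0 (replicate (2 * N) 1)) \<oplus>\<^bsub>scalar_algebra\<^esub>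
          ?L e c (gen_word 1 (replicate (2 * N) 1)) = ?L e c 1"
        unfolding word word_functional_word cnt_replicate_even
        using that(2) rep_nonempty(1)[of "1 :: 2"] two_cases[of d]
        by (auto simp: compatible_def power_mult_distrib one)
      show "?L e c (gen_word d' (rows 0 (replicate n 0))) =
          sgn_of lam d' \<odot>\<^bsub>scalar_algebra\<^esub> ?L e c (gen_word d' (rows 1 (replicate n 0)))" for d'
      proof -
        have "c 0 ^ n = sgn_of lam d * c 1 ^ n" using that(2) by (simp add: compatible_def)
        then show ?thesis
          unfolding word word_functional_word using n by (auto simp: cnt_rows count_list_replicate)
      qed
      show "?L e c (gen_word d1 [i] * gen_word d2 [j]) = \<zero>\<^bsub>scalar_algebra\<^esub>" if "d1 \<noteq> d2" for d1 d2 i j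
        using that by (simp add: gen_word_def mult_single plus_list_def single)
    qed
    then show ?thesis by simp
  qed
  \<comment> \<open>The induction over the ideal runs for all \<open>e\<close> and \<open>c\<close>
    together: a letter on the left changes \<open>e\<close> and exchanges the values of
    \<open>c\<close>, and a letter on the right changes \<open>e\<close>.\<close>
  have kill: "\<forall>e c. compatible d c \<longrightarrow> ?L e c r = 0" if "r \<in> Idl\<^bsub>free_algebra\<^esub> R" for r
    using that
    by (rule Idl_induct) (auto simp: base zero add scale left right compatible_swap)
  fix e c assume c: "compatible d c"
  have k: "?L e c r = \<zero>\<^bsub>scalar_algebra\<^esub>" if "r \<in> Idl\<^bsub>free_algebra\<^esub> R" for r
    using kill[OF that] c by simp
  note p = presented_linear[OF kspace_scalar_algebra lin k]
  show "functional e d c \<in> linear_maps A scalar_algebra"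
    using p(1) by (simp add: functional_def[abs_def] suzuki_algebra_def)
  show "functional e d c (mon d' r) =
    (if e = of_nat (length r) \<and> (d = d' \<or> r = []) then c 0 ^ cnt 0 r * c 1 ^ cnt 1 r else 0)"
    using p(2)[where p = "gen_word d' r"] by (simp add: functional_def mon_def word word_functional_word)
qed

lemma functional_U:
  assumes "compatible d c"
  shows "functional e d c (U d' a b) = (if e = of_nat (a + b) \<and> d = d' then c 0 ^ a * c 1 ^ b else 0)"
proof -
  have 1: "c 0 ^ (a + N) * c 1 ^ (b + N) = c 0 ^ a * c 1 ^ b"
  proof -
    have "c 0 ^ (a + N) * c 1 ^ (b + N) = c 0 ^ a * c 1 ^ b * (c 0 * c 1) ^ N"
      by (simp add: power_add power_mult_distrib)
    then show ?thesis using assms by (simp add: compatible_def)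
  qed
  have 2: "of_nat (length (rows 0 (replicate (a + N) 0 @ replicate (b + N) 1))) = (of_nat (a + b) :: 2)"
  proof -
    have len: "length (rows 0 (replicate (a + N) 0 @ replicate (b + N) 1)) = a + b + 2 * N" by simp
    show ?thesis unfolding len of_nat_two by simp
  qed
  show ?thesis
    unfolding U_def functional_mon[OF assms] cnt_U_word 1 2 using N by simp
qed

end

section \<open>The pairing, its Gram matrix, and coordinates\<close>

section \<open>The Hopf pairing\<close>

lemma sum_powers_root:
  fixes z :: "'a::field"
  assumes "z ^ m = 1" "z \<noteq> 1"
  shows "(\<Sum>i<m. z ^ i) = 0"
  using assms power_diff_1_eq[of z m] by simp

definition bit :: "2 \<Rightarrow> nat" where "bit e = (if e = 0 then 0 else 1)"

lemma of_nat_bit: "(of_nat (bit e + 2 * m) :: 2) = e"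
  using two_cases[of e] by (auto simp: bit_def of_nat_two)

locale suzuki_roots = suzuki N n lam K
  for N n :: nat and lam :: int and K :: "'k::field itself" +
  fixes ze xi :: 'k
  assumes odd_N: "odd N" and nN: "of_nat (n * N) \<noteq> (0 :: 'k)"
    and ze: "ze ^ N = 1" and ze_order: "\<And>k. ze ^ k = 1 \<Longrightarrow> N dvd k"
    and xi: "xi ^ (2 * n) = of_int lam" and xi_order: "\<And>k. xi ^ (4 * k) = 1 \<Longrightarrow> n dvd k"
begin

abbreviation "al \<equiv> ze * xi"
abbreviation "be \<equiv> ze / xi"

lemma nonzero [simp]: "ze \<noteq> 0" "xi \<noteq> 0"
  using ze xi N n lam by (auto simp: power_0_left)

text \<open>The exponent of \<open>xi\<close> is \<open>(a - b) * (q - r)\<close>, which can be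
  negative; powers of \<open>al\<close> and \<open>be\<close> keep all exponents natural. The
  nesting matches \<open>functional_U\<close>, with \<open>q\<close> and \<open>r\<close> as the
  outer exponents.\<close>

definition chi :: "nat \<Rightarrow> nat \<Rightarrow> nat \<Rightarrow> nat \<Rightarrow> 'k" where
  "chi a b q r = (al ^ a * be ^ b) ^ q * (be ^ a * al ^ b) ^ r"

lemma chi_sym: "chi a b q r = chi q r a b"
  by (simp add: chi_def power_mult_distrib flip: power_mult) (simp add: ac_simps)

lemma chi_swap: "chi b a q r = chi a b r q"
  by (simp add: chi_def mult.commute)

lemma chi_add: "chi a b (q + q') (r + r') = chi a b q r * chi a b q' r'"
  by (simp add: chi_def power_add ac_simps)

lemma chi_zero [simp]: "chi a b 0 0 = 1"
  by (simp add: chi_def)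

lemma chi_diagonal: "chi a b m m = (al * be) ^ ((a + b) * m)"
proof -
  have "(x ^ a * y ^ b) ^ m * (y ^ a * x ^ b) ^ m = (x * y) ^ ((a + b) * m)" for x y :: 'k
    by (simp add: power_add power_mult_distrib algebra_simps flip: power_mult)
  then show ?thesis unfolding chi_def .
qed

lemma chi_roots: "chi (u + k) k (v + l) l = (ze ^ (u + 2 * k)) ^ (v + 2 * l) * (xi ^ u) ^ v"
proof -
  have 1: "al ^ (u + k) * be ^ k = ze ^ (u + 2 * k) * xi ^ u"
    "be ^ (u + k) * al ^ k = ze ^ (u + 2 * k) / xi ^ u"
    by (simp_all add: power_add power_mult_distrib power_divide mult_2)
  have "(x * y) ^ (v + l) * (x / y) ^ l = x ^ (v + 2 * l) * y ^ v" if "y \<noteq> 0" for x y :: 'k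
    using that by (simp add: power_mult_distrib power_divide power_add mult_2 mult_2_right field_simps)
  then show ?thesis
    unfolding chi_def 1 by simp
qed

lemma lam_eq: "al ^ n = of_int lam * be ^ n" "be ^ n = of_int lam * al ^ n"
proof -
  have "xi ^ n * xi ^ n = of_int lam" using xi by (simp add: mult_2 power_add)
  moreover have "of_int lam * of_int lam = (1 :: 'k)" using lam by auto
  ultimately show "al ^ n = of_int lam * be ^ n" "be ^ n = of_int lam * al ^ n"
    by (simp_all add: power_mult_distrib power_divide field_simps)
qed

lemma sgn_of_of_nat: "sgn_of lam (of_nat m) = (of_int lam ^ m :: 'k)"
  using lam by (auto simp: sgn_of_def of_nat_two)

text \<open>Below, \<open>pf d a b\<close> is the pairing with \<open>U d a b\<close>. On generators the pairing of \<open>x\<^sub>i\<^sub>j\<close> with \<open>x\<^sub>k\<^sub>l\<close> is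
  \<open>al\<close> if \<open>i = k \<noteq> j = l\<close>, it is \<open>be\<close> if \<open>i = l \<noteq> j = k\<close>, and it vanishes otherwise.\<close>

definition pf :: "2 \<Rightarrow> nat \<Rightarrow> nat \<Rightarrow> 'k suzuki \<Rightarrow> 'k" where
  "pf d a b = functional d (of_nat (a + b)) (\<lambda>i. if i = 0 then al ^ a * be ^ b else be ^ a * al ^ b)"

text \<open>The product of the two values is \<open>(al * be) ^ (a + b)\<close>, an
  \<open>N\<close>-th root of unity. Exchanging \<open>al ^ n\<close> and \<open>be ^ n\<close>
  costs one factor \<open>lam\<close> for each of the \<open>a + b\<close> exponents, which is the
  sign belonging to type \<open>a + b\<close> modulo 2.\<close>

lemma compatible_pf: "compatible (of_nat (a + b)) (\<lambda>i. if i = 0 then al ^ a * be ^ b else be ^ a * al ^ b)"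
proof -
  have comm: "(x ^ m) ^ m' = (x ^ m') ^ m" for x :: 'k and m m'
    by (simp add: mult.commute flip: power_mult)
  have gen: "x ^ a * y ^ b * (y ^ a * x ^ b) = (x * y) ^ (a + b)" for x y :: 'k
    by (simp add: power_add power_mult_distrib ac_simps)
  have "al * be = ze ^ 2" by (simp add: power2_eq_square)
  then have "(al * be) ^ N = 1" by (simp only: comm[of ze 2 N] ze power_one)
  then have 1: "(al ^ a * be ^ b * (be ^ a * al ^ b)) ^ N = 1"
    by (simp only: gen comm[of _ "a + b" N] power_one)
  have gen': "(x ^ a * y ^ b) ^ n = (x ^ n) ^ a * (y ^ n) ^ b" for x y :: 'k
    by (simp add: power_mult_distrib comm[of _ n])
  have "(al ^ a * be ^ b) ^ n = (of_int lam * be ^ n) ^ a * (of_int lam * al ^ n) ^ b"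
    unfolding gen' by (simp only: lam_eq[symmetric])
  also have "\<dots> = of_int lam ^ (a + b) * ((be ^ n) ^ a * (al ^ n) ^ b)"
    by (simp only: power_mult_distrib[of "of_int lam"] power_add ac_simps)
  finally have 2: "(al ^ a * be ^ b) ^ n = of_int lam ^ (a + b) * (be ^ a * al ^ b) ^ n"
    unfolding gen' .
  show ?thesis
    unfolding compatible_def sgn_of_of_nat using 1 2 by simp
qed

lemma pf_linear: "pf d a b \<in> linear_maps A scalar_algebra"
  unfolding pf_def by (rule functional_linear[OF compatible_pf])

lemma pf_U: "pf d a b (U d' q r) = (if d = of_nat (q + r) \<and> d' = of_nat (a + b) then chi a b q r else 0)"
  unfolding pf_def functional_U[OF compatible_pf] by (auto simp: chi_def)

lemmas pf_add = linear_maps_add[OF pf_linear, simplified]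
lemmas pf_smult = linear_maps_smult[OF pf_linear, simplified]

lemma pf_sym: "pf d a b (U d' q r) = pf d' q r (U d a b)"
  by (auto simp: pf_U chi_sym)

lemma pf_one: "pf d a b \<one>\<^bsub>A\<^esub> = (if d = 0 then 1 else 0)"
  using two_cases[of "of_nat (a + b)"] by (auto simp: one_eq pf_add pf_U)

text \<open>The right-hand side is the coproduct of \<open>U d a b\<close> evaluated at
  \<open>x\<close> and \<open>y\<close>. For \<open>x = U d1 p p'\<close> the parity of
  \<open>p + p'\<close> selects one of the two summands, just as it selects the case in
  \<open>U_mult\<close>; the exchange of counts for odd parity is absorbed by
  \<open>chi_swap\<close>.\<close>

lemma pf_mult:
  assumes "x \<in> carrier A" "y \<in> carrier A"
  shows "pf d a b (x \<otimes>\<^bsub>A\<^esub> y) = pf 0 a b x * pf d a b y + pf 1 a b x * pf (d + 1) b a y"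
proof -
  have U: "pf d a b (U d1 p p' \<otimes>\<^bsub>A\<^esub> U d2 q q') =
      pf 0 a b (U d1 p p') * pf d a b (U d2 q q') + pf 1 a b (U d1 p p') * pf (d + 1) b a (U d2 q q')"
    for d1 d2 p p' q q'
  proof -
    have ab: "(of_nat (b + a) :: 2) = of_nat (a + b)" by (simp add: add.commute)
    have zero: "pf d a b \<zero>\<^bsub>A\<^esub> = 0"
      using linear_maps_zero[OF pf_linear A.kspace_axioms kspace_scalar_algebra] by simp
    have e: "d + 1 = e \<longleftrightarrow> d = e + 1" for e
      using two_cases[of d] two_cases[of e] by auto
    show ?thesis
    proof (cases "even (p + p')")
      case True
      then have 1: "(of_nat (p + p') :: 2) = 0" by (simp only: of_nat_two if_True)
      have "(of_nat ((p + q) + (p' + q')) :: 2) = of_nat (p + p') + of_nat (q + q')"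
        by (simp add: ac_simps)
      then have 2: "(of_nat ((p + q) + (p' + q')) :: 2) = of_nat (q + q')" unfolding 1 by simp
      show ?thesis
        unfolding U_mult using True by (auto simp only: if_True pf_U 1 2 ab zero chi_add simp_thms split: if_splits) auto
    next
      case False
      then have 1: "(of_nat (p + p') :: 2) = 1" by (simp only: of_nat_two if_False)
      have "(of_nat ((p + q') + (p' + q)) :: 2) = of_nat (p + p') + of_nat (q + q')"
        by (simp add: ac_simps)
      then have 2: "(of_nat ((p + q') + (p' + q)) :: 2) = of_nat (q + q') + 1" unfolding 1 by (simp add: add.commute)
      show ?thesis
        unfolding U_mult using False
        by (auto simp only: if_False pf_U 1 2 ab zero chi_add chi_swap[of b a] e simp_thms split: if_splits) auto
    qed
  qed
  have lin: "(\<lambda>y. c * pf d' a' b' y + c' * pf d'' a'' b'' y) \<in> linear_maps A scalar_algebra" for c c' d' a' b' d'' a'' b''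
    by (rule linear_mapsI) (simp_all add: pf_add pf_smult algebra_simps)
  have lin': "(\<lambda>y. pf d' a' b' y * c + pf d'' a'' b'' y * c') \<in> linear_maps A scalar_algebra" for c c' d' a' b' d'' a'' b''
    by (rule linear_mapsI) (simp_all add: pf_add pf_smult algebra_simps)
  have left: "(\<lambda>y. pf d a b (z \<otimes>\<^bsub>A\<^esub> y)) \<in> linear_maps A scalar_algebra"
    "(\<lambda>y. pf d a b (y \<otimes>\<^bsub>A\<^esub> z)) \<in> linear_maps A scalar_algebra" if "z \<in> carrier A" for z
    by (rule linear_maps_compose[OF _ pf_linear], use AA.mult_bilinear that in \<open>auto simp: bilinear_maps_def\<close>)+
  have "pf d a b (U d1 p p' \<otimes>\<^bsub>A\<^esub> y) =
      pf 0 a b (U d1 p p') * pf d a b y + pf 1 a b (U d1 p p') * pf (d + 1) b a y" for d1 p p'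
    by (rule A_maps_eq[OF left(1) lin U assms(2)]) simp
  then show ?thesis
    by (intro A_maps_eq[OF left(2)[OF assms(2)] lin' _ assms(1)])
qed

text \<open>When the values do not vanish, \<open>d\<close> and \<open>d'\<close> are the parities
  of \<open>q + r\<close> and \<open>a + b\<close>. The antipode therefore exchanges counts on one
  side exactly when it does so on the other, and an exchange in either argument of
  \<open>chi\<close> has the same effect. The common shift of the counts contributes a power of
  \<open>al * be\<close> that is symmetric in both sides.\<close>

lemma pf_antipode: "pf d a b (antipode H (U d' q r)) = pf d' q r (antipode H (U d a b))"
proof (cases "d = of_nat (q + r) \<and> d' = of_nat (a + b)")
  case True
  have even: "(of_nat ((N - 1) * m) :: 2) = 0" for m
    using odd_N by (simp add: of_nat_two)
  have par: "(of_nat ((N - 1) * m + x + ((N - 1) * m + y)) :: 2) = of_nat (x + y)" for m x y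
    using even by simp
  have shift: "chi a b ((N - 1) * m + x) ((N - 1) * m + y) = (al * be) ^ ((a + b) * ((N - 1) * m)) * chi a b x y"
    for a b m x y
    by (simp only: chi_add chi_diagonal)
  have comm: "(q + r) * ((N - 1) * (a + b)) = (a + b) * ((N - 1) * (q + r))" by simp
  have ab: "(of_nat (b + a) :: 2) = of_nat (a + b)" "(of_nat (r + q) :: 2) = of_nat (q + r)"
    by (simp_all add: add.commute)
  have chi: "chi q r b a = chi a b r q" "chi q r a b = chi a b q r"
    by (metis chi_sym chi_swap)+
  show ?thesis
  proof (cases "(of_nat (q + r) :: 2) = of_nat (a + b)")
    case eq: True
    show ?thesis
      using True eq by (simp only: antipode_U pf_U par ab shift comm chi if_True simp_thms)
  next
    case neq: False
    then have "(of_nat (a + b) :: 2) \<noteq> of_nat (q + r)" by simp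
    then show ?thesis
      using True neq by (simp only: antipode_U pf_U par shift comm chi if_True if_False simp_thms)
  qed
next
  case False
  have even: "(of_nat ((N - 1) * m) :: 2) = 0" for m
    using odd_N by (simp add: of_nat_two)
  have par: "(of_nat ((N - 1) * m + x + ((N - 1) * m + y)) :: 2) = of_nat (x + y)" for m x y
    using even by simp
  have ab: "(of_nat (b + a) :: 2) = of_nat (a + b)" for a b
    by (simp add: add.commute)
  have "pf d a b (antipode H (U d' q r)) = 0" "pf d' q r (antipode H (U d a b)) = 0"
    using False by (auto simp only: antipode_U pf_U par ab split: if_splits)
  then show ?thesis by simp
qed

subsection \<open>A basis and its dual\<close>

text \<open>The indices \<open>(d, e, i, k)\<close> parametrize the elements \<open>U d a b\<close> up to scalars: \<open>e\<close> is the parity of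
  \<open>a - b\<close>, which is determined modulo \<open>2n\<close>, and then \<open>b\<close> is determined modulo \<open>N\<close>.\<close>

definition index_set :: "(2 \<times> 2 \<times> nat \<times> nat) set" where
  "index_set = UNIV \<times> UNIV \<times> {..<n} \<times> {..<N}"

lemma finite_index_set [simp]: "finite index_set"
  by (simp add: index_set_def)

fun basis :: "2 \<times> 2 \<times> nat \<times> nat \<Rightarrow> 'k suzuki" where
  "basis (d, e, i, k) = U d (bit e + 2 * i + k) k"

fun basis_pf :: "2 \<times> 2 \<times> nat \<times> nat \<Rightarrow> 'k suzuki \<Rightarrow> 'k" where
  "basis_pf (d, e, i, k) = pf d (bit e + 2 * i + k) k"

text \<open>The form of \<open>chi_roots\<close> for two basis elements, with
  \<open>bit e + 2 * i\<close> and \<open>bit d + 2 * j\<close> as the differences of the counts.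
  All entries are nonzero, so they can be inverted entrywise.\<close>

definition gram :: "2 \<Rightarrow> nat \<Rightarrow> nat \<Rightarrow> 2 \<Rightarrow> nat \<Rightarrow> nat \<Rightarrow> 'k" where
  "gram e i k d j l = (ze ^ (bit e + 2 * i + 2 * k)) ^ (bit d + 2 * j + 2 * l) * (xi ^ (bit e + 2 * i)) ^ (bit d + 2 * j)"

lemma gram_nonzero [simp]: "gram e i k d j l \<noteq> 0"
  by (simp add: gram_def)

lemma basis_closed [simp]: "basis i \<in> carrier A"
  by (cases i) simp

lemma basis_pf_basis:
  "basis_pf (d', e', j, l) (basis (d, e, i, k)) = (if d' = e \<and> d = e' then gram e i k d j l else 0)"
proof -
  have "(of_nat (bit e + 2 * i + k + k) :: 2) = e" for e i k
    using of_nat_bit[of e "i + k"] by (simp add: ac_simps)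
  then show ?thesis
    using chi_roots[of "bit e + 2 * i" k "bit e' + 2 * j" l] chi_sym
    by (auto simp: pf_U gram_def)
qed

text \<open>The exponents differ by \<open>2 * (k' - k)\<close>, and the factor 2 cancels in the
  divisibility by \<open>N\<close> because \<open>N\<close> is odd.\<close>

lemma ze_power_eq:
  assumes "ze ^ (c + 2 * k) = ze ^ (c + 2 * k')" "k < N" "k' < N" shows "k = k'"
  using assms
proof (induction k k' rule: linorder_wlog)
  case (le k k')
  have "c + 2 * k' = (c + 2 * k) + 2 * (k' - k)" using le(1) by simp
  then have "ze ^ (c + 2 * k') = ze ^ (c + 2 * k) * ze ^ (2 * (k' - k))"
    by (metis power_add)
  then have "ze ^ (2 * (k' - k)) = 1" using le(2) by simp
  then have "N dvd 2 * (k' - k)" by (rule ze_order)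
  then have "N dvd k' - k" using odd_N by (simp add: coprime_dvd_mult_right_iff)
  then show ?case using le by (auto dest: dvd_imp_le)
qed auto

text \<open>Squaring turns the step 2 in the exponent into a step 4, which is what the hypothesis on
  \<open>xi ^ 4\<close> controls.\<close>

lemma xi_power_eq:
  assumes "(xi ^ (c + 2 * i)) ^ 2 = (xi ^ (c + 2 * i')) ^ 2" "i < n" "i' < n" shows "i = i'"
  using assms
proof (induction i i' rule: linorder_wlog)
  case (le i i')
  have "2 * (c + 2 * i') = 2 * (c + 2 * i) + 4 * (i' - i)" using le(1) by simp
  then have "(xi ^ (c + 2 * i')) ^ 2 = (xi ^ (c + 2 * i)) ^ 2 * xi ^ (4 * (i' - i))"
    by (metis mult.commute power_add power_mult)
  then have "xi ^ (4 * (i' - i)) = 1" using le(2) by simp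
  then have "n dvd i' - i" by (rule xi_order)
  then show ?case using le by (auto dest: dvd_imp_le)
qed auto

text \<open>The quotient of two rows is a product of geometric progressions in \<open>j\<close> and
  \<open>l\<close>, so character orthogonality applies: up to the factor \<open>n * N\<close>, the
  inverse of the Gram matrix is the transpose of its entrywise inverse.\<close>

lemma gram_orthogonal:
  assumes "i < n" "i' < n" "k < N" "k' < N"
  shows "(\<Sum>j<n. \<Sum>l<N. gram e i' k' d j l / gram e i k d j l) = (if i = i' \<and> k = k' then of_nat (n * N) else 0)"
proof -
  define x where "x = ze ^ (bit e + 2 * i' + 2 * k') / ze ^ (bit e + 2 * i + 2 * k)"
  define y where "y = xi ^ (bit e + 2 * i') / xi ^ (bit e + 2 * i)"
  have ratio: "gram e i' k' d j l / gram e i k d j l = (x * y) ^ bit d * ((x * y) ^ 2) ^ j * (x ^ 2) ^ l" for j l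
  proof -
    have "gram e i' k' d j l / gram e i k d j l = x ^ (bit d + 2 * j + 2 * l) * y ^ (bit d + 2 * j)"
      by (simp add: gram_def x_def y_def power_divide)
    then show ?thesis by (simp add: power_add power_mult power_mult_distrib power2_eq_square ac_simps)
  qed
  have sum: "(\<Sum>j<n. \<Sum>l<N. gram e i' k' d j l / gram e i k d j l) =
      (x * y) ^ bit d * (\<Sum>j<n. ((x * y) ^ 2) ^ j) * (\<Sum>l<N. (x ^ 2) ^ l)"
    unfolding ratio by (simp add: sum_distrib_left sum_distrib_right ac_simps)
  have xN: "x ^ N = 1"
    by (simp add: x_def power_divide) (metis mult.commute power_mult power_one ze)
  then have x2N: "(x ^ 2) ^ N = 1" by (metis mult.commute power_mult power_one)
  show ?thesis
  proof (cases "x ^ 2 = 1")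
    case False
    then have "i \<noteq> i' \<or> k \<noteq> k'" by (auto simp: x_def)
    moreover have "(\<Sum>l<N. (x ^ 2) ^ l) = 0" by (rule sum_powers_root[OF x2N False])
    ultimately show ?thesis unfolding sum by auto
  next
    case True
    \<comment> \<open>For odd \<open>N\<close>, \<open>x ^ 2 = 1\<close> and
      \<open>x ^ N = 1\<close> force \<open>x = 1\<close>, after which the sum over \<open>j\<close>
      involves \<open>y\<close> alone.\<close>
    obtain M where "N = 2 * M + 1" using odd_N by (rule oddE)
    then have "x ^ N = (x ^ 2) ^ M * x" by (simp add: power_mult)
    then have x1: "x = 1" using True xN by simp
    have y2n: "(y ^ 2) ^ n = 1"
    proof -
      have 1: "(xi ^ m) ^ (2 * n) = of_int lam ^ m" for m
        by (metis mult.commute power_mult xi)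
      \<comment> \<open>Numerator and denominator of \<open>y\<close> have exponents of the same
        parity, so the powers of \<open>lam\<close> cancel in \<open>y ^ (2 * n)\<close>.\<close>
      have "of_int lam ^ (bit e + 2 * j) = (of_int lam ^ bit e :: 'k)" for j
        using lam by (auto simp: power_add power_mult)
      then have "y ^ (2 * n) = 1"
        using lam by (auto simp: y_def power_divide 1)
      then show ?thesis by (simp add: power_mult)
    qed
    show ?thesis
    proof (cases "y ^ 2 = 1")
      case False
      then have "i \<noteq> i'" by (auto simp: y_def)
      moreover have "(\<Sum>j<n. (y ^ 2) ^ j) = 0" by (rule sum_powers_root[OF y2n False])
      ultimately show ?thesis unfolding sum x1 by simp
    next
      case True
      then have "(xi ^ (bit e + 2 * i)) ^ 2 = (xi ^ (bit e + 2 * i')) ^ 2"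
        by (simp add: y_def power_divide)
      then have i: "i = i'" using assms by (intro xi_power_eq)
      have "ze ^ (bit e + 2 * i + 2 * k) = ze ^ (bit e + 2 * i + 2 * k')"
        using x1 by (simp add: x_def i)
      then have k: "k = k'" using assms by (intro ze_power_eq)
      have "y = 1" by (simp add: y_def i)
      then show ?thesis unfolding sum x1 using i k by simp
    qed
  qed
qed

text \<open>The inverse Gram matrix applied to the functionals \<open>basis_pf\<close>. Type and
  parity change places between \<open>(d, e)\<close> and \<open>(e, d)\<close>, since a pairing is
  nonzero only if the type on each side is the parity on the other.\<close>

fun coord :: "2 \<times> 2 \<times> nat \<times> nat \<Rightarrow> 'k suzuki \<Rightarrow> 'k" where
  "coord (d, e, i, k) x = (\<Sum>j<n. \<Sum>l<N. basis_pf (e, d, j, l) x / (gram e i k d j l * of_nat (n * N)))"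

lemma basis_pf_linear: "basis_pf i \<in> linear_maps A scalar_algebra"
  by (cases i) (simp add: pf_linear)

lemma coord_linear: "coord i \<in> linear_maps A scalar_algebra"
  by (cases i, rule linear_mapsI)
    (simp_all add: pf_add pf_smult add_divide_distrib sum.distrib sum_distrib_left)

lemma coord_basis:
  assumes "i \<in> index_set" "j \<in> index_set"
  shows "coord i (basis j) = (if i = j then 1 else 0)"
proof -
  obtain d e a b where i: "i = (d, e, a, b)" by (cases i)
  obtain d' e' a' b' where j: "j = (d', e', a', b')" by (cases j)
  show ?thesis
  proof (cases "e = e' \<and> d' = d")
    case False
    then have "basis_pf (e, d, p, q) (basis j) = 0" for p q
      unfolding j basis_pf_basis by auto
    then show ?thesis using False by (auto simp: i j simp del: basis_pf.simps basis.simps)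
  next
    case True
    have "coord i (basis j) = (\<Sum>p<n. \<Sum>q<N. gram e a' b' d p q / gram e a b d p q) / of_nat (n * N)"
      using True unfolding i j coord.simps basis_pf_basis by (simp add: sum_divide_distrib)
    then show ?thesis
      using True assms nN by (subst (asm) gram_orthogonal) (auto simp: index_set_def i j)
  qed
qed

lemma U_alts: "U d (a + s * n) b = sgn_of lam d ^ s \<odot>\<^bsub>A\<^esub> U d a (b + s * n)"
proof (induction s arbitrary: b)
  case (Suc s)
  have "U d (a + Suc s * n) b = U d (a + s * n + n) b" by (simp add: ac_simps)
  also have "\<dots> = sgn_of lam d \<odot>\<^bsub>A\<^esub> U d (a + s * n) (b + n)" by (rule U_alt)
  finally show ?case unfolding Suc by (simp add: A.smult_smult ac_simps)
qed simp

text \<open>Moving multiples of \<open>n\<close> from one count to the other reduces the difference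
  of the counts modulo \<open>2 * n\<close>; shifting both by multiples of \<open>N\<close> then
  reduces the second count.\<close>

lemma U_scalar_basis: "\<exists>c. \<exists>i\<in>index_set. U d a b = c \<odot>\<^bsub>A\<^esub> basis i"
proof -
  have ge: "\<exists>c. \<exists>i\<in>index_set. U d a b = c \<odot>\<^bsub>A\<^esub> basis i" if ab: "b \<le> a" for a b
  proof -
    define r where "r = (a - b) mod (2 * n)"
    define s where "s = (a - b) div (2 * n)"
    \<comment> \<open>Half of the multiple \<open>2 * n * s\<close> in the difference is moved to
      the second count, leaving the difference \<open>r < 2 * n\<close>.\<close>
    have a: "a = b + r + s * n + s * n"
      using ab by (simp add: r_def s_def algebra_simps) (metis div_mult_mod_eq mult.assoc mult.commute add.commute le_add_diff_inverse mult_2 distrib_left)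
    define e :: 2 where "e = of_nat r"
    define i where "i = r div 2"
    define y where "y = b + s * n"
    have r: "r = bit e + 2 * i"
      by (auto simp: e_def i_def bit_def of_nat_two)
    have "r < 2 * n" using n by (simp add: r_def)
    then have i: "i < n" by (simp add: i_def)
    have "a = (r + y) + s * n" by (simp add: a y_def)
    then have "U d a b = sgn_of lam d ^ s \<odot>\<^bsub>A\<^esub> U d (r + y) (b + s * n)"
      using U_alts[of d "r + y" s b] by simp
    also have "b + s * n = y" by (simp add: y_def)
    also have "U d (r + y) y = U d (r + y mod N + y div N * N) (y mod N + y div N * N)"
      by (simp add: add.assoc)
    also have "\<dots> = basis (d, e, i, y mod N)"
      unfolding U_shifts by (simp add: r)
    finally have "U d a b = sgn_of lam d ^ s \<odot>\<^bsub>A\<^esub> basis (d, e, i, y mod N)" .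
    moreover have "(d, e, i, y mod N) \<in> index_set" using i N by (simp add: index_set_def)
    ultimately show ?thesis by blast
  qed
  \<comment> \<open>Reduction to the case \<open>b \<le> a\<close>: both counts grow by
    \<open>b * n * N\<close>, a multiple of \<open>N\<close>, and then \<open>b * n\<close> is moved
    from the second count to the first. The truncated subtraction is exact because
    \<open>N \<ge> 1\<close>.\<close>
  define a' where "a' = a + b * n * N"
  define b' where "b' = b + (b * n * N - b * n)"
  have le: "b * n \<le> b * n * N" using N by simp
  have le_mult: "b \<le> b * n" using n by simp
  have ge': "b' \<le> a' + b * n" using le le_mult unfolding a'_def b'_def by linarith
  have "b' + b * n = b + b * n * N" using le unfolding b'_def by linarith
  then have "U d a b = U d a' (b' + b * n)"
    using U_shifts[of d a "b * n" b] by (simp only: a'_def)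
  also have "\<dots> = sgn_of lam d ^ b \<odot>\<^bsub>A\<^esub> U d (a' + b * n) b'"
    unfolding U_alts by (simp add: A.smult_smult sgn_of_square flip: power_mult_distrib)
  finally have eq: "U d a b = sgn_of lam d ^ b \<odot>\<^bsub>A\<^esub> U d (a' + b * n) b'" .
  obtain c i where "i \<in> index_set" "U d (a' + b * n) b' = c \<odot>\<^bsub>A\<^esub> basis i" using ge[OF ge'] by blast
  then show ?thesis unfolding eq by (auto simp: A.smult_smult)
qed

lemma basis_expansion:
  assumes "x \<in> carrier A" shows "x = (\<Oplus>\<^bsub>A\<^esub>i\<in>index_set. coord i x \<odot>\<^bsub>A\<^esub> basis i)"
proof -
  let ?f = "\<lambda>x. \<Oplus>\<^bsub>A\<^esub>i\<in>index_set. coord i x \<odot>\<^bsub>A\<^esub> basis i"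
  note add = linear_maps_add[OF coord_linear, simplified] and scale = linear_maps_smult[OF coord_linear, simplified]
  have lin: "?f \<in> linear_maps A A"
    by (rule linear_mapsI)
      (simp_all add: add scale A.smult_add_left A.finsum_addf A.smult_finsum A.smult_smult Pi_def)
  have basis: "?f (basis j) = basis j" if j: "j \<in> index_set" for j
  proof -
    have "?f (basis j) = (\<Oplus>\<^bsub>A\<^esub>i\<in>index_set. if j = i then basis i else \<zero>\<^bsub>A\<^esub>)"
      by (rule A.finsum_cong') (use j in \<open>auto simp: coord_basis simp del: coord.simps\<close>)
    also have "\<dots> = basis j" using j by (intro A.add.finprod_singleton) auto
    finally show ?thesis .
  qed
  have "?f x = id x"
  proof (rule A_maps_eq[OF lin linear_maps_id _ assms])
    fix d a b
    obtain c i where i: "i \<in> index_set" and eq: "U d a b = c \<odot>\<^bsub>A\<^esub> basis i"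
      using U_scalar_basis by blast
    show "?f (U d a b) = id (U d a b)"
      unfolding eq using linear_maps_smult[OF lin basis_closed[of i], of c] basis[OF i] by simp
  qed
  then show ?thesis by simp
qed

text \<open>Expanding the first argument in coordinates makes bilinearity evident, so the dependence
  of \<open>pf d a b\<close> on \<open>U d a b\<close> need not be checked against
  relations.\<close>

definition pairing :: "'k suzuki \<Rightarrow> 'k suzuki \<Rightarrow> 'k" where
  "pairing x y = (\<Sum>i\<in>index_set. coord i x * basis_pf i y)"

lemma pairing_linear:
  "pairing x \<in> linear_maps A scalar_algebra" "(\<lambda>x. pairing x y) \<in> linear_maps A scalar_algebra"
proof -
  note add = linear_maps_add[OF coord_linear, simplified] and scale = linear_maps_smult[OF coord_linear, simplified]
  note add' = linear_maps_add[OF basis_pf_linear, simplified] and scale' = linear_maps_smult[OF basis_pf_linear, simplified]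
  show "pairing x \<in> linear_maps A scalar_algebra" "(\<lambda>x. pairing x y) \<in> linear_maps A scalar_algebra"
    by (intro linear_mapsI; simp add: pairing_def add add' scale scale' algebra_simps sum.distrib sum_distrib_left)+
qed

lemma linear_expansion:
  assumes "f \<in> linear_maps A scalar_algebra" "x \<in> carrier A"
  shows "f x = (\<Sum>i\<in>index_set. coord i x * f (basis i))"
proof -
  have "f x = f (\<Oplus>\<^bsub>A\<^esub>i\<in>index_set. coord i x \<odot>\<^bsub>A\<^esub> basis i)"
    using basis_expansion[OF assms(2)] by simp
  also have "\<dots> = (\<Oplus>\<^bsub>scalar_algebra\<^esub>i\<in>index_set. f (coord i x \<odot>\<^bsub>A\<^esub> basis i))"
    by (rule linear_maps_finsum[OF assms(1) A.kspace_axioms kspace_scalar_algebra]) auto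
  finally show ?thesis
    by (simp add: finsum_scalar_algebra linear_maps_smult[OF assms(1)])
qed

text \<open>Symmetry turns the coefficients \<open>basis_pf i (U d a b)\<close> into
  \<open>pf d a b (basis i)\<close>, and the defining sum becomes the expansion of
  \<open>pf d a b\<close> at \<open>x\<close>.\<close>

lemma pairing_U_right:
  assumes "x \<in> carrier A" shows "pairing x (U d a b) = pf d a b x"
proof -
  have "basis_pf i (U d a b) = pf d a b (basis i)" for i
    by (cases i) (simp add: pf_sym)
  then show ?thesis
    by (simp only: pairing_def linear_expansion[OF pf_linear assms])
qed

lemma pairing_U_left: "y \<in> carrier A \<Longrightarrow> pairing (U d a b) y = pf d a b y"
  by (rule A_maps_eq[OF pairing_linear(1) pf_linear]) (simp_all add: pairing_U_right pf_sym)

end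

section \<open>The map to the dual and its compatibility with all structure maps\<close>

section \<open>The dual Hopf algebra\<close>

lemma dual_algebra_simps [simp]:
  "carrier (dual_algebra H) = linear_maps H scalar_algebra \<inter> extensional (carrier H)"
  "f \<oplus>\<^bsub>dual_algebra H\<^esub> g = (\<lambda>x\<in>carrier H. f x + g x)"
  "\<zero>\<^bsub>dual_algebra H\<^esub> = (\<lambda>x\<in>carrier H. 0)"
  "c \<odot>\<^bsub>dual_algebra H\<^esub> f = (\<lambda>x\<in>carrier H. c * f x)"
  by (simp_all add: dual_algebra_def)

lemma restrict_linear:
  assumes "kspace V" "f \<in> linear_maps V W"
  shows "restrict f (carrier V) \<in> linear_maps V W"
proof -
  interpret kspace V by fact
  show ?thesis using assms(2) by (auto simp: linear_maps_def)
qed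

lemma kspace_dual_algebra:
  fixes H :: "('k::field, 'a) hopf"
  assumes "kspace H" shows "kspace (dual_algebra H)"
proof -
  interpret H: kspace H by fact
  note S = kspace_scalar_algebra
  note restr = restrict_linear[OF assms]
  have add: "(\<lambda>x\<in>carrier H. f x + g x) \<in> linear_maps H scalar_algebra"
    if "f \<in> linear_maps H scalar_algebra" "g \<in> linear_maps H scalar_algebra" for f g
    using restr[OF linear_maps_plus[OF S that]] by simp
  have scale: "(\<lambda>x\<in>carrier H. c * f x) \<in> linear_maps H scalar_algebra"
    if "f \<in> linear_maps H scalar_algebra" for f c
    using restr[OF linear_maps_scaled[OF S that]] by simp
  have zero: "(\<lambda>x\<in>carrier H. 0) \<in> linear_maps H scalar_algebra"
    by (rule restr, rule linear_mapsI) simp_all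
  have "abelian_group (dual_algebra H)"
  proof (rule abelian_groupI)
    fix f assume f: "f \<in> carrier (dual_algebra H)"
    then show "\<exists>g\<in>carrier (dual_algebra H). g \<oplus>\<^bsub>dual_algebra H\<^esub> f = \<zero>\<^bsub>dual_algebra H\<^esub>"
      using scale[of f "- 1"] by (intro bexI[of _ "\<lambda>x\<in>carrier H. - 1 * f x"]) (auto intro: restrict_ext)
    show "\<zero>\<^bsub>dual_algebra H\<^esub> \<oplus>\<^bsub>dual_algebra H\<^esub> f = f"
      using f by (auto intro!: extensionalityI[of _ "carrier H"])
  qed (auto simp: add zero algebra_simps intro: restrict_ext)
  then interpret abelian_group "dual_algebra H" .
  show ?thesis
    by unfold_locales (auto simp: scale algebra_simps intro!: extensionalityI[of _ "carrier H"])
qed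

lemma dual_hopf_simps [simp]:
  "carrier (dual_hopf H) = carrier (dual_algebra H)" "add (dual_hopf H) = add (dual_algebra H)"
  "zero (dual_hopf H) = zero (dual_algebra H)" "module.smult (dual_hopf H) = module.smult (dual_algebra H)"
  "f \<otimes>\<^bsub>dual_hopf H\<^esub> g = (\<lambda>x\<in>carrier H. tensor_lift scalar_algebra (\<lambda>a b. f a * g b) (comult H x))"
  "\<one>\<^bsub>dual_hopf H\<^esub> = (\<lambda>x\<in>carrier H. counit H x)"
  "counit (dual_hopf H) f = f \<one>\<^bsub>H\<^esub>" "antipode (dual_hopf H) f = (\<lambda>x\<in>carrier H. f (antipode H x))"
  by (simp_all add: dual_hopf_def dual_algebra_def module.defs hopf.defs)

lemma comult_dual_hopf:
  "comult (dual_hopf H) f = (THE t. t \<in> carrier (tensor_space (dual_algebra H) (dual_algebra H)) \<and>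
    (\<forall>a\<in>carrier H. \<forall>b\<in>carrier H. tensor_lift scalar_algebra (\<lambda>g h. g a * h b) t = f (a \<otimes>\<^bsub>H\<^esub> b)))"
  by (simp add: dual_hopf_def module.defs hopf.defs)

lemma same_space_dual_hopf: "same_space (dual_algebra H) (dual_hopf H)"
  by unfold_locales simp_all

lemma linear_maps_finsum_pointwise:
  assumes W: "kspace W" and "kspace V" and "finite S" "\<And>i. i \<in> S \<Longrightarrow> f i \<in> linear_maps V W"
  shows "(\<lambda>x. \<Oplus>\<^bsub>W\<^esub>i\<in>S. f i x) \<in> linear_maps V W"
  using assms(3,4)
proof (induction S rule: finite_induct)
  case empty
  interpret W: kspace W by fact
  show ?case by (rule linear_mapsI) simp_all
next
  case (insert i S)
  interpret W: kspace W by fact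
  interpret V: kspace V by fact
  have cl: "f j x \<in> carrier W" if "j \<in> insert i S" "x \<in> carrier V" for j x
    using linear_maps_closed[OF insert.prems] that by blast
  have eq: "(\<Oplus>\<^bsub>W\<^esub>j\<in>insert i S. f j x) = f i x \<oplus>\<^bsub>W\<^esub> (\<Oplus>\<^bsub>W\<^esub>j\<in>S. f j x)" if "x \<in> carrier V" for x
    using insert.hyps cl that by (intro W.finsum_insert) auto
  have lin: "(\<lambda>x. f i x \<oplus>\<^bsub>W\<^esub> (\<Oplus>\<^bsub>W\<^esub>j\<in>S. f j x)) \<in> linear_maps V W"
    by (rule linear_maps_plus[OF W]) (use insert in auto)
  show ?case
    by (rule linear_mapsI)
      (simp_all add: eq linear_maps_closed[OF lin] linear_maps_add[OF lin] linear_maps_smult[OF lin])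
qed

lemma linear_maps_scalar_vector:
  assumes "kspace W" "f \<in> linear_maps V scalar_algebra" "w \<in> carrier W"
  shows "(\<lambda>x. f x \<odot>\<^bsub>W\<^esub> w) \<in> linear_maps V W"
proof -
  interpret W: kspace W by fact
  show ?thesis
    using assms(3) by (intro linear_mapsI)
      (simp_all add: linear_maps_add[OF assms(2)] linear_maps_smult[OF assms(2)] W.smult_add_left W.smult_smult)
qed

lemma product_bilinear:
  assumes "f \<in> linear_maps V scalar_algebra" "g \<in> linear_maps W scalar_algebra"
  shows "(\<lambda>a b. f a * g b) \<in> bilinear_maps V W scalar_algebra"
  by (intro bilinear_mapsI linear_mapsI)
    (simp_all add: linear_maps_add[OF assms(1)] linear_maps_smult[OF assms(1)]
      linear_maps_add[OF assms(2)] linear_maps_smult[OF assms(2)] algebra_simps)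

lemma evaluation_linear: "a \<in> carrier H \<Longrightarrow> (\<lambda>g. g a) \<in> linear_maps (dual_algebra H) scalar_algebra"
  by (rule linear_mapsI) simp_all

lemma evaluation_bilinear:
  "a \<in> carrier H \<Longrightarrow> b \<in> carrier H \<Longrightarrow>
    (\<lambda>g h. g a * h b) \<in> bilinear_maps (dual_algebra H) (dual_algebra H) scalar_algebra"
  by (rule product_bilinear[OF evaluation_linear evaluation_linear])

context suzuki_roots
begin

abbreviation "Dual \<equiv> dual_algebra H"

lemma kspace_Dual: "kspace Dual"
  by (rule kspace_dual_algebra[OF kspace_H])

sublocale DD: kspace_pair Dual Dual
  using kspace_Dual by (simp add: kspace_pair_def)

definition Phi :: "'k suzuki \<Rightarrow> 'k suzuki \<Rightarrow> 'k" where
  "Phi x = restrict (pairing x) (carrier A)"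

definition dual_basis :: "2 \<times> 2 \<times> nat \<times> nat \<Rightarrow> 'k suzuki \<Rightarrow> 'k" where
  "dual_basis i = restrict (coord i) (carrier A)"

lemma restrict_Dual: "f \<in> linear_maps A scalar_algebra \<Longrightarrow> restrict f (carrier A) \<in> carrier Dual"
  using restrict_linear[OF kspace_H, of f scalar_algebra] by (simp add: linear_maps_H)

lemma Phi_closed: "Phi x \<in> carrier Dual"
  unfolding Phi_def by (rule restrict_Dual[OF pairing_linear(1)])

lemma dual_basis_closed: "dual_basis i \<in> carrier Dual"
  unfolding dual_basis_def by (rule restrict_Dual[OF coord_linear])

lemma Phi_linear: "Phi \<in> linear_maps H Dual"
proof (rule linear_mapsI[OF Phi_closed])
  note add = linear_maps_add[OF pairing_linear(2), simplified] and scale = linear_maps_smult[OF pairing_linear(2), simplified]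
  show "Phi (x \<oplus>\<^bsub>H\<^esub> y) = Phi x \<oplus>\<^bsub>Dual\<^esub> Phi y" if "x \<in> carrier H" "y \<in> carrier H" for x y
    using that by (auto simp: Phi_def add intro: restrict_ext)
  show "Phi (c \<odot>\<^bsub>H\<^esub> x) = c \<odot>\<^bsub>Dual\<^esub> Phi x" if "x \<in> carrier H" for c x
    using that by (auto simp: Phi_def scale intro: restrict_ext)
qed

lemma Dual_linear: "g \<in> carrier Dual \<Longrightarrow> g \<in> linear_maps A scalar_algebra"
  by (simp add: linear_maps_H)

lemma Dual_finsum_eval:
  assumes "finite S" "\<And>i. i \<in> S \<Longrightarrow> f i \<in> carrier Dual" "x \<in> carrier A"
  shows "(\<Oplus>\<^bsub>Dual\<^esub>i\<in>S. f i) x = (\<Sum>i\<in>S. f i x)"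
  using linear_maps_finsum[OF evaluation_linear[of x H] kspace_Dual kspace_scalar_algebra assms(1,2)] assms(3)
  by (simp add: finsum_scalar_algebra[OF assms(1)])

lemma Dual_eqI:
  assumes "f \<in> carrier Dual" "g \<in> carrier Dual" "\<And>x. x \<in> carrier A \<Longrightarrow> f x = g x"
  shows "f = g"
  using assms by (intro extensionalityI[of f "carrier A"]) auto

lemma Dual_expansion:
  assumes "g \<in> carrier Dual"
  shows "g = (\<Oplus>\<^bsub>Dual\<^esub>i\<in>index_set. g (basis i) \<odot>\<^bsub>Dual\<^esub> dual_basis i)"
proof (rule Dual_eqI[OF assms])
  have closed: "g (basis i) \<odot>\<^bsub>Dual\<^esub> dual_basis i \<in> carrier Dual" for i
    by (rule DD.V.smult_closed[OF dual_basis_closed])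
  show "(\<Oplus>\<^bsub>Dual\<^esub>i\<in>index_set. g (basis i) \<odot>\<^bsub>Dual\<^esub> dual_basis i) \<in> carrier Dual"
    using closed by (intro DD.V.finsum_closed) blast
  fix x assume x: "x \<in> carrier A"
  have "(\<Oplus>\<^bsub>Dual\<^esub>i\<in>index_set. g (basis i) \<odot>\<^bsub>Dual\<^esub> dual_basis i) x
      = (\<Sum>i\<in>index_set. (g (basis i) \<odot>\<^bsub>Dual\<^esub> dual_basis i) x)"
    by (rule Dual_finsum_eval[OF finite_index_set closed x])
  also have "\<dots> = g x"
    using x linear_expansion[OF Dual_linear[OF assms] x] by (simp add: dual_basis_def mult.commute)
  finally show "g x = (\<Oplus>\<^bsub>Dual\<^esub>i\<in>index_set. g (basis i) \<odot>\<^bsub>Dual\<^esub> dual_basis i) x" by simp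
qed

abbreviation ev :: "'k suzuki \<Rightarrow> 'k suzuki \<Rightarrow> ('k, 'k suzuki \<Rightarrow> 'k, 'k suzuki \<Rightarrow> 'k) tensor \<Rightarrow> 'k" where
  "ev a b \<equiv> tensor_lift scalar_algebra (\<lambda>g h. g a * h b)"

lemma ev_linear:
  "a \<in> carrier A \<Longrightarrow> b \<in> carrier A \<Longrightarrow> ev a b \<in> linear_maps (tensor_space Dual Dual) scalar_algebra"
  and ev_pure: "a \<in> carrier A \<Longrightarrow> b \<in> carrier A \<Longrightarrow> g \<in> carrier Dual \<Longrightarrow> h \<in> carrier Dual \<Longrightarrow>
    ev a b (pure_tensor Dual Dual g h) = g a * h b"
proof -
  assume a: "a \<in> carrier A" and b: "b \<in> carrier A"
  have bil: "(\<lambda>g h. g a * h b) \<in> bilinear_maps Dual Dual scalar_algebra"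
    by (rule evaluation_bilinear) (simp_all add: a b)
  show "ev a b \<in> linear_maps (tensor_space Dual Dual) scalar_algebra"
    by (rule DD.tensor_lift_linear[OF kspace_scalar_algebra bil])
  show "g \<in> carrier Dual \<Longrightarrow> h \<in> carrier Dual \<Longrightarrow> ev a b (pure_tensor Dual Dual g h) = g a * h b"
    by (rule DD.tensor_lift_pure[OF kspace_scalar_algebra bil])
qed

text \<open>An element of the tensor square of the dual is determined by its evaluations at pairs of
  basis elements. This gives the injectivity that makes the definite description in
  \<open>dual_hopf\<close> unique.\<close>

lemma tensor_Dual_expansion:
  assumes "t \<in> carrier (tensor_space Dual Dual)"
  shows "t = (\<Oplus>\<^bsub>tensor_space Dual Dual\<^esub>i\<in>index_set. \<Oplus>\<^bsub>tensor_space Dual Dual\<^esub>j\<in>index_set.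
    ev (basis i) (basis j) t \<odot>\<^bsub>tensor_space Dual Dual\<^esub> pure_tensor Dual Dual (dual_basis i) (dual_basis j))"
proof -
  let ?T = "tensor_space Dual Dual"
  let ?p = "\<lambda>i j. pure_tensor Dual Dual (dual_basis i) (dual_basis j)"
  let ?f = "\<lambda>t. \<Oplus>\<^bsub>?T\<^esub>i\<in>index_set. \<Oplus>\<^bsub>?T\<^esub>j\<in>index_set. ev (basis i) (basis j) t \<odot>\<^bsub>?T\<^esub> ?p i j"
  note T = DD.kspace_tensor_space
  note db = dual_basis_closed
  have p: "?p i j \<in> carrier ?T" for i j
    by (rule DD.pure_tensor_closed[OF db db])
  have lin: "?f \<in> linear_maps ?T ?T"
    by (intro linear_maps_finsum_pointwise[OF T T finite_index_set] linear_maps_scalar_vector[OF T] ev_linear basis_closed p)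
  have pure: "?f (pure_tensor Dual Dual g h) = id (pure_tensor Dual Dual g h)"
    if g: "g \<in> carrier Dual" and h: "h \<in> carrier Dual" for g h
  proof -
    note bil = DD.pure_tensor_bilinear
    have sm: "c \<odot>\<^bsub>Dual\<^esub> dual_basis i \<in> carrier Dual" for c i by (rule DD.V.smult_closed[OF db])
    have right: "pure_tensor Dual Dual (dual_basis i) h = (\<Oplus>\<^bsub>?T\<^esub>j\<in>index_set. h (basis j) \<odot>\<^bsub>?T\<^esub> ?p i j)" for i
    proof -
      note l = bilinear_mapsD(1)[OF bil db[of i]]
      have "pure_tensor Dual Dual (dual_basis i) h =
          pure_tensor Dual Dual (dual_basis i) (\<Oplus>\<^bsub>Dual\<^esub>j\<in>index_set. h (basis j) \<odot>\<^bsub>Dual\<^esub> dual_basis j)"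
        using Dual_expansion[OF h] by (rule arg_cong)
      also have "\<dots> = (\<Oplus>\<^bsub>?T\<^esub>j\<in>index_set. pure_tensor Dual Dual (dual_basis i) (h (basis j) \<odot>\<^bsub>Dual\<^esub> dual_basis j))"
        by (rule linear_maps_finsum[OF l kspace_Dual T finite_index_set sm])
      also have "\<dots> = (\<Oplus>\<^bsub>?T\<^esub>j\<in>index_set. h (basis j) \<odot>\<^bsub>?T\<^esub> ?p i j)"
        by (simp only: linear_maps_smult[OF l db])
      finally show ?thesis .
    qed
    note l = bilinear_mapsD(2)[OF bil h]
    have "pure_tensor Dual Dual g h = pure_tensor Dual Dual (\<Oplus>\<^bsub>Dual\<^esub>i\<in>index_set. g (basis i) \<odot>\<^bsub>Dual\<^esub> dual_basis i) h"
      using Dual_expansion[OF g] by (rule arg_cong[where f = "\<lambda>g. pure_tensor Dual Dual g h"])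
    also have "\<dots> = (\<Oplus>\<^bsub>?T\<^esub>i\<in>index_set. pure_tensor Dual Dual (g (basis i) \<odot>\<^bsub>Dual\<^esub> dual_basis i) h)"
      by (rule linear_maps_finsum[OF l kspace_Dual T finite_index_set sm])
    also have "\<dots> = (\<Oplus>\<^bsub>?T\<^esub>i\<in>index_set. g (basis i) \<odot>\<^bsub>?T\<^esub> (\<Oplus>\<^bsub>?T\<^esub>j\<in>index_set. h (basis j) \<odot>\<^bsub>?T\<^esub> ?p i j))"
      by (simp only: linear_maps_smult[OF l db] right)
    also have "\<dots> = ?f (pure_tensor Dual Dual g h)"
      using p by (simp add: DD.T.smult_finsum DD.T.smult_smult ev_pure[OF basis_closed basis_closed g h]
        del: dual_algebra_simps coord.simps)
    finally show ?thesis by simp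
  qed
  have "?f t = id t"
    by (rule DD.tensor_maps_eq[OF lin linear_maps_id pure assms])
  then show ?thesis by simp
qed

lemma tensor_Dual_eqI:
  assumes "s \<in> carrier (tensor_space Dual Dual)" "t \<in> carrier (tensor_space Dual Dual)"
    and "\<And>a b. a \<in> carrier A \<Longrightarrow> b \<in> carrier A \<Longrightarrow> ev a b s = ev a b t"
  shows "s = t"
  by (rule trans[OF tensor_Dual_expansion[OF assms(1)] trans[OF _ tensor_Dual_expansion[OF assms(2), symmetric]]])
    (simp only: assms(3)[OF basis_closed basis_closed])

lemma pairing_mult_left:
  assumes "x \<in> carrier A" "y \<in> carrier A"
  shows "pairing (U d a b) (x \<otimes>\<^bsub>A\<^esub> y) = pairing (U 0 a b) x * pairing (U d a b) y + pairing (U 1 a b) x * pairing (U (d + 1) b a) y"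
  using assms by (simp add: pairing_U_left pf_mult)

text \<open>The right-hand side is a witness for the definite description: its evaluation at
  \<open>a\<close> and \<open>b\<close> is the two-term formula of \<open>pf_mult\<close> for the
  pairing with a product in the second argument.\<close>

lemma comult_Phi:
  assumes x: "x \<in> carrier A"
  shows "comult (dual_hopf H) (Phi x) = tensor_map Dual Dual Phi Phi (comult H x)"
proof -
  note tm = tensor_map_linear[OF kspace_H kspace_H kspace_Dual kspace_Dual Phi_linear Phi_linear]
  note tmp = tensor_map_pure[OF kspace_H kspace_H kspace_Dual kspace_Dual Phi_linear Phi_linear]
  have closed: "tensor_map Dual Dual Phi Phi (comult H x) \<in> carrier (tensor_space Dual Dual)"
    by (rule linear_maps_closed[OF tm comult_closed[OF x]])
  have eval: "ev a b (tensor_map Dual Dual Phi Phi (comult H x)) = Phi x (a \<otimes>\<^bsub>A\<^esub> b)"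
    if a: "a \<in> carrier A" and b: "b \<in> carrier A" for a b
  proof (rule A_maps_eq[OF _ _ _ x])
    show "(\<lambda>x. ev a b (tensor_map Dual Dual Phi Phi (comult H x))) \<in> linear_maps A scalar_algebra"
      using linear_maps_compose[OF linear_maps_compose[OF comult_linear tm] ev_linear[OF a b]] by (simp add: linear_maps_H)
    have "(\<lambda>x. Phi x (a \<otimes>\<^bsub>A\<^esub> b)) \<in> linear_maps H scalar_algebra"
      by (rule linear_maps_compose[OF Phi_linear evaluation_linear]) (simp add: a b)
    then show "(\<lambda>x. Phi x (a \<otimes>\<^bsub>A\<^esub> b)) \<in> linear_maps A scalar_algebra" by (simp add: linear_maps_H)
    fix d p q
    have "tensor_map Dual Dual Phi Phi (comult H (U d p q)) =
        pure_tensor Dual Dual (Phi (U 0 p q)) (Phi (U d p q)) \<oplus>\<^bsub>tensor_space Dual Dual\<^esub>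
        pure_tensor Dual Dual (Phi (U 1 p q)) (Phi (U (d + 1) q p))"
      by (simp add: comult_H_U linear_maps_add[OF tm] tmp del: dual_algebra_simps)
    then have "ev a b (tensor_map Dual Dual Phi Phi (comult H (U d p q))) =
        Phi (U 0 p q) a * Phi (U d p q) b + Phi (U 1 p q) a * Phi (U (d + 1) q p) b"
      using Phi_closed
      by (simp add: linear_maps_add[OF ev_linear[OF a b]] ev_pure[OF a b] DD.pure_tensor_closed del: dual_algebra_simps)
    then show "ev a b (tensor_map Dual Dual Phi Phi (comult H (U d p q))) = Phi (U d p q) (a \<otimes>\<^bsub>A\<^esub> b)"
      using a b by (simp add: Phi_def pairing_mult_left)
  qed
  show ?thesis
    unfolding comult_dual_hopf
  proof (rule the_equality)
    show "tensor_map Dual Dual Phi Phi (comult H x) \<in> carrier (tensor_space Dual Dual) \<and>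
      (\<forall>a\<in>carrier H. \<forall>b\<in>carrier H. ev a b (tensor_map Dual Dual Phi Phi (comult H x)) = Phi x (a \<otimes>\<^bsub>H\<^esub> b))"
      using closed eval by simp
  next
    fix t assume t: "t \<in> carrier (tensor_space Dual Dual) \<and>
      (\<forall>a\<in>carrier H. \<forall>b\<in>carrier H. ev a b t = Phi x (a \<otimes>\<^bsub>H\<^esub> b))"
    show "t = tensor_map Dual Dual Phi Phi (comult H x)"
      by (rule tensor_Dual_eqI[OF _ closed]) (use t eval in simp_all)
  qed
qed

text \<open>The same identity \<open>pf_mult\<close> read in the other argument:
  \<open>pairing_U_right\<close> expresses the pairing of the product \<open>x \<otimes> y\<close>
  with \<open>U d a b\<close> through \<open>pf d a b\<close>.\<close>

lemma Phi_mult: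
  assumes x: "x \<in> carrier A" and y: "y \<in> carrier A"
  shows "Phi (x \<otimes>\<^bsub>A\<^esub> y) = Phi x \<otimes>\<^bsub>dual_hopf H\<^esub> Phi y"
proof -
  have bil: "(\<lambda>a b. Phi x a * Phi y b) \<in> bilinear_maps H H scalar_algebra"
    using Phi_closed[of x] Phi_closed[of y] by (intro product_bilinear) simp_all
  note cl = comult_lift[OF kspace_scalar_algebra bil]
  have lin: "pairing (x \<otimes>\<^bsub>A\<^esub> y) \<in> linear_maps H scalar_algebra"
    using pairing_linear(1) by (simp add: linear_maps_H)
  have "pairing (x \<otimes>\<^bsub>A\<^esub> y) z = tensor_lift scalar_algebra (\<lambda>a b. Phi x a * Phi y b) (comult H z)"
    if "z \<in> carrier H" for z
  proof (rule H_maps_eq[OF lin cl(1) _ that])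
    show "pairing (x \<otimes>\<^bsub>A\<^esub> y) (U d a b) = tensor_lift scalar_algebra (\<lambda>a b. Phi x a * Phi y b) (comult H (U d a b))" for d a b
      unfolding cl(2) using x y by (simp add: Phi_def pairing_U_right pf_mult)
  qed
  then show ?thesis by (auto simp: Phi_def intro: restrict_ext)
qed

lemma pairing_one: "x \<in> carrier A \<Longrightarrow> pairing x \<one>\<^bsub>A\<^esub> = counit H x"
  and pairing_one_left: "x \<in> carrier A \<Longrightarrow> pairing \<one>\<^bsub>A\<^esub> x = counit H x"
proof -
  have c: "counit H \<in> linear_maps A scalar_algebra"
    using algebra_mapsD(1)[OF counit_algebra_map] by (simp add: linear_maps_H)
  show "x \<in> carrier A \<Longrightarrow> pairing x \<one>\<^bsub>A\<^esub> = counit H x"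
    by (rule A_maps_eq[OF pairing_linear(2) c]) (simp_all add: pairing_U_left pf_one counit_U)
  show "x \<in> carrier A \<Longrightarrow> pairing \<one>\<^bsub>A\<^esub> x = counit H x"
    by (rule A_maps_eq[OF pairing_linear(1) c]) (simp_all add: pairing_U_right pf_one counit_U)
qed

lemma pairing_antipode:
  assumes x: "x \<in> carrier A" and y: "y \<in> carrier A"
  shows "pairing x (antipode H y) = pairing (antipode H x) y"
proof -
  have S: "antipode H \<in> linear_maps A A" using antipode_linear by (simp add: linear_maps_H)
  have cl: "antipode H (U d a b) \<in> carrier A" for d a b
    by (rule linear_maps_closed[OF S]) simp
  have "pairing (U d a b) (antipode H y) = pairing (antipode H (U d a b)) y" for d a b
    by (rule A_maps_eq[OF linear_maps_compose[OF S pairing_linear(1)] pairing_linear(1) _ y])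
      (simp add: pairing_U_left pairing_U_right cl pf_antipode del: of_nat_add)
  then show ?thesis
    by (intro A_maps_eq[OF pairing_linear(2) linear_maps_compose[OF S pairing_linear(2)] _ x])
qed

text \<open>The coordinates are combinations of the functionals \<open>pf d a b\<close>, and these
  are values of the pairing; so \<open>Phi x\<close> determines all coordinates of
  \<open>x\<close>.\<close>

lemma Phi_inj: "inj_on Phi (carrier A)"
proof (rule inj_onI)
  fix x y assume x: "x \<in> carrier A" and y: "y \<in> carrier A" and eq: "Phi x = Phi y"
  have "pairing x z = pairing y z" if "z \<in> carrier A" for z
    using fun_cong[OF eq, of z] that by (simp add: Phi_def)
  then have "pf d a b x = pf d a b y" for d a b
    using x y by (metis pairing_U_right U_closed)
  then have "coord i x = coord i y" for i
    by (cases i) simp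
  then show "x = y"
    using basis_expansion[OF x] basis_expansion[OF y] by simp
qed

lemma Phi_surj:
  assumes f: "f \<in> carrier Dual" shows "f \<in> Phi ` carrier A"
proof -
  \<comment> \<open>The coefficients come from the inverse Gram matrix as in \<open>coord\<close>:
    pairing with \<open>g i\<close> is then the \<open>i\<close>-th coordinate functional times the
    value of \<open>f\<close> at the \<open>i\<close>-th basis element.\<close>
  define c where "c = (\<lambda>(d, e, i, k) j l. f (basis (d, e, i, k)) / (gram e i k d j l * of_nat (n * N)))"
  define g where "g = (\<lambda>(d, e, i, k). \<Oplus>\<^bsub>A\<^esub>j\<in>{..<n}. \<Oplus>\<^bsub>A\<^esub>l\<in>{..<N}. c (d, e, i, k) j l \<odot>\<^bsub>A\<^esub> basis (e, d, j, l))"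
  define x where "x = (\<Oplus>\<^bsub>A\<^esub>i\<in>index_set. g i)"
  have g: "g i \<in> carrier A" for i
    by (cases i) (auto simp: g_def intro!: A.finsum_closed simp del: basis.simps)
  have x: "x \<in> carrier A" unfolding x_def using g by (intro A.finsum_closed) auto
  have pg: "pairing (g i) y = f (basis i) * coord i y" if y: "y \<in> carrier A" for i y
  proof -
    obtain d e p q where i: "i = (d, e, p, q)" by (cases i)
    note l = pairing_linear(2)[of y]
    note sum = linear_maps_finsum[OF l A.kspace_axioms kspace_scalar_algebra]
    have bp: "pairing (basis j) y = basis_pf j y" for j
      using y by (cases j) (simp add: pairing_U_left)
    have "pairing (g i) y = (\<Sum>j<n. \<Sum>l<N. c i j l * basis_pf (e, d, j, l) y)"
      unfolding g_def i split
      by (subst sum, simp, simp add: A.finsum_closed del: basis.simps, subst sum, simp, simp del: basis.simps)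
        (simp add: finsum_scalar_algebra linear_maps_smult[OF l] bp del: basis.simps basis_pf.simps)
    then show ?thesis
      by (simp add: i c_def sum_distrib_left del: basis.simps basis_pf.simps)
  qed
  have "pairing x y = f y" if y: "y \<in> carrier A" for y
  proof -
    have "pairing x y = (\<Sum>i\<in>index_set. pairing (g i) y)"
      unfolding x_def
      by (subst linear_maps_finsum[OF pairing_linear(2) A.kspace_axioms kspace_scalar_algebra])
        (simp_all add: g finsum_scalar_algebra)
    also have "\<dots> = f y"
      by (simp add: pg[OF y] linear_expansion[OF Dual_linear[OF f] y] mult.commute del: coord.simps basis.simps)
    finally show ?thesis .
  qed
  then have "f = Phi x"
    by (intro Dual_eqI[OF f Phi_closed]) (simp add: Phi_def)
  then show ?thesis using x by blast
qed

lemma Phi_hopf_iso: "Phi \<in> hopf_isos H (dual_hopf H)"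
  unfolding hopf_isos_def
proof (intro CollectI conjI ballI)
  have S: "x \<in> carrier A \<Longrightarrow> antipode H x \<in> carrier A" for x
    using linear_maps_closed[OF antipode_linear] by simp
  have "Phi \<in> linear_maps H (dual_hopf H)"
    using Phi_linear by (simp add: linear_maps_def)
  then show "Phi \<in> algebra_maps H (dual_hopf H)"
  proof (rule algebra_mapsI)
    show "Phi \<one>\<^bsub>H\<^esub> = \<one>\<^bsub>dual_hopf H\<^esub>"
      by (auto simp: Phi_def pairing_one_left intro: restrict_ext)
  qed (simp only: H_simps Phi_mult)
  show "bij_betw Phi (carrier H) (carrier (dual_hopf H))"
    unfolding bij_betw_def using Phi_inj Phi_surj Phi_closed by (auto simp del: dual_algebra_simps)
  fix x assume x: "x \<in> carrier H"
  \<comment> \<open>The statement about \<open>comult\<close> uses the tensor square of the Hopf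
    record, whereas \<open>comult_Phi\<close> was proved over the underlying algebra record; the two
    tensor squares coincide.\<close>
  have "tensor_map (dual_hopf H) (dual_hopf H) = (tensor_map Dual Dual :: _ \<Rightarrow> _ \<Rightarrow> ('k, 'k suzuki, 'k suzuki) tensor \<Rightarrow> _)"
    using same_space.tensor_space_same[OF same_space_dual_hopf[of H]]
      same_space.pure_tensor_same[OF same_space_dual_hopf[of H]]
    by (simp add: fun_eq_iff tensor_map_def)
  then show "comult (dual_hopf H) (Phi x) = tensor_map (dual_hopf H) (dual_hopf H) Phi Phi (comult H x)"
    using comult_Phi x by simp
  show "counit (dual_hopf H) (Phi x) = counit H x"
    using x by (simp add: Phi_def pairing_one)
  show "antipode (dual_hopf H) (Phi x) = Phi (antipode H x)"
    unfolding dual_hopf_simps H_simps Phi_def[of "antipode H x"]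
    by (rule restrict_ext) (use x S in \<open>simp add: Phi_def pairing_antipode\<close>)
qed

lemma finite_dimensional_H: "finite_dimensional H"
  unfolding finite_dimensional_def
proof (intro exI[of _ "basis ` index_set"] conjI ballI)
  have inj: "inj_on basis index_set"
    by (rule inj_onI) (metis coord_basis one_neq_zero)
  fix x assume x: "x \<in> carrier H"
  \<comment> \<open>Coefficients are indexed by vectors in \<open>finite_dimensional\<close> but by
    quadruples in \<open>coord\<close>; injectivity of \<open>basis\<close> allows the change of
    index.\<close>
  define c where "c = (\<lambda>b. coord (the_inv_into index_set basis b) x)"
  have "x = (\<Oplus>\<^bsub>A\<^esub>i\<in>index_set. coord i x \<odot>\<^bsub>A\<^esub> basis i)"
    using basis_expansion x by simp
  also have "\<dots> = (\<Oplus>\<^bsub>A\<^esub>i\<in>index_set. c (basis i) \<odot>\<^bsub>A\<^esub> basis i)"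
    by (rule A.finsum_cong') (auto simp: c_def the_inv_into_f_f[OF inj] simp del: coord.simps)
  also have "\<dots> = (\<Oplus>\<^bsub>A\<^esub>b\<in>basis ` index_set. c b \<odot>\<^bsub>A\<^esub> b)"
    by (rule A.add.finprod_reindex[symmetric, OF _ inj]) auto
  finally show "\<exists>c. x = (\<Oplus>\<^bsub>H\<^esub>b\<in>basis ` index_set. c b \<odot>\<^bsub>H\<^esub> b)"
    by (auto simp: same_space.finsum_same[OF same_space_H])
qed auto

lemma self_dual_H: "self_dual H"
  unfolding self_dual_def using hopf_algebra_H finite_dimensional_H Phi_hopf_iso by blast

end

section \<open>Parameters of the pairing in the given field\<close>

section \<open>Choice of the roots of unity\<close>

lemma primitive_root_dvd:
  assumes "primitive_root m (z :: 'k::field)" "z ^ k = 1" shows "m dvd k"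
proof (rule ccontr)
  assume "\<not> m dvd k"
  have "z ^ k = z ^ (m * (k div m) + k mod m)" by simp
  also have "\<dots> = (z ^ m) ^ (k div m) * z ^ (k mod m)" by (simp only: power_add power_mult)
  finally have "z ^ (k mod m) = 1" using assms by (simp add: primitive_root_def)
  moreover have "0 < k mod m" "k mod m < m"
    using \<open>\<not> m dvd k\<close> assms(1) by (auto simp: primitive_root_def dvd_eq_mod_eq_0)
  ultimately show False using assms(1) by (auto simp: primitive_root_def)
qed

text \<open>For \<open>lam = -1\<close> take \<open>z ^ N\<close>, of order \<open>4 * n\<close>:
  its power \<open>2 * n\<close> is the nontrivial square root of 1. For \<open>lam = 1\<close> and
  \<open>n\<close> odd take \<open>z ^ (4 * N)\<close>, of order \<open>n\<close>; its fourth power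
  keeps that order because 4 is coprime to \<open>n\<close>.\<close>

lemma exists_xi:
  fixes z :: "'k::field"
  assumes z: "primitive_root (4 * n * N) z" and lam: "lam = -1 \<or> (lam = 1 \<and> odd n)"
  shows "\<exists>xi :: 'k. xi ^ (2 * n) = of_int lam \<and> (\<forall>k. xi ^ (4 * k) = 1 \<longrightarrow> n dvd k)"
proof (cases "lam = -1")
  case True
  have pos: "0 < n" "0 < N" and one: "z ^ (4 * n * N) = 1" using z by (auto simp: primitive_root_def)
  have "(z ^ (2 * n * N)) ^ 2 = 1" using one by (simp add: mult.commute mult.left_commute flip: power_mult)
  moreover have "z ^ (2 * n * N) \<noteq> 1" using z pos by (auto simp: primitive_root_def)
  ultimately have "z ^ (2 * n * N) = - 1" by (simp add: power2_eq_1_iff)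
  then have 1: "(z ^ N) ^ (2 * n) = of_int lam"
    using True by (simp add: mult.commute mult.left_commute flip: power_mult)
  have "n dvd k" if "(z ^ N) ^ (4 * k) = 1" for k
  proof -
    have "z ^ (N * (4 * k)) = 1" using that by (simp only: power_mult)
    then have "4 * n * N dvd N * (4 * k)" by (rule primitive_root_dvd[OF z])
    then have "(4 * N) * n dvd (4 * N) * k" by (simp only: ac_simps)
    then show ?thesis using pos by simp
  qed
  with 1 show ?thesis by blast
next
  case False
  then have lam: "lam = 1" "odd n" using lam by auto
  have pos: "0 < n" "0 < N" and one: "z ^ (4 * n * N) = 1" using z by (auto simp: primitive_root_def)
  have "(z ^ (4 * N)) ^ (2 * n) = (z ^ (4 * n * N)) ^ 2"
    by (simp add: mult.commute mult.left_commute flip: power_mult)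
  then have 1: "(z ^ (4 * N)) ^ (2 * n) = of_int lam" using one lam by simp
  have "n dvd k" if "(z ^ (4 * N)) ^ (4 * k) = 1" for k
  proof -
    have "z ^ ((4 * N) * (4 * k)) = 1" using that by (simp only: power_mult)
    then have "4 * n * N dvd (4 * N) * (4 * k)" by (rule primitive_root_dvd[OF z])
    then have "(4 * N) * n dvd (4 * N) * (4 * k)" by (simp only: ac_simps)
    then have "n dvd 4 * k" using pos by simp
    have "coprime n (2 :: nat)" using lam(2) by simp
    then have "coprime n (2 ^ 2)" by (rule coprime_power_right_iff[THEN iffD2, OF disjI1])
    from coprime_dvd_mult_right_iff[OF this, of k] show ?thesis
      using \<open>n dvd 4 * k\<close> by simp
  qed
  with 1 show ?thesis by blast
qed

theorem corollary6p9:
  fixes N n :: nat and lam :: int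
  assumes "N \<ge> 1" and "odd N" and "n \<ge> 2"
    and "lam = 1 \<or> lam = -1"
    and "\<not> CHAR('k::field) dvd 2 * n * N"
    and "\<exists>z :: 'k. primitive_root (4 * n * N) z"
    and "lam = -1 \<or> (lam = 1 \<and> odd n)"
  shows "self_dual (suzuki_hopf N n 1 lam :: ('k, 'k suzuki) hopf)"
proof -
  obtain z :: 'k where z: "primitive_root (4 * n * N) z" using assms(6) by blast
  obtain xi :: 'k where xi: "xi ^ (2 * n) = of_int lam" "\<And>k. xi ^ (4 * k) = 1 \<Longrightarrow> n dvd k"
    using exists_xi[OF z assms(7)] by blast
  \<comment> \<open>The power \<open>z ^ (4 * n)\<close> has order exactly \<open>N\<close> and
    serves as \<open>ze\<close>.\<close>
  have ze: "(z ^ (4 * n)) ^ N = 1"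
    using z by (simp add: primitive_root_def flip: power_mult)
  have ze_order: "N dvd k" if "(z ^ (4 * n)) ^ k = 1" for k
  proof -
    have "z ^ (4 * n * k) = 1" using that by (simp only: power_mult)
    then have "4 * n * N dvd 4 * n * k" by (rule primitive_root_dvd[OF z])
    then show ?thesis using assms(3) by simp
  qed
  \<comment> \<open>The condition on the characteristic makes the factor \<open>n * N\<close> from
    the orthogonality relation invertible.\<close>
  have "of_nat (n * N) \<noteq> (0 :: 'k)"
    using assms(5) by (metis dvd_mult mult.assoc of_nat_eq_0_iff_char_dvd)
  then interpret suzuki_roots N n lam "TYPE('k)" "z ^ (4 * n)" xi
    using assms xi ze ze_order by unfold_locales auto
  show ?thesis by (rule self_dual_H)
qed

end
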